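(* Let $q$ be a positive integer and let $\mathscr{B}\colon X\to^? q$ be a Borel CSP on a standard Borel space $X$. Suppose that \[ \mathsf{p}(\mathscr{B})\,(\mathsf{d}(\mathscr{B})+1)^{2}\,\leq\, e^{-2}. \] If $\tau$ is a compatible Polish topology on $X$, then $\mathscr{B}$ has a $\tau$-Baire-measurable solution.
   Context: $q\in\mathbb{N}$ is identified with $\{0,\dots,q-1\}$. CSPs. Let $X$ be a set and $q$ a positive integer. An $(X,q)$-constraint with domain a finite set $D\subseteq X$ is a set $B\subseteq q^D$ of functions $D\to q$; write $\mathrm{dom}(B)=D$. A function $f\colon X\to q$ violates $B$ if $f|_{\mathrm{dom}(B)}\in B$, and satisfies $B$ otherwise. A constraint satisfaction problem (CSP) $\mathscr{B}\colon X\to^? q$ is a set of $(X,q)$-constraints; a solution to it is a function $f\colon X\to q$ satisfying every $B\in\mathscr{B}$. Put $\mathbb{P}[B]=|B|/q^{|\mathrm{dom}(B)|}$, $\mathsf{p}(\mathscr{B})=\sup_{B\in\mathscr{B}}\mathbb{P}[B]$, and $\mathsf{d}(\mathscr{B})=\sup_{B\in\mathscr{B}}|\{B'\in\mathscr{B}: B'\neq B,\ \mathrm{dom}(B')\cap\mathrm{dom}(B)\neq\varnothing\}|$. Inequalities involving $\mathsf{d}(\mathscr{B})$ are understood to include $\mathsf{d}(\mathscr{B})<\infty$. Borel CSPs. For a standard Borel space $X$, the set $[X]^k$ of $k$-element subsets carries the quotient standard Borel structure from the $k$-tuples of distinct points, and the set $[X]^{<\infty}=\bigsqcup_k[X]^k$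 of finite subsets carries the disjoint union structure. The set of finite partial functions $X\rightharpoonup q$ (identified with their graphs) is a Borel subset of $[X\times q]^{<\infty}$. The set $\mathrm{Const}(X,q)$ of all $(X,q)$-constraints, viewed as finite sets of finite partial functions $X\rightharpoonup q$ with a common domain, is a Borel subset of the space of finite subsets of that space, hence is standard Borel. A CSP $\mathscr{B}\colon X\to^? q$ is Borel if it is a Borel subset of $\mathrm{Const}(X,q)$. A Polish topology on $X$ is compatible if it generates the Borel $\sigma$-algebra of $X$. A function $f\colon X\to q$ is $\tau$-Baire-measurable if each $f^{-1}(i)$, $0\le i<q$, has the Baire property with respect to $\tau$. *)

theory Defs
  imports "HOL-Analysis.Analysis"
begin

section \<open>Polish topologies, standard Borel spaces, the Baire property\<close>

definition polish_topology :: "'a topology \<Rightarrow> bool" where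
  "polish_topology \<tau> \<longleftrightarrow> completely_metrizable_space \<tau> \<and> separable_space \<tau>"

text \<open>A measurable space is given by a \<^typ>\<open>'a measure\<close>, of which only the carrier and the
  \<open>\<sigma>\<close>-algebra matter.\<close>

definition compatible_polish :: "'a measure \<Rightarrow> 'a topology \<Rightarrow> bool" where
  "compatible_polish X \<tau> \<longleftrightarrow> polish_topology \<tau> \<and> topspace \<tau> = space X \<and>
     sets X = sigma_sets (space X) {U. openin \<tau> U}"

definition standard_borel :: "'a measure \<Rightarrow> bool" where
  "standard_borel X \<longleftrightarrow> (\<exists>\<tau>. compatible_polish X \<tau>)"

definition nowhere_dense_in :: "'a topology \<Rightarrow> 'a set \<Rightarrow> bool" where
  "nowhere_dense_in \<tau> A \<longleftrightarrow> A \<subseteq> topspace \<tau> \<and> \<tau> interior_of (\<tau> closure_of A) = {}"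

definition meager_in :: "'a topology \<Rightarrow> 'a set \<Rightarrow> bool" where
  "meager_in \<tau> A \<longleftrightarrow> (\<exists>N :: nat \<Rightarrow> 'a set. (\<forall>n. nowhere_dense_in \<tau> (N n)) \<and> A = (\<Union>n. N n))"

definition baire_property :: "'a topology \<Rightarrow> 'a set \<Rightarrow> bool" where
  "baire_property \<tau> A \<longleftrightarrow> (\<exists>U. openin \<tau> U \<and> meager_in \<tau> ((A - U) \<union> (U - A)))"

definition baire_measurable :: "'a topology \<Rightarrow> nat \<Rightarrow> ('a \<Rightarrow> nat) \<Rightarrow> bool" where
  "baire_measurable \<tau> q f \<longleftrightarrow> (\<forall>i<q. baire_property \<tau> (f -` {i} \<inter> topspace \<tau>))"

section \<open>The Borel space of finite subsets\<close>

definition distinct_tuples :: "nat \<Rightarrow> 'a measure \<Rightarrow> (nat \<Rightarrow> 'a) measure" where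
  "distinct_tuples k X = restrict_space (Pi\<^sub>M {..<k} (\<lambda>_. X)) {x. inj_on x {..<k}}"

text \<open>A set of finite subsets is Borel iff, for every \<open>k\<close>, its part in \<open>[X]\<^sup>k\<close> is Borel in the
  quotient structure, i.e. its preimage under the map
  \<open>(x\<^sub>0, \<dots>, x\<^sub>k\<^sub>-\<^sub>1) \<mapsto> {x\<^sub>0, \<dots>, x\<^sub>k\<^sub>-\<^sub>1}\<close> on tuples of distinct points is Borel.\<close>

definition fin_subsets :: "'a measure \<Rightarrow> 'a set measure" where
  "fin_subsets X = sigma (Fpow (space X))
     {A. A \<subseteq> Fpow (space X) \<and>
         (\<forall>k. (\<lambda>x. x ` {..<k}) -` A \<inter> space (distinct_tuples k X) \<in> sets (distinct_tuples k X))}"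

lemma space_fin_subsets: "space (fin_subsets X) = Fpow (space X)"
  unfolding fin_subsets_def by (rule space_measure_of) auto

text \<open>The generating family above is itself a \<open>\<sigma>\<close>-algebra.\<close>

lemma sets_fin_subsets:
  "sets (fin_subsets X) =
     {A. A \<subseteq> Fpow (space X) \<and>
         (\<forall>k. (\<lambda>x. x ` {..<k}) -` A \<inter> space (distinct_tuples k X) \<in> sets (distinct_tuples k X))}"
  (is "_ = ?S")
proof -
  have im: "x ` {..<k} \<in> Fpow (space X)" if "x \<in> space (distinct_tuples k X)" for x k
    using that by (auto simp: distinct_tuples_def space_restrict_space space_PiM Fpow_def)
  have "sigma_algebra (Fpow (space X)) ?S"
    unfolding sigma_algebra_iff2
  proof (intro conjI ballI allI impI)
    show "?S \<subseteq> Pow (Fpow (space X))" by auto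
    show "{} \<in> ?S" by auto
  next
    fix A assume A: "A \<in> ?S"
    have "(\<lambda>x. x ` {..<k}) -` (Fpow (space X) - A) \<inter> space (distinct_tuples k X) =
        space (distinct_tuples k X) -
        ((\<lambda>x. x ` {..<k}) -` A \<inter> space (distinct_tuples k X))" for k
      using im by auto
    moreover have "space (distinct_tuples k X) -
        ((\<lambda>x. x ` {..<k}) -` A \<inter> space (distinct_tuples k X)) \<in> sets (distinct_tuples k X)" for k
      using A by (intro sets.compl_sets) blast
    ultimately have "(\<lambda>x. x ` {..<k}) -` (Fpow (space X) - A) \<inter> space (distinct_tuples k X)
        \<in> sets (distinct_tuples k X)" for k
      by (simp only:)
    then show "Fpow (space X) - A \<in> ?S" by (simp only: mem_Collect_eq) blast
  next
    fix A :: "nat \<Rightarrow> 'a set set" assume A: "range A \<subseteq> ?S"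
    have "(\<lambda>x. x ` {..<k}) -` (\<Union>i. A i) \<inter> space (distinct_tuples k X) =
        (\<Union>i. (\<lambda>x. x ` {..<k}) -` A i \<inter> space (distinct_tuples k X))" for k
      by auto
    moreover have "(\<Union>i. (\<lambda>x. x ` {..<k}) -` A i \<inter> space (distinct_tuples k X))
        \<in> sets (distinct_tuples k X)" for k
      using A by (intro sets.countable_UN) auto
    ultimately have "(\<lambda>x. x ` {..<k}) -` (\<Union>i. A i) \<inter> space (distinct_tuples k X)
        \<in> sets (distinct_tuples k X)" for k
      by (simp only:)
    moreover have "(\<Union>i. A i) \<subseteq> Fpow (space X)" using A by auto
    ultimately show "(\<Union>i. A i) \<in> ?S" by (simp only: mem_Collect_eq) blast
  qed
  then have "sigma_sets (Fpow (space X)) ?S = ?S"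
    by (rule sigma_algebra.sigma_sets_eq)
  moreover have "sets (fin_subsets X) = sigma_sets (Fpow (space X)) ?S"
    unfolding fin_subsets_def by (rule sets_measure_of) blast
  ultimately show ?thesis by (rule trans[rotated])
qed

section \<open>Constraints\<close>

text \<open>Partial functions are identified with their graphs, so a constraint has type
  \<^typ>\<open>('a \<times> nat) set set\<close>.\<close>

definition graph_funs :: "'a set \<Rightarrow> nat \<Rightarrow> ('a \<times> nat) set set" where
  "graph_funs D q = {g. g \<subseteq> D \<times> {..<q} \<and> single_valued g \<and> Domain g = D}"

definition fin_pfuns :: "'a set \<Rightarrow> nat \<Rightarrow> ('a \<times> nat) set set" where
  "fin_pfuns X q = (\<Union>D \<in> Fpow X. graph_funs D q)"

definition Const :: "'a set \<Rightarrow> nat \<Rightarrow> ('a \<times> nat) set set set" where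
  "Const X q = (\<Union>D \<in> Fpow X. Pow (graph_funs D q))"

text \<open>The domain of a constraint is recovered from its members. The empty constraint, which no
  function violates, does not determine a domain; by convention it is \<open>{}\<close>.\<close>

definition cdom :: "('a \<times> nat) set set \<Rightarrow> 'a set" where
  "cdom B = (\<Union>g \<in> B. Domain g)"

lemma cdom_eq:
  assumes "B \<subseteq> graph_funs D q" "B \<noteq> {}"
  shows "cdom B = D"
proof -
  have "Domain g = D" if "g \<in> B" for g
    using assms(1) that by (auto simp: graph_funs_def)
  then show ?thesis using assms(2) by (simp add: cdom_def)
qed

definition violates :: "('a \<Rightarrow> nat) \<Rightarrow> ('a \<times> nat) set set \<Rightarrow> bool" where
  "violates f B \<longleftrightarrow> (\<lambda>x. (x, f x)) ` cdom B \<in> B"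

definition is_solution ::
    "'a set \<Rightarrow> nat \<Rightarrow> ('a \<times> nat) set set set \<Rightarrow> ('a \<Rightarrow> nat) \<Rightarrow> bool" where
  "is_solution X q \<B> f \<longleftrightarrow> f \<in> X \<rightarrow> {..<q} \<and> (\<forall>B \<in> \<B>. \<not> violates f B)"

definition cprob :: "nat \<Rightarrow> ('a \<times> nat) set set \<Rightarrow> real" where
  "cprob q B = real (card B) / real q ^ card (cdom B)"

text \<open>Both suprema are taken in \<open>[0, \<infinity>]\<close>, so they are \<open>0\<close> for the empty CSP, and
  \<open>csp_d\<close> is \<open>\<infinity>\<close> if the neighborhoods have unbounded or infinite size.\<close>

definition csp_p :: "nat \<Rightarrow> ('a \<times> nat) set set set \<Rightarrow> ennreal" where
  "csp_p q \<B> = (SUP B \<in> \<B>. ennreal (cprob q B))"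

definition csp_d :: "('a \<times> nat) set set set \<Rightarrow> ennreal" where
  "csp_d \<B> = (SUP B \<in> \<B>. emeasure (count_space UNIV)
     {B' \<in> \<B>. B' \<noteq> B \<and> cdom B' \<inter> cdom B \<noteq> {}})"

section \<open>Borel CSPs\<close>

definition pfun_space :: "'a measure \<Rightarrow> nat \<Rightarrow> ('a \<times> nat) set measure" where
  "pfun_space X q = restrict_space (fin_subsets (X \<Otimes>\<^sub>M count_space {..<q})) (fin_pfuns (space X) q)"

definition const_space :: "'a measure \<Rightarrow> nat \<Rightarrow> ('a \<times> nat) set set measure" where
  "const_space X q = restrict_space (fin_subsets (pfun_space X q)) (Const (space X) q)"

lemma finite_graph_funs:
  assumes "finite D"
  shows "finite (graph_funs D q)"
  by (rule finite_subset[of _ "Pow (D \<times> {..<q})"]) (use assms in \<open>auto simp: graph_funs_def\<close>)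

lemma space_pfun_space: "space (pfun_space X q) = fin_pfuns (space X) q"
proof -
  have "g \<in> Fpow (space X \<times> {..<q})" if g: "g \<in> fin_pfuns (space X) q" for g
  proof -
    from g obtain D where D: "finite D" "D \<subseteq> space X" "g \<subseteq> D \<times> {..<q}"
      by (auto simp: fin_pfuns_def graph_funs_def Fpow_def)
    then have "finite g"
      by (meson finite_SigmaI finite_lessThan finite_subset)
    with D show ?thesis by (auto simp: Fpow_def)
  qed
  then show ?thesis
    by (auto simp: pfun_space_def space_restrict_space space_fin_subsets space_pair_measure)
qed

lemma space_const_space: "space (const_space X q) = Const (space X) q"
proof -
  have "B \<in> Fpow (fin_pfuns (space X) q)" if B: "B \<in> Const (space X) q" for B
  proof -
    from B obtain D where D: "D \<in> Fpow (space X)" "B \<subseteq> graph_funs D q"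
      by (auto simp: Const_def)
    then have "finite B"
      using finite_graph_funs[of D q] by (auto simp: Fpow_def intro: finite_subset)
    with D show ?thesis by (auto simp: Fpow_def fin_pfuns_def)
  qed
  then show ?thesis
    by (auto simp: const_space_def space_restrict_space space_fin_subsets space_pfun_space)
qed

definition is_csp :: "'a set \<Rightarrow> nat \<Rightarrow> ('a \<times> nat) set set set \<Rightarrow> bool" where
  "is_csp X q \<B> \<longleftrightarrow> \<B> \<subseteq> Const X q"

definition borel_csp :: "'a measure \<Rightarrow> nat \<Rightarrow> ('a \<times> nat) set set set \<Rightarrow> bool" where
  "borel_csp X q \<B> \<longleftrightarrow> is_csp (space X) q \<B> \<and> \<B> \<in> sets (const_space X q)"

end

theory Submission
  imports Defs
begin

text \<open>Put \<open>\<theta> = 1 / (e (d + 1))\<close>, the threshold of the symmetric Local Lemma. The hypothesis says that every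
constraint is violated with probability at most \<open>\<theta>\<^sup>2\<close>, and this leaves room to apply the Local Lemma
twice. Join two points of \<open>X\<close> by an edge if some constraint has both in its domain, and suppose that
\<open>X\<close> is the union of two sets \<open>U\<close> and \<open>X - U\<close> each of which induces a graph with finite components.
Colour \<open>U\<close> first, and call a colouring of \<open>U\<close> risky for \<open>B\<close> if it raises the conditional
probability of violating \<open>B\<close> to \<open>\<theta>\<close> or more. By Markov's inequality a random colouring is risky
for \<open>B\<close> with probability at most \<open>\<theta>\<^sup>2 / \<theta> = \<theta>\<close> (\<open>card_risky\<close>), so the Local Lemma provides a colouring
of \<open>U\<close> that is risky for no constraint. Given that colouring, a random colouring of \<open>X - U\<close>
violates \<open>B\<close> with probability less than \<open>\<theta>\<close> (\<open>card_violating\<close>), and the Local Lemma applies again.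
In both rounds the components are finite, and therefore the colouring can be chosen on each
component separately and measurably, as the first member of a countable list of functions that
succeeds there (\<open>measurable_lovasz_local_lemma\<close>).

The partition exists only away from a meager union of components (\<open>ex_generic_colouring\<close>). It is
the union of an increasing sequence of partial two-colourings with finite components. Any finite
set of points can be sealed off, that is, surrounded inside a finite region, by finitely many out
of countably many possible extension steps; a Baire category argument then finds one sequence of
steps that seals off whole balls around almost every point. On the exceptional set the
colouring may be arbitrary, and the infinite Local Lemma provides one that satisfies the constraints.

Measurability is the other issue, since all these constructions take neighbourhoods of sets in the
graph, which are projections of Borel sets with finite fibres. Let \<open>\<A>\<close> be the \<open>\<sigma>\<close>-algebra generated by the
analytic sets. Its members have the Baire property (\<open>baire_property_projection\<close>), and projections along a Borel
set with finite fibres do not lead out of it (\<open>finite_fibre_projection\<close>). Hence every set in the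
construction can be kept in \<open>\<A>\<close>.\<close>

section \<open>Meager sets and the Baire property\<close>

lemma nowhere_dense_in_subset:
  "nowhere_dense_in \<tau> A \<Longrightarrow> B \<subseteq> A \<Longrightarrow> nowhere_dense_in \<tau> B"
  unfolding nowhere_dense_in_def
  by (metis closure_of_mono interior_of_mono subset_empty subset_trans)

lemma meager_inI:
  assumes "\<And>n::nat. nowhere_dense_in \<tau> (N n)" "A \<subseteq> (\<Union>n. N n)"
  shows "meager_in \<tau> A"
  unfolding meager_in_def
proof (intro exI[of _ "\<lambda>n. N n \<inter> A"] conjI allI)
  show "nowhere_dense_in \<tau> (N n \<inter> A)" for n
    using assms(1) by (rule nowhere_dense_in_subset) auto
  show "A = (\<Union>n. N n \<inter> A)" using assms(2) by auto
qed

lemma nowhere_dense_imp_meager_in: "nowhere_dense_in \<tau> A \<Longrightarrow> meager_in \<tau> A"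
  by (rule meager_inI[of _ "\<lambda>_. A"]) auto

lemma meager_in_subset: "meager_in \<tau> A \<Longrightarrow> B \<subseteq> A \<Longrightarrow> meager_in \<tau> B"
  unfolding meager_in_def[of _ A] by (auto intro: meager_inI)

lemma meager_in_subset_topspace: "meager_in \<tau> A \<Longrightarrow> A \<subseteq> topspace \<tau>"
  unfolding meager_in_def nowhere_dense_in_def by blast

lemma meager_in_UN:
  assumes "\<And>n::nat. meager_in \<tau> (A n)" shows "meager_in \<tau> (\<Union>n. A n)"
proof -
  obtain N where N: "\<And>n m::nat. nowhere_dense_in \<tau> (N n m)" "\<And>n. A n = (\<Union>m. N n m)"
    using assms unfolding meager_in_def by metis
  show ?thesis
  proof (rule meager_inI[of _ "\<lambda>k. N (fst (prod_decode k)) (snd (prod_decode k))"])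
    show "(\<Union>n. A n) \<subseteq> (\<Union>k. N (fst (prod_decode k)) (snd (prod_decode k)))"
    proof
      fix x assume "x \<in> (\<Union>n. A n)"
      then obtain n m where "x \<in> N n m" using N(2) by auto
      then show "x \<in> (\<Union>k. N (fst (prod_decode k)) (snd (prod_decode k)))"
        by (intro UN_I[of "prod_encode (n, m)"]) auto
    qed
  qed (rule N)
qed

lemma meager_in_empty: "meager_in \<tau> {}"
  by (rule nowhere_dense_imp_meager_in) (simp add: nowhere_dense_in_def)

lemma meager_in_UN_countable:
  assumes "countable I" "\<And>i. i \<in> I \<Longrightarrow> meager_in \<tau> (A i)" shows "meager_in \<tau> (\<Union>i\<in>I. A i)"
proof (cases "I = {}")
  case False
  have "meager_in \<tau> (\<Union>n::nat. A (from_nat_into I n))"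
    by (rule meager_in_UN) (use assms False in \<open>auto simp: from_nat_into\<close>)
  moreover have "(\<Union>n::nat. A (from_nat_into I n)) = (\<Union>i\<in>I. A i)"
    using range_from_nat_into[OF False assms(1)] by (metis image_image)
  ultimately show ?thesis by simp
qed (simp add: meager_in_empty)

lemma meager_in_Un: "meager_in \<tau> A \<Longrightarrow> meager_in \<tau> B \<Longrightarrow> meager_in \<tau> (A \<union> B)"
  using meager_in_UN_countable[of "{A, B}" \<tau> "\<lambda>x. x"] by auto

lemma meager_in_boundary_of_open:
  assumes "openin \<tau> U" shows "meager_in \<tau> (\<tau> closure_of U - U)"
proof (rule nowhere_dense_imp_meager_in)
  have cl: "closedin \<tau> (\<tau> closure_of U - U)"
    using assms by (simp add: closedin_diff)
  moreover have "\<tau> interior_of (\<tau> closure_of U - U) = {}"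
  proof (rule ccontr)
    assume "\<tau> interior_of (\<tau> closure_of U - U) \<noteq> {}"
    then obtain x where x: "x \<in> \<tau> interior_of (\<tau> closure_of U - U)" by auto
    let ?V = "\<tau> interior_of (\<tau> closure_of U - U)"
    have V: "openin \<tau> ?V" "?V \<subseteq> \<tau> closure_of U - U"
      by (simp_all add: interior_of_subset)
    then have "x \<in> \<tau> closure_of U" using x by auto
    then obtain y where "y \<in> U" "y \<in> ?V" using V x by (auto simp: in_closure_of)
    then show False using V by auto
  qed
  ultimately show "nowhere_dense_in \<tau> (\<tau> closure_of U - U)"
    by (auto simp: nowhere_dense_in_def closure_of_closedin closedin_subset)
qed

lemma baire_property_subset: "baire_property \<tau> A \<Longrightarrow> A \<subseteq> topspace \<tau>"
  unfolding baire_property_def using meager_in_subset_topspace openin_subset by blast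

lemma baire_property_open: "openin \<tau> U \<Longrightarrow> baire_property \<tau> U"
  unfolding baire_property_def by (rule exI[of _ U]) (simp add: meager_in_empty)

lemma baire_property_cong:
  assumes "baire_property \<tau> A" "meager_in \<tau> ((A - B) \<union> (B - A))"
  shows "baire_property \<tau> B"
proof -
  obtain U where U: "openin \<tau> U" "meager_in \<tau> ((A - U) \<union> (U - A))"
    using assms(1) by (auto simp: baire_property_def)
  have "meager_in \<tau> ((B - U) \<union> (U - B))"
    by (rule meager_in_subset[OF meager_in_Un[OF U(2) assms(2)]]) auto
  then show ?thesis using U(1) by (auto simp: baire_property_def)
qed

lemma baire_property_meager: "meager_in \<tau> A \<Longrightarrow> baire_property \<tau> A"
  by (rule baire_property_cong[OF baire_property_open[of \<tau> "{}"]]) auto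

lemma baire_property_compl:
  assumes "baire_property \<tau> A" shows "baire_property \<tau> (topspace \<tau> - A)"
proof -
  obtain U where U: "openin \<tau> U" "meager_in \<tau> ((A - U) \<union> (U - A))"
    using assms by (auto simp: baire_property_def)
  have "meager_in \<tau> (((A - U) \<union> (U - A)) \<union> (\<tau> closure_of U - U))" (is "meager_in _ ?M")
    by (intro meager_in_Un U meager_in_boundary_of_open)
  moreover have "(topspace \<tau> - A - (topspace \<tau> - \<tau> closure_of U)) \<union>
      ((topspace \<tau> - \<tau> closure_of U) - (topspace \<tau> - A)) \<subseteq> ?M"
    using closure_of_subset[OF openin_subset[OF U(1)]] by auto
  ultimately have "meager_in \<tau> ((topspace \<tau> - A - (topspace \<tau> - \<tau> closure_of U)) \<union>
      ((topspace \<tau> - \<tau> closure_of U) - (topspace \<tau> - A)))"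
    by (rule meager_in_subset)
  then show ?thesis unfolding baire_property_def
    by (intro exI[of _ "topspace \<tau> - \<tau> closure_of U"]) auto
qed

lemma baire_property_UN:
  assumes "\<And>n::nat. baire_property \<tau> (A n)" shows "baire_property \<tau> (\<Union>n. A n)"
proof -
  obtain U where U: "\<And>n. openin \<tau> (U n)" "\<And>n. meager_in \<tau> ((A n - U n) \<union> (U n - A n))"
    using assms unfolding baire_property_def by metis
  have "meager_in \<tau> (\<Union>n. (A n - U n) \<union> (U n - A n))" (is "meager_in _ ?M")
    by (rule meager_in_UN) (rule U)
  then have "meager_in \<tau> (((\<Union>n. A n) - (\<Union>n. U n)) \<union> ((\<Union>n. U n) - (\<Union>n. A n)))"
    by (rule meager_in_subset) blast
  then show ?thesis unfolding baire_property_def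
    by (intro exI[of _ "\<Union>n. U n"]) (use U in auto)
qed

lemma sigma_algebra_baire_property: "sigma_algebra (topspace \<tau>) {A. baire_property \<tau> A}"
  unfolding sigma_algebra_iff2
proof (intro conjI ballI allI impI)
  show "{A. baire_property \<tau> A} \<subseteq> Pow (topspace \<tau>)"
    using baire_property_subset by auto
  show "{} \<in> {A. baire_property \<tau> A}" by (simp add: baire_property_meager meager_in_empty)
next
  fix A :: "nat \<Rightarrow> 'a set" assume "range A \<subseteq> {A. baire_property \<tau> A}"
  then show "(\<Union>i. A i) \<in> {A. baire_property \<tau> A}" by (auto intro: baire_property_UN)
qed (auto intro: baire_property_compl)

section \<open>Polish spaces\<close>

locale polish =
  fixes X :: "'a measure" and \<tau> :: "'a topology"
  assumes compat: "compatible_polish X \<tau>"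
begin

lemma topspace_eq: "topspace \<tau> = space X"
  and sets_X: "sets X = sigma_sets (space X) {U. openin \<tau> U}"
  using compat by (auto simp: compatible_polish_def)

lemma completely_metrizable: "completely_metrizable_space \<tau>"
  using compat by (simp add: compatible_polish_def polish_topology_def)

lemma not_meager_open:
  assumes "openin \<tau> U" "U \<noteq> {}" shows "\<not> meager_in \<tau> U"
proof
  assume "meager_in \<tau> U"
  then obtain N :: "nat \<Rightarrow> 'a set" where N: "\<And>n. nowhere_dense_in \<tau> (N n)" "U = (\<Union>n. N n)"
    by (auto simp: meager_in_def)
  have "\<tau> interior_of \<Union>(range (\<lambda>n. \<tau> closure_of N n)) = {}"
    by (rule Baire_category_alt)
      (use completely_metrizable N(1) in \<open>auto simp: nowhere_dense_in_def\<close>)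
  moreover have "U \<subseteq> \<Union>(range (\<lambda>n. \<tau> closure_of N n))"
    using N closure_of_subset[of "N _" \<tau>] by (force simp: nowhere_dense_in_def)
  ultimately show False using assms interior_of_maximal by blast
qed

lemma ex_base:
  "\<exists>b :: nat \<Rightarrow> 'a set. (\<forall>n. openin \<tau> (b n)) \<and>
     (\<forall>U x. openin \<tau> U \<longrightarrow> x \<in> U \<longrightarrow> (\<exists>n. x \<in> b n \<and> b n \<subseteq> U))"
proof -
  obtain M d where "Metric_space M d" and \<tau>: "\<tau> = Metric_space.mtopology M d"
    using completely_metrizable by (auto simp: completely_metrizable_space_def)
  then interpret Metric_space M d by simp
  obtain C where C: "countable C" "C \<subseteq> M" "mtopology closure_of C = M"
    using compat \<tau> by (auto simp: compatible_polish_def polish_topology_def separable_space_def)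
  define \<B> where "\<B> = insert {} ((\<lambda>(c, n). mball c (inverse (Suc n))) ` (C \<times> (UNIV :: nat set)))"
  have cnt: "countable \<B>" unfolding \<B>_def using C by auto
  have base: "\<exists>V\<in>\<B>. x \<in> V \<and> V \<subseteq> U" if U: "openin \<tau> U" "x \<in> U" for U x
  proof -
    obtain r where r: "r > 0" "mball x r \<subseteq> U" and x: "x \<in> M"
      using U unfolding \<tau> openin_mtopology by blast
    obtain n where n: "inverse (real (Suc n)) < r / 2"
      using reals_Archimedean[of "r/2"] r by auto
    have "x \<in> mtopology closure_of C" using C x by simp
    then have "\<forall>r>0. \<exists>c\<in>C. c \<in> mball x r" unfolding metric_closure_of by blast
    then obtain c where c: "c \<in> C" "c \<in> mball x (inverse (Suc n))"
      using inverse_positive_iff_positive of_nat_0_less_iff zero_less_Suc by metis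
    have "x \<in> mball c (inverse (Suc n))" using c by (simp add: commute)
    moreover have "mball c (inverse (Suc n)) \<subseteq> U"
    proof
      fix y assume y: "y \<in> mball c (inverse (Suc n))"
      have "d x y \<le> d x c + d c y" using x y c C by (auto intro: triangle)
      also have "\<dots> < r" using y c n by (auto simp: )
      finally show "y \<in> U" using r x y by auto
    qed
    ultimately show ?thesis using c unfolding \<B>_def
      by (intro bexI[of _ "mball c (inverse (Suc n))"]) auto
  qed
  have ne: "\<B> \<noteq> {}" by (auto simp: \<B>_def)
  have op: "\<forall>V\<in>\<B>. openin \<tau> V" by (auto simp: \<B>_def \<tau>)
  show ?thesis
  proof (intro exI[of _ "from_nat_into \<B>"] conjI allI impI)
    show "openin \<tau> (from_nat_into \<B> n)" for n using op ne by (simp add: from_nat_into)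
  next
    fix U x assume "openin \<tau> U" "x \<in> U"
    then obtain V where "V \<in> \<B>" "x \<in> V" "V \<subseteq> U" using base by blast
    moreover then obtain n where "from_nat_into \<B> n = V"
      using from_nat_into_surj[OF cnt] by blast
    ultimately show "\<exists>n. x \<in> from_nat_into \<B> n \<and> from_nat_into \<B> n \<subseteq> U" by blast
  qed
qed

definition basic :: "nat \<Rightarrow> 'a set" where
  "basic = (SOME b. (\<forall>n. openin \<tau> (b n)) \<and>
     (\<forall>U x. openin \<tau> U \<longrightarrow> x \<in> U \<longrightarrow> (\<exists>n. x \<in> b n \<and> b n \<subseteq> U)))"

lemma basic_spec:
  "(\<forall>n. openin \<tau> (basic n)) \<and>
     (\<forall>U x. openin \<tau> U \<longrightarrow> x \<in> U \<longrightarrow> (\<exists>n. x \<in> basic n \<and> basic n \<subseteq> U))"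
  unfolding basic_def by (rule someI_ex[OF ex_base])

lemma openin_basic: "openin \<tau> (basic n)"
  and ex_basic: "openin \<tau> U \<Longrightarrow> x \<in> U \<Longrightarrow> \<exists>n. x \<in> basic n \<and> basic n \<subseteq> U"
  using basic_spec by auto

lemma basic_subset: "basic n \<subseteq> space X"
  using openin_subset[OF openin_basic] topspace_eq by simp

lemma open_in_sets_X: "openin \<tau> U \<Longrightarrow> U \<in> sets X"
  by (simp add: sets_X)

lemma basic_in_sets: "basic n \<in> sets X"
  by (rule open_in_sets_X) (rule openin_basic)

text \<open>This is how one point is told apart from finitely many others in a countable manner.\<close>

lemma ex_basic_isolating:
  assumes "finite F" "x \<in> space X" "x \<notin> F"
  shows "\<exists>n. x \<in> basic n \<and> basic n \<inter> F = {}"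
proof -
  have "Hausdorff_space \<tau>" using completely_metrizable
    by (simp add: completely_metrizable_imp_metrizable_space metrizable_imp_Hausdorff_space)
  then have "closedin \<tau> (F \<inter> space X)"
    using assms topspace_eq by (intro closedin_Hausdorff_finite) auto
  then have "openin \<tau> (space X - (F \<inter> space X))" unfolding topspace_eq[symmetric] by blast
  then obtain n where "x \<in> basic n" "basic n \<subseteq> space X - (F \<inter> space X)"
    using ex_basic assms by blast
  then show ?thesis by blast
qed

section \<open>The Baire property of projections\<close>

text \<open>The largest open set such that \<open>A\<close> is nonmeager in each of its nonempty open subsets.\<close>

definition heavy :: "'a set \<Rightarrow> 'a set" where
  "heavy A = space X - \<tau> closure_of (\<Union>{U. openin \<tau> U \<and> meager_in \<tau> (A \<inter> U)})"

lemma openin_heavy: "openin \<tau> (heavy A)"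
  unfolding heavy_def topspace_eq[symmetric] by (intro openin_diff) auto

text \<open>The open sets in which \<open>A\<close> is meager may be replaced by basic ones, so that \<open>A\<close> is meager in
their union by countability; the rest of \<open>A - heavy A\<close> lies in the boundary of that union.\<close>

lemma meager_light_part:
  assumes "A \<subseteq> space X" shows "meager_in \<tau> (A - heavy A)"
proof -
  let ?U = "\<Union>{U. openin \<tau> U \<and> meager_in \<tau> (A \<inter> U)}"
  have op: "openin \<tau> ?U" by auto
  have "meager_in \<tau> (\<Union>n\<in>{n. meager_in \<tau> (A \<inter> basic n)}. A \<inter> basic n)" (is "meager_in _ ?M")
    by (rule meager_in_UN_countable) auto
  then have "meager_in \<tau> (?M \<union> (\<tau> closure_of ?U - ?U))"
    by (intro meager_in_Un meager_in_boundary_of_open op)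
  moreover have "A \<inter> ?U \<subseteq> ?M"
  proof
    fix x assume "x \<in> A \<inter> ?U"
    then obtain U where U: "x \<in> A" "x \<in> U" "openin \<tau> U" "meager_in \<tau> (A \<inter> U)" by auto
    then obtain n where "x \<in> basic n" "basic n \<subseteq> U" using ex_basic by blast
    moreover then have "meager_in \<tau> (A \<inter> basic n)"
      by (intro meager_in_subset[OF U(4)]) auto
    ultimately show "x \<in> ?M" using U by auto
  qed
  then have "A - heavy A \<subseteq> ?M \<union> (\<tau> closure_of ?U - ?U)"
    using assms unfolding heavy_def by auto
  ultimately show ?thesis by (rule meager_in_subset)
qed

lemma not_meager_heavy:
  assumes "openin \<tau> U" "U \<inter> heavy A \<noteq> {}" shows "\<not> meager_in \<tau> (A \<inter> U)"
proof
  assume "meager_in \<tau> (A \<inter> U)"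
  then have "U \<subseteq> \<Union>{U. openin \<tau> U \<and> meager_in \<tau> (A \<inter> U)}" using assms by auto
  also have "\<dots> \<subseteq> \<tau> closure_of \<dots>"
    by (rule closure_of_subset) (auto dest: openin_subset)
  finally show False using assms unfolding heavy_def by auto
qed

lemma heavy_subset_closure: "heavy A \<subseteq> \<tau> closure_of A"
proof
  fix x assume x: "x \<in> heavy A"
  have "\<exists>y. y \<in> A \<and> y \<in> U" if "x \<in> U" "openin \<tau> U" for U
    using not_meager_heavy[of U A] that x meager_in_empty by (metis Int_emptyI disjoint_iff)
  then show "x \<in> \<tau> closure_of A" using x by (auto simp: in_closure_of heavy_def topspace_eq)
qed

text \<open>An open set that misses every \<open>heavy (A n)\<close> meets each \<open>A n\<close> in a meager set, hence cannot meet
\<open>heavy (\<Union>n. A n)\<close>. So the difference lies in the boundary of the open set \<open>\<Union>n. heavy (A n)\<close>.\<close>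

lemma meager_heavy_UN:
  fixes A :: "nat \<Rightarrow> 'a set"
  assumes "\<And>n. A n \<subseteq> space X"
  shows "meager_in \<tau> (heavy (\<Union>n. A n) - (\<Union>n. heavy (A n)))"
proof (rule meager_in_subset)
  let ?O = "\<Union>n. heavy (A n)"
  show "meager_in \<tau> (\<tau> closure_of ?O - ?O)"
    by (rule meager_in_boundary_of_open) (use openin_heavy in auto)
  have "heavy (\<Union>n. A n) \<subseteq> \<tau> closure_of ?O"
  proof
    fix x assume x: "x \<in> heavy (\<Union>n. A n)"
    have "\<exists>y. y \<in> ?O \<and> y \<in> U" if U: "x \<in> U" "openin \<tau> U" for U
    proof (rule ccontr)
      assume no: "\<nexists>y. y \<in> ?O \<and> y \<in> U"
      have "meager_in \<tau> (\<Union>n. A n - heavy (A n))"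
        by (rule meager_in_UN) (use assms meager_light_part in auto)
      then have "meager_in \<tau> ((\<Union>n. A n) \<inter> U)"
        by (rule meager_in_subset) (use no in auto)
      then show False using not_meager_heavy[OF U(2)] U x by blast
    qed
    then show "x \<in> \<tau> closure_of ?O" using x by (auto simp: in_closure_of heavy_def topspace_eq)
  qed
  then show "heavy (\<Union>n. A n) - ?O \<subseteq> \<tau> closure_of ?O - ?O" by auto
qed

text \<open>The set \<open>A []\<close> differs from the open set \<open>heavy (A [])\<close> by a meager set. In one direction this is
\<open>meager_light_part\<close>. In the other, a point of \<open>heavy (A [])\<close> that avoids the countably many meager
sets of \<open>meager_heavy_UN\<close> lies in \<open>heavy (A s)\<close> for all initial segments \<open>s\<close> of some branch, and
\<open>heavy (A s)\<close> is contained in the closure of \<open>A s\<close>.\<close>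

lemma baire_property_scheme:
  fixes A :: "nat list \<Rightarrow> 'a set"
  assumes sub: "\<And>s. A s \<subseteq> space X"
    and split: "\<And>s. A s = (\<Union>k. A (s @ [k]))"
    and lim: "\<And>x \<rho>. x \<in> space X \<Longrightarrow> (\<And>n. x \<in> \<tau> closure_of (A (map \<rho> [0..<n]))) \<Longrightarrow> x \<in> A []"
  shows "baire_property \<tau> (A [])"
proof -
  define M where "M = (\<Union>s. heavy (A s) - (\<Union>k. heavy (A (s @ [k]))))"
  have "meager_in \<tau> (\<Union>s. heavy (A s) - (\<Union>k. heavy (A (s @ [k]))))"
  proof (rule meager_in_UN_countable)
    fix s
    have "meager_in \<tau> (heavy (\<Union>k. A (s @ [k])) - (\<Union>k. heavy (A (s @ [k]))))"
      by (rule meager_heavy_UN) (rule sub)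
    then show "meager_in \<tau> (heavy (A s) - (\<Union>k. heavy (A (s @ [k]))))"
      using split by metis
  qed auto
  then have M: "meager_in \<tau> M" by (simp add: M_def)
  have "heavy (A []) - M \<subseteq> A []"
  proof
    fix x assume x: "x \<in> heavy (A []) - M"
    have step: "\<exists>k. x \<in> heavy (A (s @ [k]))" if "x \<in> heavy (A s)" for s
      using x that by (auto simp: M_def)
    define g where "g s = s @ [SOME k. x \<in> heavy (A (s @ [k]))]" for s
    define t where "t n = (g ^^ n) []" for n
    have t: "x \<in> heavy (A (t n)) \<and> length (t n) = n" for n
    proof (induction n)
      case 0 then show ?case using x by (simp add: t_def)
    next
      case (Suc n)
      have "x \<in> heavy (A (g (t n)))"
        unfolding g_def using someI_ex[OF step] Suc by blast
      then show ?case using Suc by (simp add: t_def g_def)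
    qed
    have tS: "t (Suc n) = t n @ [last (t (Suc n))]" for n by (simp add: t_def g_def)
    define \<rho> where "\<rho> n = last (t (Suc n))" for n
    have "map \<rho> [0..<n] = t n" for n
    proof (induction n)
      case (Suc n) then show ?case using tS[of n] by (simp add: \<rho>_def)
    qed (use t[of 0] in auto)
    then have "x \<in> \<tau> closure_of (A (map \<rho> [0..<n]))" for n
      using t heavy_subset_closure by auto
    then show "x \<in> A []" using lim[of x \<rho>] x by (auto simp: heavy_def)
  qed
  then have "meager_in \<tau> ((heavy (A []) - A []) \<union> (A [] - heavy (A [])))"
    by (intro meager_in_subset[OF meager_in_Un[OF M meager_light_part[OF sub[of "[]"]]]]) auto
  then show ?thesis using baire_property_cong baire_property_open openin_heavy by blast
qed

abbreviation W :: "(nat \<Rightarrow> 'a) measure" where "W \<equiv> Pi\<^sub>M UNIV (\<lambda>_. X)"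

lemma space_W: "space W = {w. \<forall>i. w i \<in> space X}"
  by (auto simp: space_PiM)

text \<open>This says that \<open>P\<close> is a closed subset of \<open>X\<^sup>\<omega> \<times> \<omega>\<^sup>\<omega>\<close>, where \<open>\<omega>\<close> is discrete, in terms of
coordinatewise convergence of sequences.\<close>

definition seq_closed :: "((nat \<Rightarrow> 'a) \<Rightarrow> (nat \<Rightarrow> nat) \<Rightarrow> bool) \<Rightarrow> bool" where
  "seq_closed P \<longleftrightarrow> (\<forall>w \<sigma> w' \<sigma>'. (\<forall>\<^sub>F n in sequentially. P (w n) (\<sigma> n)) \<longrightarrow>
     (\<forall>i. limitin \<tau> (\<lambda>n. w n i) (w' i) sequentially) \<longrightarrow>
     (\<forall>i. \<forall>\<^sub>F n in sequentially. \<sigma> n i = \<sigma>' i) \<longrightarrow> P w' \<sigma>')"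

lemma seq_closedD:
  assumes "seq_closed P" "\<forall>\<^sub>F n in sequentially. P (w n) (\<sigma> n)"
    "\<And>i. limitin \<tau> (\<lambda>n. w n i) (w' i) sequentially"
    "\<And>i. \<forall>\<^sub>F n in sequentially. \<sigma> n i = \<sigma>' i"
  shows "P w' \<sigma>'"
  using assms unfolding seq_closed_def by blast

definition closed_proj :: "(nat \<Rightarrow> 'a) set \<Rightarrow> bool" where
  "closed_proj E \<longleftrightarrow> (\<exists>P. seq_closed P \<and> E = {w \<in> space W. \<exists>\<sigma>. P w \<sigma>})"

lemma closed_proj_closedin:
  assumes "closedin \<tau> C" shows "closed_proj {w \<in> space W. w i \<in> C}"
proof -
  have "seq_closed (\<lambda>w _. w i \<in> C)"
    unfolding seq_closed_def
  proof (intro allI impI)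
    fix w :: "nat \<Rightarrow> nat \<Rightarrow> 'a" and w' :: "nat \<Rightarrow> 'a"
    assume "\<forall>\<^sub>F n in sequentially. w n i \<in> C" "\<forall>i. limitin \<tau> (\<lambda>n. w n i) (w' i) sequentially"
    then show "w' i \<in> C" using assms
      by (intro limitin_closedin[of \<tau> "\<lambda>n. w n i" "w' i" sequentially C]) auto
  qed
  then show ?thesis unfolding closed_proj_def by (intro exI[of _ "\<lambda>w _. w i \<in> C"]) auto
qed

text \<open>The number \<open>\<sigma> 0\<close> selects the member of the union, and the rest of \<open>\<sigma>\<close> is a witness for it.\<close>

lemma closed_proj_UN:
  fixes E :: "nat \<Rightarrow> (nat \<Rightarrow> 'a) set"
  assumes "\<And>n. closed_proj (E n)" shows "closed_proj (\<Union>n. E n)"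
proof -
  have "\<forall>n. \<exists>P. seq_closed P \<and> E n = {w \<in> space W. \<exists>\<sigma>. P w \<sigma>}"
    using assms unfolding closed_proj_def by (rule allI)
  from choice[OF this] obtain P where
    "\<forall>n. seq_closed (P n) \<and> E n = {w \<in> space W. \<exists>\<sigma>. P n w \<sigma>}" ..
  then have P: "\<And>n. seq_closed (P n)" "\<And>n. E n = {w \<in> space W. \<exists>\<sigma>. P n w \<sigma>}"
    by auto
  define Q where "Q w \<sigma> = P (\<sigma> 0) w (\<lambda>n. \<sigma> (Suc n))" for w \<sigma>
  have "seq_closed Q"
    unfolding seq_closed_def
  proof (intro allI impI)
    fix w \<sigma> w' \<sigma>'
    assume *: "\<forall>\<^sub>F n in sequentially. Q (w n) (\<sigma> n)"
      "\<forall>i. limitin \<tau> (\<lambda>n. w n i) (w' i) sequentially"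
      "\<forall>i. \<forall>\<^sub>F n in sequentially. \<sigma> n i = \<sigma>' (i :: nat)"
    have "\<forall>\<^sub>F n in sequentially. P (\<sigma>' 0) (w n) (\<lambda>j. \<sigma> n (Suc j))"
      using *(1) *(3)[rule_format, of 0] by eventually_elim (simp add: Q_def)
    then show "Q w' \<sigma>'" unfolding Q_def
      by (rule seq_closedD[OF P(1)]) (use * in auto)
  qed
  moreover have "(\<Union>n. E n) = {w \<in> space W. \<exists>\<sigma>. Q w \<sigma>}"
  proof (intro equalityI subsetI)
    fix w assume "w \<in> (\<Union>n. E n)"
    then obtain n \<sigma> where "w \<in> space W" "P n w \<sigma>" using P(2) by auto
    then have "Q w (case_nat n \<sigma>)" by (simp add: Q_def)
    then show "w \<in> {w \<in> space W. \<exists>\<sigma>. Q w \<sigma>}" using \<open>w \<in> space W\<close> by blast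
  qed (auto simp: P(2) Q_def)
  ultimately show ?thesis unfolding closed_proj_def by blast
qed

text \<open>A pairing function lets one \<open>\<sigma>\<close> carry a witness for each member of the intersection.\<close>

lemma closed_proj_INT:
  fixes E :: "nat \<Rightarrow> (nat \<Rightarrow> 'a) set"
  assumes "\<And>n. closed_proj (E n)" shows "closed_proj (\<Inter>n. E n)"
proof -
  have "\<forall>n. \<exists>P. seq_closed P \<and> E n = {w \<in> space W. \<exists>\<sigma>. P w \<sigma>}"
    using assms unfolding closed_proj_def by (rule allI)
  from choice[OF this] obtain P where
    "\<forall>n. seq_closed (P n) \<and> E n = {w \<in> space W. \<exists>\<sigma>. P n w \<sigma>}" ..
  then have P: "\<And>n. seq_closed (P n)" "\<And>n. E n = {w \<in> space W. \<exists>\<sigma>. P n w \<sigma>}"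
    by auto
  define Q where "Q w \<sigma> \<longleftrightarrow> (\<forall>n. P n w (\<lambda>j. \<sigma> (prod_encode (n, j))))" for w \<sigma>
  have "seq_closed Q"
    unfolding seq_closed_def
  proof (intro allI impI)
    fix w \<sigma> w' \<sigma>'
    assume *: "\<forall>\<^sub>F n in sequentially. Q (w n) (\<sigma> n)"
      "\<forall>i. limitin \<tau> (\<lambda>n. w n i) (w' i) sequentially"
      "\<forall>i. \<forall>\<^sub>F n in sequentially. \<sigma> n i = \<sigma>' (i :: nat)"
    show "Q w' \<sigma>'" unfolding Q_def
    proof
      fix m
      have "\<forall>\<^sub>F n in sequentially. P m (w n) (\<lambda>j. \<sigma> n (prod_encode (m, j)))"
        using *(1) by eventually_elim (simp add: Q_def)
      then show "P m w' (\<lambda>j. \<sigma>' (prod_encode (m, j)))"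
        by (rule seq_closedD[OF P(1)]) (use * in auto)
    qed
  qed
  moreover have "(\<Inter>n. E n) = {w \<in> space W. \<exists>\<sigma>. Q w \<sigma>}"
  proof (intro equalityI subsetI)
    fix w assume w: "w \<in> (\<Inter>n. E n)"
    then have sp: "w \<in> space W" using P(2)[of 0] by auto
    have "\<forall>n. \<exists>\<sigma>. P n w \<sigma>" using w P(2) by auto
    then obtain s where s: "\<And>n. P n w (s n)" by metis
    have "Q w (\<lambda>k. s (fst (prod_decode k)) (snd (prod_decode k)))"
      using s by (simp add: Q_def)
    then show "w \<in> {w \<in> space W. \<exists>\<sigma>. Q w \<sigma>}" using sp by blast
  qed (auto simp: P(2) Q_def)
  ultimately show ?thesis unfolding closed_proj_def by blast
qed

lemma closed_proj_openin:
  assumes U: "openin \<tau> U" shows "closed_proj {w \<in> space W. w i \<in> U}"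
proof -
  have reg: "regular_space \<tau>" using completely_metrizable
    by (simp add: completely_metrizable_imp_metrizable_space metrizable_imp_regular_space)
  define C where "C n = (if \<tau> closure_of basic n \<subseteq> U then \<tau> closure_of basic n else {})" for n
  have "\<exists>n. x \<in> C n" if x: "x \<in> U" for x
  proof -
    have "closedin \<tau> (topspace \<tau> - U)" "x \<in> topspace \<tau> - (topspace \<tau> - U)"
      using U x openin_subset by auto
    then obtain V V' where V: "openin \<tau> V" "openin \<tau> V'" "x \<in> V" "topspace \<tau> - U \<subseteq> V'" "disjnt V V'"
      using reg unfolding regular_space_def by metis
    then obtain n where n: "x \<in> basic n" "basic n \<subseteq> V" using ex_basic by blast
    have "\<tau> closure_of basic n \<subseteq> topspace \<tau> - V'"
      using n V by (intro closure_of_minimal) (auto simp: disjnt_def dest: openin_subset)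
    also have "\<dots> \<subseteq> U" using V(4) by auto
    finally have "C n = \<tau> closure_of basic n" by (simp add: C_def)
    moreover have "basic n \<subseteq> \<tau> closure_of basic n"
      using closure_of_subset openin_basic openin_subset by metis
    ultimately show ?thesis using n by auto
  qed
  moreover have "C n \<subseteq> U" for n by (simp add: C_def)
  ultimately have "U = (\<Union>n. C n)" by (intro equalityI subsetI) auto
  then have "{w \<in> space W. w i \<in> U} = (\<Union>n. {w \<in> space W. w i \<in> C n})"
    by auto
  moreover have "closed_proj (\<Union>n. {w \<in> space W. w i \<in> C n})"
    by (intro closed_proj_UN closed_proj_closedin) (simp add: C_def)
  ultimately show ?thesis by simp
qed

lemma openin_space: "openin \<tau> (space X)"
  unfolding topspace_eq[symmetric] by simp

text \<open>Projections of closed sets are not closed under complements, so the induction over Borel sets has to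
treat a set and its complement together.\<close>

lemma closed_proj_coordinate:
  assumes "A \<in> sets X"
  shows "closed_proj {w \<in> space W. w i \<in> A} \<and> closed_proj {w \<in> space W. w i \<in> space X - A}"
  using assms unfolding sets_X
proof (induction rule: sigma_sets.induct)
  case (Basic A)
  then have "openin \<tau> A" by simp
  then have "closedin \<tau> (space X - A)" unfolding topspace_eq[symmetric] by (rule closedin_diff[OF closedin_topspace])
  then show ?case using closed_proj_openin[OF \<open>openin \<tau> A\<close>] closed_proj_closedin by blast
next
  case Empty
  have "closed_proj {w \<in> space W. w i \<in> {}}" "closed_proj {w \<in> space W. w i \<in> space X}"
    using closed_proj_openin[of "{}"] closed_proj_openin[OF openin_space] by auto
  then show ?case by auto
next
  case (Compl A)
  have "space X - (space X - A) = A" using sets.sets_into_space Compl.hyps sets_X by blast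
  then show ?case using Compl.IH by simp
next
  case (Union A)
  have "{w \<in> space W. w i \<in> \<Union> (range A)} = (\<Union>n. {w \<in> space W. w i \<in> A n})"
    "{w \<in> space W. w i \<in> space X - \<Union> (range A)} = (\<Inter>n. {w \<in> space W. w i \<in> space X - A n})"
    by auto
  moreover have "closed_proj (\<Union>n. {w \<in> space W. w i \<in> A n})"
    by (rule closed_proj_UN) (rule conjunct1[OF Union.IH])
  moreover have "closed_proj (\<Inter>n. {w \<in> space W. w i \<in> space X - A n})"
    by (rule closed_proj_INT) (rule conjunct2[OF Union.IH])
  ultimately show ?case by simp
qed

lemma closed_proj_sets_W:
  assumes "E \<in> sets W" shows "closed_proj E \<and> closed_proj (space W - E)"
  using assms unfolding sets_PiM_single
proof (induction rule: sigma_sets.induct)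
  case (Basic E)
  then obtain i A where A: "A \<in> sets X" "E = {f \<in> space W. f i \<in> A}" by (auto simp: space_PiM)
  moreover have "space W - E = {w \<in> space W. w i \<in> space X - A}" using A by (auto simp: space_W)
  ultimately show ?case using closed_proj_coordinate by simp
next
  case Empty
  have "closed_proj {w \<in> space W. w 0 \<in> {}}" "closed_proj {w \<in> space W. w 0 \<in> space X}"
    using closed_proj_openin[of "{}"] closed_proj_openin[OF openin_space] by auto
  moreover have "{w \<in> space W. w 0 \<in> space X} = space W" by (auto simp: space_W)
  ultimately show ?case by auto
next
  case (Compl E)
  have "E \<subseteq> space W" using Compl.IH unfolding closed_proj_def by auto
  then have "space W - (space W - E) = E" by blast
  then show ?case using Compl.IH by (simp add: space_PiM)
next
  case (Union E)
  have "space W - \<Union> (range E) = (\<Inter>n. space W - E n)" by auto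
  moreover have "closed_proj (\<Union>n. E n)"
    by (rule closed_proj_UN) (rule conjunct1[OF Union.IH])
  moreover have "closed_proj (\<Inter>n. space W - E n)"
    by (rule closed_proj_INT) (rule conjunct2[OF Union.IH])
  ultimately show ?case by (simp add: space_PiM)
qed

text \<open>Represent \<open>E\<close> by a closed \<open>P\<close>. An entry \<open>s ! n\<close> of the index \<open>s\<close> prescribes the value \<open>\<sigma> n\<close> and
basic sets of radius at most \<open>1 / (n + 1)\<close> that contain \<open>w 0, \<dots>, w n\<close>. Sequences that obey longer and longer initial segments
of one branch therefore converge coordinatewise, by completeness, and the limit stays in \<open>P\<close>.
This makes \<open>baire_property_scheme\<close> applicable.\<close>

theorem baire_property_projection:
  assumes "E \<in> sets W" shows "baire_property \<tau> ((\<lambda>w. w 0) ` E)"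
proof -
  obtain P where P: "seq_closed P" "E = {w \<in> space W. \<exists>\<sigma>. P w \<sigma>}"
    using closed_proj_sets_W[OF assms] unfolding closed_proj_def by auto
  obtain M d where "Metric_space M d" and mc: "Metric_space.mcomplete M d"
    and \<tau>: "\<tau> = Metric_space.mtopology M d"
    using completely_metrizable by (auto simp: completely_metrizable_space_def)
  then interpret Metric_space M d by simp
  have XM: "space X = M" using topspace_eq \<tau> by simp
  have small: "\<exists>j z. x \<in> basic j \<and> basic j \<subseteq> mball z (inverse (Suc n))" if x: "x \<in> M" for x n
    using ex_basic[of "mball x (inverse (Suc n))" x] x unfolding \<tau> by auto
  \<comment> \<open>An entry codes a value of \<open>\<sigma>\<close> and a list of indices of small basic sets.\<close>
  define dec :: "nat \<Rightarrow> nat \<times> nat list" where "dec = from_nat"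
  define fits where "fits n k w \<sigma> \<longleftrightarrow> \<sigma> n = fst (dec k) \<and>
      (\<forall>i\<le>n. w i \<in> basic (snd (dec k) ! i) \<and>
        (\<exists>z. basic (snd (dec k) ! i) \<subseteq> mball z (inverse (Suc n))))" for n k w \<sigma>
  define A where "A s = {x. \<exists>w \<sigma>. x = w 0 \<and> w \<in> space W \<and> P w \<sigma> \<and> (\<forall>n<length s. fits n (s ! n) w \<sigma>)}" for s
  have "baire_property \<tau> (A [])"
  proof (rule baire_property_scheme)
    show "A s \<subseteq> space X" for s by (auto simp: A_def space_W)
  next
    fix s
    show "A s = (\<Union>k. A (s @ [k]))"
    proof (intro equalityI subsetI)
      fix x assume "x \<in> A s"
      then obtain w \<sigma> where w: "x = w 0" "w \<in> space W" "P w \<sigma>" "\<forall>n<length s. fits n (s ! n) w \<sigma>"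
        by (auto simp: A_def)
      have "\<forall>i. \<exists>j z. w i \<in> basic j \<and> basic j \<subseteq> mball z (inverse (Suc (length s)))"
        using w(2) small XM by (auto simp: space_W)
      then obtain j where
        j: "\<And>i. w i \<in> basic (j i) \<and> (\<exists>z. basic (j i) \<subseteq> mball z (inverse (Suc (length s))))"
        by metis
      define k where "k = to_nat (\<sigma> (length s), map j [0..<Suc (length s)])"
      have k: "fits (length s) k w \<sigma>" unfolding fits_def
      proof (intro conjI allI impI)
        show "\<sigma> (length s) = fst (dec k)" by (simp add: k_def dec_def)
        fix i assume "i \<le> length s"
        then have "snd (dec k) ! i = j i" by (simp add: k_def dec_def del: upt_Suc)
        then show "w i \<in> basic (snd (dec k) ! i)"
          "\<exists>z. basic (snd (dec k) ! i) \<subseteq> mball z (inverse (Suc (length s)))"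
          using j[of i] by simp_all
      qed
      have "\<forall>n<length (s @ [k]). fits n ((s @ [k]) ! n) w \<sigma>"
        using w(4) k by (auto simp: nth_append less_Suc_eq)
      then show "x \<in> (\<Union>k. A (s @ [k]))" using w unfolding A_def by blast
    next
      fix x assume "x \<in> (\<Union>k. A (s @ [k]))"
      then obtain k w \<sigma> where w: "x = w 0" "w \<in> space W" "P w \<sigma>"
        "\<forall>n<length (s @ [k]). fits n ((s @ [k]) ! n) w \<sigma>"
        by (auto simp: A_def)
      have "\<forall>n<length s. fits n (s ! n) w \<sigma>"
      proof (intro allI impI)
        fix n assume "n < length s"
        then show "fits n (s ! n) w \<sigma>" using w(4)[rule_format, of n] by (simp add: nth_append)
      qed
      then show "x \<in> A s" using w unfolding A_def by blast
    qed
  next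
    fix x \<rho> assume x: "x \<in> space X" and cl: "\<And>n. x \<in> \<tau> closure_of A (map \<rho> [0..<n])"
    have ex_near: "\<exists>y. y \<in> A (map \<rho> [0..<n]) \<and> y \<in> mball x (inverse (Suc n))" for n
    proof -
      have "\<forall>r>0. \<exists>y\<in>A (map \<rho> [0..<n]). y \<in> mball x r"
        using cl[of n] unfolding \<tau> metric_closure_of by blast
      then show ?thesis
        using inverse_positive_iff_positive of_nat_0_less_iff zero_less_Suc by metis
    qed
    have "\<exists>w \<sigma>. w 0 \<in> mball x (inverse (Suc n)) \<and> w \<in> space W \<and> P w \<sigma> \<and>
        (\<forall>m<n. fits m (\<rho> m) w \<sigma>)" for n
    proof -
      obtain y where "y \<in> A (map \<rho> [0..<n])" "y \<in> mball x (inverse (Suc n))"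
        using ex_near by blast
      moreover then obtain w \<sigma> where "y = w 0" "w \<in> space W" "P w \<sigma>"
        "\<forall>m<length (map \<rho> [0..<n]). fits m (map \<rho> [0..<n] ! m) w \<sigma>"
        unfolding A_def by blast
      ultimately show ?thesis by (intro exI[of _ w] exI[of _ \<sigma>]) auto
    qed
    then obtain w \<sigma> where w: "\<And>n. w n 0 \<in> mball x (inverse (Suc n))" "\<And>n. w n \<in> space W"
      "\<And>n. P (w n) (\<sigma> n)" "\<And>n m. m < n \<Longrightarrow> fits m (\<rho> m) (w n) (\<sigma> n)"
      by metis
    have wM: "w n i \<in> M" for n i using w(2) XM by (auto simp: space_W)
    have close: "d (w n i) (w n' i) < 2 * inverse (Suc m)" if "i \<le> m" "m < n" "m < n'" for n n' m i
    proof -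
      let ?b = "basic (snd (dec (\<rho> m)) ! i)"
      have b: "w n i \<in> ?b" "w n' i \<in> ?b" "\<exists>z. ?b \<subseteq> mball z (inverse (Suc m))"
        using w(4)[of m n] w(4)[of m n'] that unfolding fits_def by blast+
      then obtain z where z: "w n i \<in> mball z (inverse (Suc m))" "w n' i \<in> mball z (inverse (Suc m))"
        by blast
      have "d (w n i) (w n' i) \<le> d (w n i) z + d z (w n' i)"
        using z by (intro triangle) auto
      also have "\<dots> < 2 * inverse (Suc m)" using z commute[of "w n i" z] by auto
      finally show ?thesis .
    qed
    have "MCauchy (\<lambda>n. w n i)" for i
      unfolding MCauchy_def
    proof (intro conjI allI impI)
      show "range (\<lambda>n. w n i) \<subseteq> M" using wM by auto
      fix \<epsilon> :: real assume "\<epsilon> > 0"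
      then obtain m0 where m0: "inverse (real (Suc m0)) < \<epsilon> / 2"
        using reals_Archimedean[of "\<epsilon>/2"] by auto
      define m where "m = max i m0"
      have "inverse (real (Suc m)) \<le> inverse (real (Suc m0))"
        by (intro le_imp_inverse_le) (auto simp: m_def)
      then have "2 * inverse (real (Suc m)) < \<epsilon>" using m0 by linarith
      then have "d (w n i) (w n' i) < \<epsilon>" if "Suc m \<le> n" "Suc m \<le> n'" for n n'
        using close[of i m n n'] that by (force simp: m_def)
      then show "\<exists>N. \<forall>n n'. N \<le> n \<longrightarrow> N \<le> n' \<longrightarrow> d (w n i) (w n' i) < \<epsilon>" by blast
    qed
    then have "\<exists>l. limitin \<tau> (\<lambda>n. w n i) l sequentially" for i
      using mc unfolding mcomplete_def \<tau> by blast
    then obtain w' where w': "\<And>i. limitin \<tau> (\<lambda>n. w n i) (w' i) sequentially" by metis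
    have "limitin \<tau> (\<lambda>n. w n 0) x sequentially"
      unfolding \<tau> limit_metric_sequentially
    proof (intro conjI allI impI)
      show "x \<in> M" using x XM by simp
      fix \<epsilon> :: real assume "\<epsilon> > 0"
      then obtain m where m: "inverse (real (Suc m)) < \<epsilon>"
        using reals_Archimedean by blast
      have "d (w n 0) x < \<epsilon>" if "n \<ge> m" for n
      proof -
        have "inverse (real (Suc n)) \<le> inverse (real (Suc m))"
          using that by (intro le_imp_inverse_le) auto
        moreover have "d (w n 0) x < inverse (real (Suc n))"
          using w(1)[of n] commute[of x "w n 0"] unfolding in_mball by simp
        ultimately show ?thesis using m by linarith
      qed
      then show "\<exists>N. \<forall>n\<ge>N. w n 0 \<in> M \<and> d (w n 0) x < \<epsilon>" using wM by blast
    qed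
    then have x': "w' 0 = x" using w'[of 0] unfolding \<tau>
      by (intro limitin_metric_unique) auto
    define \<sigma>' where "\<sigma>' i = fst (dec (\<rho> i))" for i
    have "\<forall>\<^sub>F n in sequentially. \<sigma> n i = \<sigma>' i" for i
      using eventually_gt_at_top[of i]
      by eventually_elim (use w(4) in \<open>auto simp: fits_def \<sigma>'_def\<close>)
    then have "P w' \<sigma>'" using seq_closedD[OF P(1), of w \<sigma> w' \<sigma>'] w(3) w' by auto
    moreover have "w' \<in> space W"
      using limitin_topspace[OF w'] topspace_eq by (simp add: space_W)
    ultimately show "x \<in> A []" using x' unfolding A_def by auto
  qed
  moreover have "A [] = (\<lambda>w. w 0) ` E" unfolding A_def P(2) by auto
  ultimately show ?thesis by simp
qed

section \<open>Analytic sets of points and of sequences\<close>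

text \<open>Any number of existentially quantified points can be stored in the coordinates \<open>w 1, w 2, \<dots>\<close>.\<close>

definition analytic :: "'a set \<Rightarrow> bool" where
  "analytic Y \<longleftrightarrow> (\<exists>E \<in> sets W. Y = (\<lambda>w. w 0) ` E)"

text \<open>Splitting a sequence \<open>u\<close> into its even part and its odd part identifies \<open>W\<close> with \<open>W \<times> W\<close>, so this
  is projection along the second factor. The map \<open>mix\<close> is the inverse of the splitting.\<close>

definition analytic_seq :: "(nat \<Rightarrow> 'a) set \<Rightarrow> bool" where
  "analytic_seq Z \<longleftrightarrow> (\<exists>E \<in> sets W. Z = (\<lambda>u n. u (2 * n)) ` E)"

definition mix :: "(nat \<Rightarrow> 'b) \<Rightarrow> (nat \<Rightarrow> 'b) \<Rightarrow> nat \<Rightarrow> 'b" where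
  "mix w v n = (if even n then w (n div 2) else v (n div 2))"

lemma mix_even [simp]: "mix w v (2 * n) = w n"
  and mix_odd [simp]: "mix w v (Suc (2 * n)) = v n"
  by (simp_all add: mix_def)

lemma mix_split: "mix (\<lambda>n. u (2 * n)) (\<lambda>n. u (Suc (2 * n))) = u"
  by (rule ext) (auto simp: mix_def elim!: oddE)

lemma mix_in_space: "w \<in> space W \<Longrightarrow> v \<in> space W \<Longrightarrow> mix w v \<in> space W"
  by (auto simp: space_W mix_def)

lemma analytic_seq_alt:
  "analytic_seq Z \<longleftrightarrow> (\<exists>E \<in> sets W. Z = {w \<in> space W. \<exists>v \<in> space W. mix w v \<in> E})"
proof -
  have "(\<lambda>u n. u (2 * n)) ` E = {w \<in> space W. \<exists>v \<in> space W. mix w v \<in> E}" if E: "E \<in> sets W" for E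
  proof (intro equalityI subsetI)
    fix w assume "w \<in> (\<lambda>u n. u (2 * n)) ` E"
    then obtain u where u: "u \<in> E" "w = (\<lambda>n. u (2 * n))" by auto
    then have "u \<in> space W" using E sets.sets_into_space by blast
    then have "(\<lambda>n. u (Suc (2 * n))) \<in> space W" "w \<in> space W" using u by (auto simp: space_W)
    moreover have "mix w (\<lambda>n. u (Suc (2 * n))) \<in> E" using u mix_split[of u] by simp
    ultimately show "w \<in> {w \<in> space W. \<exists>v \<in> space W. mix w v \<in> E}" by blast
  next
    fix w assume "w \<in> {w \<in> space W. \<exists>v \<in> space W. mix w v \<in> E}"
    then obtain v where "mix w v \<in> E" by auto
    then show "w \<in> (\<lambda>u n. u (2 * n)) ` E"
      by (intro image_eqI[of _ _ "mix w v"]) auto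
  qed
  then show ?thesis unfolding analytic_seq_def by (intro bex_cong) auto
qed

lemma measurable_W:
  assumes "\<And>i. (\<lambda>w. f w i) \<in> measurable M X" shows "f \<in> measurable M W"
proof (rule measurable_PiM_single')
  show "(\<lambda>w. f w i) \<in> measurable M X" for i by (rule assms)
  have "f w i \<in> space X" if "w \<in> space M" for w i using measurable_space[OF assms that] .
  then show "f \<in> space M \<rightarrow> (\<Pi>\<^sub>E i\<in>UNIV. space X)" by auto
qed

lemma measurable_coord: "(\<lambda>w. w i) \<in> measurable W X"
  by simp

lemma analytic_seq_borel:
  assumes "E \<in> sets W" shows "analytic_seq E"
  unfolding analytic_seq_alt
proof (intro bexI[of _ "(\<lambda>u n. u (2 * n)) -` E \<inter> space W"] equalityI subsetI)
  have "(\<lambda>u n. u (2 * n)) \<in> measurable W W"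
    by (intro measurable_W measurable_coord)
  then show "(\<lambda>u n. u (2 * n)) -` E \<inter> space W \<in> sets W" using assms by (rule measurable_sets)
  fix w assume "w \<in> E"
  then have "w \<in> space W" using assms sets.sets_into_space by blast
  then show "w \<in> {w \<in> space W. \<exists>v\<in>space W. mix w v \<in> (\<lambda>u n. u (2 * n)) -` E \<inter> space W}"
    using \<open>w \<in> E\<close> by (auto intro!: bexI[of _ w] mix_in_space)
qed auto

text \<open>The two witnesses are the even and the odd part of a common one.\<close>

lemma analytic_seq_Int:
  assumes "analytic_seq Z" "analytic_seq Z'" shows "analytic_seq (Z \<inter> Z')"
proof -
  obtain E where E: "E \<in> sets W" "Z = {w \<in> space W. \<exists>v \<in> space W. mix w v \<in> E}"
    using assms(1) unfolding analytic_seq_alt by auto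
  obtain E' where E': "E' \<in> sets W" "Z' = {w \<in> space W. \<exists>v \<in> space W. mix w v \<in> E'}"
    using assms(2) unfolding analytic_seq_alt by auto
  define f where "f u = mix (\<lambda>n. u (2 * n)) (\<lambda>n. u (Suc (2 * (2 * n))))" for u :: "nat \<Rightarrow> 'a"
  define f' where "f' u = mix (\<lambda>n. u (2 * n)) (\<lambda>n. u (Suc (2 * Suc (2 * n))))" for u :: "nat \<Rightarrow> 'a"
  have f: "f \<in> measurable W W" "f' \<in> measurable W W"
    by (intro measurable_W; simp add: f_def f'_def mix_def)+
  show ?thesis unfolding analytic_seq_alt
  proof (intro bexI[of _ "f -` E \<inter> space W \<inter> (f' -` E' \<inter> space W)"] equalityI subsetI)
    show "f -` E \<inter> space W \<inter> (f' -` E' \<inter> space W) \<in> sets W"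
      using f E(1) E'(1) by (intro sets.Int measurable_sets)
  next
    fix w assume "w \<in> Z \<inter> Z'"
    then obtain v v' where v: "w \<in> space W" "v \<in> space W" "v' \<in> space W" "mix w v \<in> E" "mix w v' \<in> E'"
      using E E' by auto
    have "f (mix w (mix v v')) = mix w v" "f' (mix w (mix v v')) = mix w v'"
      unfolding f_def f'_def mix_odd mix_even by simp_all
    then show "w \<in> {w \<in> space W. \<exists>v\<in>space W. mix w v \<in> f -` E \<inter> space W \<inter> (f' -` E' \<inter> space W)}"
      using v by (auto intro!: bexI[of _ "mix v v'"] mix_in_space)
  next
    fix w assume "w \<in> {w \<in> space W. \<exists>v\<in>space W. mix w v \<in> f -` E \<inter> space W \<inter> (f' -` E' \<inter> space W)}"
    then obtain v where v: "w \<in> space W" "v \<in> space W" "f (mix w v) \<in> E" "f' (mix w v) \<in> E'" by auto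
    have "f (mix w v) = mix w (\<lambda>n. v (2 * n))" "f' (mix w v) = mix w (\<lambda>n. v (Suc (2 * n)))"
      unfolding f_def f'_def mix_odd mix_even by simp_all
    then show "w \<in> Z \<inter> Z'" using v E(2) E'(2)
      by (auto intro!: bexI[of _ "\<lambda>n. v (2 * n)"] bexI[of _ "\<lambda>n. v (Suc (2 * n))"] simp: space_W)
  qed
qed

lemma analytic_seq_reindex:
  assumes "analytic_seq Z" shows "analytic_seq {w \<in> space W. (\<lambda>n. w (\<phi> n)) \<in> Z}"
proof -
  obtain E where E: "E \<in> sets W" "Z = {w \<in> space W. \<exists>v \<in> space W. mix w v \<in> E}"
    using assms(1) unfolding analytic_seq_alt by auto
  define f where "f u = mix (\<lambda>n. u (2 * \<phi> n)) (\<lambda>n. u (Suc (2 * n)))" for u :: "nat \<Rightarrow> 'a"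
  have f: "f \<in> measurable W W" by (intro measurable_W) (simp add: f_def mix_def)
  have fm: "f (mix w v) = mix (\<lambda>n. w (\<phi> n)) v" for w v unfolding f_def by simp
  show ?thesis unfolding analytic_seq_alt
  proof (intro bexI[of _ "f -` E \<inter> space W"])
    show "f -` E \<inter> space W \<in> sets W" using f E(1) by (rule measurable_sets)
    show "{w \<in> space W. (\<lambda>n. w (\<phi> n)) \<in> Z} =
        {w \<in> space W. \<exists>v\<in>space W. mix w v \<in> f -` E \<inter> space W}"
      by (auto simp: E(2) fm mix_in_space) (auto simp: space_W)
  qed
qed

lemma analytic_seq_coord:
  assumes "analytic Y" shows "analytic_seq {w \<in> space W. w i \<in> Y}"
proof -
  obtain E where E: "E \<in> sets W" "Y = (\<lambda>w. w 0) ` E" using assms by (auto simp: analytic_def)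
  define f where "f u = case_nat (u (2 * i)) (\<lambda>n. u (Suc (2 * n)))" for u :: "nat \<Rightarrow> 'a"
  have f: "f \<in> measurable W W"
    by (intro measurable_W) (simp add: f_def split: nat.split)
  have fm: "f (mix w v) = case_nat (w i) v" for w v unfolding f_def by simp
  show ?thesis unfolding analytic_seq_alt
  proof (intro bexI[of _ "f -` E \<inter> space W"] equalityI subsetI)
    show "f -` E \<inter> space W \<in> sets W" using f E(1) by (rule measurable_sets)
  next
    fix w assume "w \<in> {w \<in> space W. w i \<in> Y}"
    then obtain u where u: "w \<in> space W" "u \<in> E" "w i = u 0" using E by auto
    have us: "u \<in> space W" using u E sets.sets_into_space by blast
    have "case_nat (w i) (\<lambda>n. u (Suc n)) = u" using u by (auto split: nat.split)
    then show "w \<in> {w \<in> space W. \<exists>v\<in>space W. mix w v \<in> f -` E \<inter> space W}"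
      using u us by (auto simp: fm intro!: bexI[of _ "\<lambda>n. u (Suc n)"] mix_in_space) (auto simp: space_W)
  next
    fix w assume "w \<in> {w \<in> space W. \<exists>v\<in>space W. mix w v \<in> f -` E \<inter> space W}"
    then obtain v where v: "w \<in> space W" "case_nat (w i) v \<in> E" by (auto simp: fm)
    then have "w i \<in> Y" unfolding E(2) by (intro image_eqI[of _ _ "case_nat (w i) v"]) auto
    then show "w \<in> {w \<in> space W. w i \<in> Y}" using v by simp
  qed
qed

lemma analytic_projection:
  assumes "analytic_seq Z" shows "analytic ((\<lambda>w. w 0) ` Z)"
proof -
  obtain E where "E \<in> sets W" "Z = (\<lambda>u n. u (2 * n)) ` E"
    using assms by (auto simp: analytic_seq_def)
  then show ?thesis unfolding analytic_def by (intro bexI[of _ E]) (auto simp: image_image)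
qed

lemma analytic_subset: "analytic Y \<Longrightarrow> Y \<subseteq> space X"
  unfolding analytic_def using sets.sets_into_space by (fastforce simp: space_W)

lemma analytic_seq_subset: "analytic_seq Z \<Longrightarrow> Z \<subseteq> space W"
  unfolding analytic_seq_alt by auto

lemma analytic_iff_seq:
  assumes "Y \<subseteq> space X" shows "analytic Y \<longleftrightarrow> analytic_seq {w \<in> space W. w 0 \<in> Y}"
proof
  assume "analytic_seq {w \<in> space W. w 0 \<in> Y}"
  then have "analytic ((\<lambda>w. w 0) ` {w \<in> space W. w 0 \<in> Y})" by (rule analytic_projection)
  moreover have "(\<lambda>w. w 0) ` {w \<in> space W. w 0 \<in> Y} = Y"
  proof (intro equalityI subsetI)
    fix y assume "y \<in> Y"
    then show "y \<in> (\<lambda>w. w 0) ` {w \<in> space W. w 0 \<in> Y}"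
      using assms by (intro image_eqI[of _ _ "\<lambda>_. y"]) (auto simp: space_W)
  qed auto
  ultimately show "analytic Y" by simp
qed (rule analytic_seq_coord)

lemma analytic_borel: "Y \<in> sets X \<Longrightarrow> analytic Y"
  using sets.sets_into_space[of Y X] analytic_iff_seq[of Y]
    analytic_seq_borel[of "{w \<in> space W. w 0 \<in> Y}"]
    measurable_sets[OF measurable_coord[of 0], of Y]
  by (simp add: vimage_def Int_def conj_commute)

text \<open>All sets of points that occur in the construction will belong to \<open>\<A>\<close>; the \<open>\<sigma>\<close>-algebra \<open>\<A>s\<close> is its
analogue for sets of sequences.\<close>

definition \<A> :: "'a measure" where "\<A> = sigma (space X) {Y. analytic Y}"
definition \<A>s :: "(nat \<Rightarrow> 'a) measure" where "\<A>s = sigma (space W) {Z. analytic_seq Z}"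

lemma space_\<A> [simp]: "space \<A> = space X"
  and sets_\<A>: "sets \<A> = sigma_sets (space X) {Y. analytic Y}"
  unfolding \<A>_def using analytic_subset by (auto intro!: space_measure_of sets_measure_of)

lemma space_\<A>s [simp]: "space \<A>s = space W"
  and sets_\<A>s: "sets \<A>s = sigma_sets (space W) {Z. analytic_seq Z}"
  unfolding \<A>s_def using analytic_seq_subset by (auto intro!: space_measure_of sets_measure_of)

lemma analytic_in_\<A>: "analytic Y \<Longrightarrow> Y \<in> sets \<A>"
  by (simp add: sets_\<A>)

lemma sets_X_\<A>: "Y \<in> sets X \<Longrightarrow> Y \<in> sets \<A>"
  by (intro analytic_in_\<A> analytic_borel)

lemma sets_W_\<A>s: "E \<in> sets W \<Longrightarrow> E \<in> sets \<A>s"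
  by (simp add: sets_\<A>s analytic_seq_borel)

lemma baire_property_\<A>:
  assumes "Y \<in> sets \<A>" shows "baire_property \<tau> Y"
proof -
  have "{Y. analytic Y} \<subseteq> {Y. baire_property \<tau> Y}"
    using baire_property_projection by (auto simp: analytic_def)
  then have "sigma_sets (space X) {Y. analytic Y} \<subseteq> {Y. baire_property \<tau> Y}"
    using sigma_algebra.sigma_sets_subset sigma_algebra_baire_property topspace_eq by metis
  then show ?thesis using assms sets_\<A> by auto
qed

lemma \<A>s_coord:
  assumes "Y \<in> sets \<A>" shows "{w \<in> space W. w i \<in> Y} \<in> sets \<A>s"
proof -
  have "(\<lambda>w. w i) \<in> measurable \<A>s \<A>"
    unfolding \<A>_def
  proof (rule measurable_measure_of)
    show "{Y. analytic Y} \<subseteq> Pow (space X)" using analytic_subset by auto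
    show "(\<lambda>w. w i) \<in> space \<A>s \<rightarrow> space X" by (auto simp: space_W)
    fix Y assume "Y \<in> {Y. analytic Y}"
    then have "analytic_seq {w \<in> space W. w i \<in> Y}" using analytic_seq_coord by auto
    moreover have "(\<lambda>w. w i) -` Y \<inter> space \<A>s = {w \<in> space W. w i \<in> Y}" by auto
    ultimately show "(\<lambda>w. w i) -` Y \<inter> space \<A>s \<in> sets \<A>s" by (simp add: sets_\<A>s)
  qed
  from measurable_sets[OF this assms] show ?thesis
    by (simp add: vimage_def Int_def conj_commute)
qed

section \<open>Projections with finite fibres\<close>

lemma diagonal_in_W: "{w \<in> space W. w i = w j} \<in> sets W"
proof -
  have "{w \<in> space W. w i = w j} = space W - (\<Union>n. {w \<in> space W. w i \<in> basic n} - {w \<in> space W. w j \<in> basic n})"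
  proof (intro equalityI subsetI)
    fix w assume w: "w \<in> space W - (\<Union>n. {w \<in> space W. w i \<in> basic n} - {w \<in> space W. w j \<in> basic n})"
    have "w i = w j"
    proof (rule ccontr)
      assume "w i \<noteq> w j"
      then obtain n where "w i \<in> basic n" "basic n \<inter> {w j} = {}"
        using ex_basic_isolating[of "{w j}" "w i"] w by (auto simp: space_W)
      then show False using w by auto
    qed
    then show "w \<in> {w \<in> space W. w i = w j}" using w by simp
  qed auto
  moreover have "{w \<in> space W. w i \<in> basic n} \<in> sets W" for i n
    using measurable_sets[OF measurable_coord[of i] basic_in_sets[of n]]
    by (simp add: vimage_def Int_def conj_commute)
  ultimately show ?thesis by simp
qed

text \<open>That the fibre over \<open>y\<close> has \<open>n\<close> elements is witnessed by \<open>n\<close> distinct sequences with first entry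
\<open>y\<close>. They are merged into a single sequence \<open>v\<close>, where \<open>\<phi> j\<close> lists the positions of the
\<open>j\<close>-th one and all of them share position \<open>0\<close>.\<close>

lemma analytic_card_fibre:
  assumes Z: "analytic_seq Z"
    and fin: "\<And>y. finite {w \<in> Z. w 0 = y}"
  shows "analytic {y \<in> space X. n \<le> card {w \<in> Z. w 0 = y}}"
proof -
  define \<phi> :: "nat \<Rightarrow> nat \<Rightarrow> nat" where "\<phi> j i = (case i of 0 \<Rightarrow> 0 | Suc m \<Rightarrow> Suc (prod_encode (j, m)))" for j i
  define D where "D j k = space W - (\<Inter>i. {v \<in> space W. v (\<phi> j i) = v (\<phi> k i)})" for j k
  have D: "D j k \<in> sets W" for j k unfolding D_def
    by (intro sets.Diff sets.top sets.countable_INT) (auto simp: diagonal_in_W)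
  define Q where "Q j = {v \<in> space W. (\<lambda>i. v (\<phi> j i)) \<in> Z}" for j
  have Q: "analytic_seq (Q j)" for j unfolding Q_def by (rule analytic_seq_reindex[OF Z])
  have fin_Int: "analytic_seq (space W \<inter> (\<Inter>j\<in>J. R j))" if "finite J" "\<And>j. j \<in> J \<Longrightarrow> analytic_seq (R j)"
    for J :: "nat set" and R
    using that
  proof (induction J rule: finite_induct)
    case (insert j J)
    have "space W \<inter> (\<Inter>j\<in>insert j J. R j) = R j \<inter> (space W \<inter> (\<Inter>j\<in>J. R j))" by auto
    then show ?case using insert by (simp add: analytic_seq_Int)
  qed (simp add: analytic_seq_borel)
  define R where "R = (space W \<inter> (\<Inter>j\<in>{..<n}. Q j)) \<inter> (space W \<inter> (\<Inter>j\<in>{..<n}. space W \<inter> (\<Inter>k\<in>{..<j}. D j k)))"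
  have "analytic_seq R" unfolding R_def
    by (intro analytic_seq_Int fin_Int Q analytic_seq_borel D) auto
  then have "analytic ((\<lambda>w. w 0) ` R)" by (rule analytic_projection)
  moreover have "(\<lambda>w. w 0) ` R = {y \<in> space X. n \<le> card {w \<in> Z. w 0 = y}}"
  proof (intro equalityI subsetI)
    fix y assume "y \<in> (\<lambda>w. w 0) ` R"
    then obtain v where v: "v \<in> R" "y = v 0" by auto
    define u where "u j = (\<lambda>i. v (\<phi> j i))" for j
    have vW: "v \<in> space W" using v by (auto simp: R_def)
    have uZ: "u j \<in> Z" if "j < n" for j using v that by (auto simp: R_def Q_def u_def)
    have u0: "u j 0 = y" for j using v by (simp add: u_def \<phi>_def)
    have ne: "u j \<noteq> u k" if "k < j" "j < n" for j k
    proof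
      assume "u j = u k"
      then have "v (\<phi> j i) = v (\<phi> k i)" for i unfolding u_def by meson
      then have "v \<notin> D j k" using vW by (auto simp: D_def)
      moreover have "v \<in> D j k" using v that unfolding R_def by blast
      ultimately show False by blast
    qed
    have "inj_on u {..<n}"
      by (rule inj_onI) (metis ne lessThan_iff linorder_neqE_nat)
    then have "n = card (u ` {..<n})" by (simp add: card_image)
    also have "\<dots> \<le> card {w \<in> Z. w 0 = y}"
      by (rule card_mono[OF fin]) (use uZ u0 in auto)
    finally show "y \<in> {y \<in> space X. n \<le> card {w \<in> Z. w 0 = y}}"
      using v vW by (auto simp: space_W)
  next
    fix y assume y: "y \<in> {y \<in> space X. n \<le> card {w \<in> Z. w 0 = y}}"
    then obtain F where F: "F \<subseteq> {w \<in> Z. w 0 = y}" "card F = n" "finite F"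
      using obtain_subset_with_card_n by (metis (no_types, lifting) mem_Collect_eq)
    obtain u where u: "bij_betw u {..<n} F"
      using F ex_bij_betw_nat_finite[of F] by (auto simp: atLeast0LessThan)
    have uZ: "u j \<in> Z" "u j 0 = y" if "j < n" for j
      using u F that by (auto simp: bij_betw_def)
    have uW: "u j i \<in> space X" if "j < n" for i j
      using uZ(1)[OF that] analytic_seq_subset[OF Z] by (auto simp: space_W)
    define v where "v m = (case m of 0 \<Rightarrow> y | Suc k \<Rightarrow>
        if fst (prod_decode k) < n then u (fst (prod_decode k)) (Suc (snd (prod_decode k))) else y)" for m
    have vW: "v \<in> space W" using y uW by (auto simp: space_W v_def split: nat.split)
    have vu: "(\<lambda>i. v (\<phi> j i)) = u j" if "j < n" for j
      using that uZ(2)[OF that] by (auto simp: v_def \<phi>_def fun_eq_iff split: nat.split)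
    have "v \<in> D j k" if "k < j" "j < n" for j k
    proof -
      have "u j \<noteq> u k" using u that inj_onD[of u "{..<n}" j k] by (auto simp: bij_betw_def)
      then have "(\<lambda>i. v (\<phi> j i)) \<noteq> (\<lambda>i. v (\<phi> k i))"
        using vu[of j] vu[of k] that by simp
      then have "\<exists>i. v (\<phi> j i) \<noteq> v (\<phi> k i)" by (simp add: fun_eq_iff)
      then show ?thesis using vW by (auto simp: D_def)
    qed
    then have "v \<in> R" using vW uZ vu by (auto simp: R_def Q_def)
    then show "y \<in> (\<lambda>w. w 0) ` R" by (intro image_eqI[of _ _ v]) (simp_all add: v_def)
  qed
  ultimately show ?thesis by simp
qed

text \<open>Projection does not commute with complements, but the number of points in a finite fibre is additive.
Hence the sets \<open>Z\<close> for which this number is measurable form a Dynkin system, and the analytic sets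
are a generator of \<open>\<A>s\<close> that is stable under intersection.\<close>

lemma measurable_card_fibre:
  assumes T: "T \<in> sets W" and fin: "\<And>y. finite {w \<in> T. w 0 = y}"
    and Z: "Z \<in> sets \<A>s"
  shows "(\<lambda>y. card {w \<in> T \<inter> Z. w 0 = y}) \<in> measurable \<A> (count_space UNIV)"
proof -
  have *: "Int_stable {Z. analytic_seq Z}" by (auto simp: Int_stable_def analytic_seq_Int)
  have sub: "{Z. analytic_seq Z} \<subseteq> Pow (space W)" using analytic_seq_subset by auto
  have finZ: "finite {w \<in> T \<inter> Z. w 0 = y}" for Z y
    by (rule finite_subset[OF _ fin[of y]]) auto
  have an: "(\<lambda>y. card {w \<in> T \<inter> Z. w 0 = y}) \<in> measurable \<A> (count_space UNIV)"
    if Z: "analytic_seq Z" for Z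
  proof (rule measurable_count_space_eq2_countable[THEN iffD2, OF _], safe)
    fix n
    have a: "{y \<in> space X. n \<le> card {w \<in> T \<inter> Z. w 0 = y}} \<in> sets \<A>" for n
      by (intro analytic_in_\<A> analytic_card_fibre analytic_seq_Int analytic_seq_borel T Z finZ)
    have "(\<lambda>y. card {w \<in> T \<inter> Z. w 0 = y}) -` {n} \<inter> space \<A> =
        {y \<in> space X. n \<le> card {w \<in> T \<inter> Z. w 0 = y}} - {y \<in> space X. Suc n \<le> card {w \<in> T \<inter> Z. w 0 = y}}"
      by auto
    then show "(\<lambda>y. card {w \<in> T \<inter> Z. w 0 = y}) -` {n} \<inter> space \<A> \<in> sets \<A>"
      using a by (simp only:) (intro sets.Diff)
  qed auto
  have TW: "T \<inter> space W = T" using T sets.sets_into_space by blast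
  show ?thesis using Z unfolding sets_\<A>s
  proof (induction rule: sigma_sets_induct_disjoint[OF * sub, consumes 1, case_names basic empty compl union])
    case (basic Z) then show ?case by (intro an) simp
  next
    case empty then show ?case by simp
  next
    case (compl Z)
    have "(\<lambda>y. card {w \<in> T \<inter> space W. w 0 = y} - card {w \<in> T \<inter> Z. w 0 = y})
        \<in> measurable \<A> (count_space UNIV)"
      using compl an[OF analytic_seq_borel[OF sets.top]] by measurable
    moreover have "card {w \<in> T \<inter> (space W - Z). w 0 = y} =
        card {w \<in> T \<inter> space W. w 0 = y} - card {w \<in> T \<inter> Z. w 0 = y}" for y
    proof -
      have "{w \<in> T \<inter> (space W - Z). w 0 = y} = {w \<in> T \<inter> space W. w 0 = y} - {w \<in> T \<inter> Z. w 0 = y}"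
        by auto
      moreover have "{w \<in> T \<inter> Z. w 0 = y} \<subseteq> {w \<in> T \<inter> space W. w 0 = y}" using TW by auto
      ultimately show ?thesis by (simp only: card_Diff_subset[OF finZ])
    qed
    ultimately show ?case by simp
  next
    case (union Z)
    let ?S = "\<lambda>n y. \<Sum>i<n. card {w \<in> T \<inter> Z i. w 0 = y}"
    have S: "?S n y = card {w \<in> T \<inter> (\<Union>i<n. Z i). w 0 = y}" for n y
    proof -
      have "{w \<in> T \<inter> (\<Union>i<n. Z i). w 0 = y} = (\<Union>i<n. {w \<in> T \<inter> Z i. w 0 = y})" by auto
      also have "card \<dots> = ?S n y"
        by (rule card_UN_disjoint) (use union(1) finZ in \<open>auto simp: disjoint_family_on_def\<close>)
      finally show ?thesis by simp
    qed
    have meas: "?S n \<in> measurable \<A> (count_space UNIV)" for n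
      using union by measurable
    have ge: "{y \<in> space X. m \<le> card {w \<in> T \<inter> (\<Union>i. Z i). w 0 = y}} = (\<Union>n. {y \<in> space \<A>. m \<le> ?S n y})" for m
    proof (intro equalityI subsetI)
      fix y assume y: "y \<in> {y \<in> space X. m \<le> card {w \<in> T \<inter> (\<Union>i. Z i). w 0 = y}}"
      have "\<forall>w \<in> {w \<in> T \<inter> (\<Union>i. Z i). w 0 = y}. \<exists>i. w \<in> Z i" by auto
      from bchoice[OF this] obtain i where
        i: "\<And>w. w \<in> {w \<in> T \<inter> (\<Union>i. Z i). w 0 = y} \<Longrightarrow> w \<in> Z (i w)" by blast
      define n where "n = Suc (Max (insert 0 (i ` {w \<in> T \<inter> (\<Union>i. Z i). w 0 = y})))"
      have "i w < n" if "w \<in> {w \<in> T \<inter> (\<Union>i. Z i). w 0 = y}" for w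
        unfolding n_def less_Suc_eq_le by (rule Max_ge) (use finite_imageI[OF finZ[of "\<Union>i. Z i" y], of i] that in auto)
      then have "{w \<in> T \<inter> (\<Union>i. Z i). w 0 = y} \<subseteq> {w \<in> T \<inter> (\<Union>i<n. Z i). w 0 = y}"
        using i by blast
      then have le: "card {w \<in> T \<inter> (\<Union>i. Z i). w 0 = y} \<le> ?S n y"
        unfolding S by (rule card_mono[OF finZ])
      have "m \<le> ?S n y" by (rule order_trans[OF _ le]) (use y in simp)
      then show "y \<in> (\<Union>n. {y \<in> space \<A>. m \<le> ?S n y})" using y by (intro UN_I[of n]) simp_all
    next
      fix y assume "y \<in> (\<Union>n. {y \<in> space \<A>. m \<le> ?S n y})"
      then obtain n where n: "y \<in> space X" "m \<le> ?S n y" by auto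
      have "?S n y \<le> card {w \<in> T \<inter> (\<Union>i. Z i). w 0 = y}"
        unfolding S by (rule card_mono[OF finZ]) auto
      then show "y \<in> {y \<in> space X. m \<le> card {w \<in> T \<inter> (\<Union>i. Z i). w 0 = y}}" using n by simp
    qed
    have a: "{y \<in> space X. m \<le> card {w \<in> T \<inter> (\<Union>i. Z i). w 0 = y}} \<in> sets \<A>" for m
      unfolding ge using meas by measurable
    show ?case
    proof (rule measurable_count_space_eq2_countable[THEN iffD2, OF _], safe)
      fix n
      have "(\<lambda>y. card {w \<in> T \<inter> (\<Union>i. Z i). w 0 = y}) -` {n} \<inter> space \<A> =
          {y \<in> space X. n \<le> card {w \<in> T \<inter> (\<Union>i. Z i). w 0 = y}} - {y \<in> space X. Suc n \<le> card {w \<in> T \<inter> (\<Union>i. Z i). w 0 = y}}"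
        by auto
      then show "(\<lambda>y. card {w \<in> T \<inter> (\<Union>i. Z i). w 0 = y}) -` {n} \<inter> space \<A> \<in> sets \<A>"
        using a by (simp only:) (intro sets.Diff)
    qed auto
  qed
qed

theorem finite_fibre_projection:
  assumes "T \<in> sets W" and fin: "\<And>y. finite {w \<in> T. w 0 = y}" and "Z \<in> sets \<A>s"
  shows "(\<lambda>w. w 0) ` (T \<inter> Z) \<in> sets \<A>"
proof -
  have "T \<subseteq> space W" using assms(1) sets.sets_into_space by blast
  then have "(\<lambda>w. w 0) ` (T \<inter> Z) = {y \<in> space \<A>. card {w \<in> T \<inter> Z. w 0 = y} \<noteq> 0}"
    using finite_subset[OF _ fin, of "{w \<in> T \<inter> Z. w 0 = _}"] by (auto simp: space_W card_eq_0_iff)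
  also have "\<dots> \<in> sets \<A>" using measurable_card_fibre[OF assms] by measurable
  finally show ?thesis .
qed

section \<open>Local relations\<close>

text \<open>Relations along which finitely many points can be inspected without leaving \<open>\<A>\<close>.\<close>

definition local_rel :: "('a \<times> 'a) set \<Rightarrow> bool" where
  "local_rel R \<longleftrightarrow> R \<subseteq> space X \<times> space X \<and> (\<forall>x. finite (R `` {x}) \<and> finite (R\<inverse> `` {x})) \<and>
     (\<forall>Y\<in>sets \<A>. R `` Y \<in> sets \<A> \<and> R\<inverse> `` Y \<in> sets \<A>)"

lemma local_rel_converse: "local_rel R \<Longrightarrow> local_rel (R\<inverse>)"
  unfolding local_rel_def by auto

lemma local_rel_finite_Image: "local_rel R \<Longrightarrow> finite F \<Longrightarrow> finite (R `` F)"
  unfolding local_rel_def by (subst Image_eq_UN) auto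

lemma local_rel_comp:
  assumes R: "local_rel R" and S: "local_rel S" shows "local_rel (R O S)"
proof -
  have "finite ((R O S) `` {x})" for x
    using local_rel_finite_Image[OF S local_rel_finite_Image[OF R, of "{x}"]] by (simp add: relcomp_Image)
  moreover have "finite ((R O S)\<inverse> `` {x})" for x
    using local_rel_finite_Image[OF local_rel_converse[OF R] local_rel_finite_Image[OF local_rel_converse[OF S], of "{x}"]]
    by (simp add: relcomp_Image converse_relcomp)
  moreover have "R O S \<subseteq> space X \<times> space X" using R S unfolding local_rel_def by blast
  ultimately show ?thesis
    using R S unfolding local_rel_def by (simp add: relcomp_Image converse_relcomp)
qed

lemma local_rel_Un: "local_rel R \<Longrightarrow> local_rel S \<Longrightarrow> local_rel (R \<union> S)"
  unfolding local_rel_def by (auto simp: Un_Image converse_Un)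

lemma local_rel_Id: "local_rel (Id_on (space X))"
proof -
  have *: "Id_on (space X) `` Y = space X \<inter> Y" for Y by auto
  show ?thesis unfolding local_rel_def converse_Id_on *
    using sets.sets_into_space[of _ \<A>] by (auto simp: Int_absorb1)
qed

lemma local_rel_Image: "local_rel R \<Longrightarrow> Y \<in> sets \<A> \<Longrightarrow> R `` Y \<in> sets \<A>"
  and local_rel_pre: "local_rel R \<Longrightarrow> Y \<in> sets \<A> \<Longrightarrow> R\<inverse> `` Y \<in> sets \<A>"
  by (simp_all add: local_rel_def)

lemma basic_\<A>: "basic n \<in> sets \<A>"
  by (intro sets_X_\<A> basic_in_sets)

end

section \<open>A generic two-colouring with finite monochromatic components\<close>

locale locally_finite_graph = polish +
  fixes G :: "('a \<times> 'a) set"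
  assumes local_G: "local_rel G" and sym_G: "sym G"
begin

text \<open>The relation of lying in the same component of the subgraph induced on \<open>D\<close>; outside \<open>D\<close> it is empty.\<close>

inductive_set conn :: "'a set \<Rightarrow> ('a \<times> 'a) set" for D :: "'a set" where
  refl: "x \<in> D \<Longrightarrow> (x, x) \<in> conn D"
| step: "(x, y) \<in> conn D \<Longrightarrow> (y, z) \<in> G \<Longrightarrow> z \<in> D \<Longrightarrow> (x, z) \<in> conn D"

lemma conn_in: "(x, y) \<in> conn D \<Longrightarrow> x \<in> D \<and> y \<in> D"
  by (induction rule: conn.induct) auto

lemma conn_trans: "(y, z) \<in> conn D \<Longrightarrow> (x, y) \<in> conn D \<Longrightarrow> (x, z) \<in> conn D"
  by (induction rule: conn.induct) (auto intro: conn.step)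

lemma conn_sym: "(x, y) \<in> conn D \<Longrightarrow> (y, x) \<in> conn D"
proof (induction rule: conn.induct)
  case (step x y z)
  then have "(z, y) \<in> conn D"
    using conn_in[OF step(1)] sym_G by (intro conn.step[OF conn.refl]) (auto dest: symD)
  then show ?case using conn_trans[OF step.IH] by simp
qed (rule conn.refl)

lemma conn_converse: "(conn D)\<inverse> = conn D"
  using conn_sym by auto

lemma conn_mono: "(x, y) \<in> conn D \<Longrightarrow> D \<subseteq> D' \<Longrightarrow> (x, y) \<in> conn D'"
  by (induction rule: conn.induct) (auto intro: conn.intros)

lemma conn_\<A>:
  assumes "D \<in> sets \<A>" "Y \<in> sets \<A>" shows "conn D `` Y \<in> sets \<A>"
proof -
  define K where "K n = ((\<lambda>Z. G `` Z \<inter> D) ^^ n) (Y \<inter> D)" for n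
  have "K n \<in> sets \<A>" for n
    by (induction n) (auto simp: K_def intro!: sets.Int assms local_rel_Image[OF local_G])
  moreover have "conn D `` Y = (\<Union>n. K n)"
  proof (intro equalityI subsetI)
    fix y assume "y \<in> conn D `` Y"
    then obtain x where "x \<in> Y" "(x, y) \<in> conn D" by auto
    from this(2,1) show "y \<in> (\<Union>n. K n)"
    proof (induction rule: conn.induct)
      case (refl x) then show ?case by (intro UN_I[of 0]) (auto simp: K_def)
    next
      case (step x y z)
      then obtain n where "y \<in> K n" by auto
      then have "z \<in> K (Suc n)" using step by (auto simp: K_def)
      then show ?case by blast
    qed
  next
    fix y assume "y \<in> (\<Union>n. K n)"
    then obtain n where "y \<in> K n" by auto
    then show "y \<in> conn D `` Y"
    proof (induction n arbitrary: y)
      case 0 then show ?case by (auto simp: K_def intro: conn.refl)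
    next
      case (Suc n)
      then obtain z where "z \<in> K n" "(z, y) \<in> G" "y \<in> D" by (auto simp: K_def)
      then show ?case using Suc.IH conn.step by blast
    qed
  qed
  ultimately show ?thesis by auto
qed

definition finite_comps :: "'a set \<Rightarrow> bool" where
  "finite_comps D \<longleftrightarrow> (\<forall>x. finite (conn D `` {x}))"

lemma local_rel_conn:
  assumes "D \<in> sets \<A>" "finite_comps D" shows "local_rel (conn D)"
proof -
  have "D \<subseteq> space X" using assms(1) sets.sets_into_space[of D \<A>] by simp
  then show ?thesis using assms conn_in unfolding local_rel_def conn_converse finite_comps_def
    by (auto intro: conn_\<A>)
qed

definition coloured :: "(bool \<Rightarrow> 'a set) \<Rightarrow> 'a set" where
  "coloured c = c False \<union> c True"

lemma in_coloured: "x \<in> c j \<Longrightarrow> x \<in> coloured c"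
  unfolding coloured_def by (cases j) auto

definition partial_colouring :: "(bool \<Rightarrow> 'a set) \<Rightarrow> bool" where
  "partial_colouring c \<longleftrightarrow> (\<forall>j. c j \<in> sets \<A>) \<and> c False \<inter> c True = {} \<and> finite_comps (coloured c)"

lemma coloured_\<A>: "partial_colouring c \<Longrightarrow> coloured c \<in> sets \<A>"
  unfolding partial_colouring_def coloured_def by auto

text \<open>Let \<open>c\<close> be a partial two-colouring and \<open>x\<close> a point. Under \<open>touch c\<close>, the point \<open>x\<close> is related
to itself and to the coloured components adjacent to it; if \<open>x\<close> gets coloured, these merge into one finite
region. Under \<open>reach c\<close> the uncoloured neighbours of that region are included. The region is sealed off if
\<open>x\<close> has one colour and these neighbours have the other one. To do so for many points at once,
two of them must not interfere: neither may the sets of points they reach intersect nor may they be linked by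
an edge or by a coloured component. This is what \<open>conflict c\<close> rules out.\<close>

definition touch :: "(bool \<Rightarrow> 'a set) \<Rightarrow> ('a \<times> 'a) set" where
  "touch c = Id_on (space X) \<union> G O conn (coloured c)"

definition reach :: "(bool \<Rightarrow> 'a set) \<Rightarrow> ('a \<times> 'a) set" where
  "reach c = Id_on (space X) \<union> touch c O G"

definition conflict :: "(bool \<Rightarrow> 'a set) \<Rightarrow> ('a \<times> 'a) set" where
  "conflict c = (reach c O reach c) O (reach c)\<inverse>"

text \<open>The points of a basic open set that can be sealed off simultaneously with colour \<open>j\<close>: no two of
them are in conflict, and none of them has the opposite colour.\<close>

definition sites :: "(bool \<Rightarrow> 'a set) \<Rightarrow> nat \<Rightarrow> bool \<Rightarrow> 'a set" where
  "sites c n j = {x \<in> basic n. conflict c `` {x} \<inter> basic n \<subseteq> {x}} - c (\<not> j)"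

definition seal :: "(bool \<Rightarrow> 'a set) \<Rightarrow> nat \<times> bool \<Rightarrow> bool \<Rightarrow> 'a set" where
  "seal c = (\<lambda>(n, j) i. let S = sites c n j in
     if i = j then c i \<union> (S - coloured c) else c i \<union> (G `` (touch c `` S) - coloured c - S))"

lemma local_rels:
  assumes "partial_colouring c"
  shows "local_rel (touch c)" "local_rel (reach c)" "local_rel (conflict c)"
proof -
  show t: "local_rel (touch c)" unfolding touch_def
    by (intro local_rel_Un local_rel_Id local_rel_comp local_G local_rel_conn coloured_\<A> assms)
      (use assms in \<open>simp add: partial_colouring_def\<close>)
  show r: "local_rel (reach c)" unfolding reach_def
    by (intro local_rel_Un local_rel_Id local_rel_comp local_G t)
  show "local_rel (conflict c)" unfolding conflict_def
    by (intro local_rel_comp local_rel_converse r)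
qed

lemma sites_\<A>:
  assumes "partial_colouring c" shows "sites c n j \<in> sets \<A>"
proof -
  have sub: "conflict c \<subseteq> space X \<times> space X" using local_rels[OF assms] by (simp add: local_rel_def)
  have "{x \<in> basic n. conflict c `` {x} \<inter> basic n \<subseteq> {x}} =
      basic n - (\<Union>m. basic m \<inter> (conflict c)\<inverse> `` (basic n - basic m))"
  proof (intro equalityI subsetI)
    fix x assume x: "x \<in> basic n - (\<Union>m. basic m \<inter> (conflict c)\<inverse> `` (basic n - basic m))"
    have "y = x" if y: "(x, y) \<in> conflict c" "y \<in> basic n" for y
    proof (rule ccontr)
      assume "y \<noteq> x"
      then obtain m where "x \<in> basic m" "basic m \<inter> {y} = {}"
        using ex_basic_isolating[of "{y}" x] y sub by auto
      then show False using x y by auto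
    qed
    then show "x \<in> {x \<in> basic n. conflict c `` {x} \<inter> basic n \<subseteq> {x}}" using x by auto
  qed auto
  also have "\<dots> \<in> sets \<A>"
    using local_rel_pre[OF local_rels(3)[OF assms] sets.Diff[OF basic_\<A> basic_\<A>]] basic_\<A>
    by (intro sets.Diff sets.countable_UN sets.Int image_subsetI) auto
  finally show ?thesis unfolding sites_def using assms by (auto simp: partial_colouring_def)
qed

text \<open>A point is in conflict with only finitely many others, and some basic neighbourhood avoids them.\<close>

lemma ex_site:
  assumes "partial_colouring c" "x \<in> space X" shows "\<exists>n j. x \<in> sites c n j"
proof -
  have "finite (conflict c `` {x} - {x})"
    using local_rel_finite_Image[OF local_rels(3)[OF assms(1)]] by simp
  then obtain n where "x \<in> basic n" "basic n \<inter> (conflict c `` {x} - {x}) = {}"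
    using ex_basic_isolating assms(2) by blast
  moreover have "x \<notin> c (\<not> (x \<in> c True))" using assms(1) by (cases "x \<in> c True") (auto simp: partial_colouring_def)
  ultimately have "x \<in> sites c n (x \<in> c True)" unfolding sites_def by auto
  then show ?thesis by blast
qed

lemma seal_extends: "c i \<subseteq> seal c k i"
  unfolding seal_def by (auto simp: Let_def split: prod.splits)

lemma coloured_seal:
  "coloured (seal c (n, j)) = coloured c \<union> sites c n j \<union> G `` (touch c `` sites c n j)"
  unfolding coloured_def seal_def by (cases j) (auto simp: Let_def coloured_def)

lemma sites_subset: "sites c n j \<subseteq> space X"
  unfolding sites_def using basic_subset by auto

lemma new_point_reach:
  assumes "p \<in> coloured (seal c (n, j))" "p \<notin> coloured c"
  shows "\<exists>x\<in>sites c n j. (x, p) \<in> reach c"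
  using assms sites_subset[of c n j] unfolding coloured_seal reach_def by blast

lemma site_unique:
  assumes "x \<in> sites c n j" "y \<in> sites c n j" "(x, y) \<in> conflict c" shows "y = x"
  using assms unfolding sites_def by auto

lemma touch_step:
  assumes "(x, y) \<in> touch c" "(y, z) \<in> G" "z \<in> coloured c" shows "(x, z) \<in> touch c"
  using assms unfolding touch_def by (auto intro: conn.intros)

text \<open>A path in the newly coloured set that starts near a site \<open>x\<close> cannot leave what \<open>x\<close> reaches and the
old components adjacent to that: the first new point outside would belong to another site in conflict with \<open>x\<close>.\<close>

lemma finite_comps_seal:
  assumes c: "partial_colouring c" shows "finite_comps (coloured (seal c (n, j)))"
  unfolding finite_comps_def
proof
  fix z
  let ?D = "coloured (seal c (n, j))" and ?S = "sites c n j"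
  have GX: "G \<subseteq> space X \<times> space X" using local_G by (simp add: local_rel_def)
  have near: "\<exists>p. (x, p) \<in> reach c \<and> (p, z) \<in> touch c"
    if x: "x \<in> ?S" "(x, p) \<in> reach c" and pz: "(p, z) \<in> conn ?D" for x p z
    using pz x
  proof (induction rule: conn.induct)
    case (refl p)
    have "p \<in> space X" using refl.prems local_rels(2)[OF c] by (auto simp: local_rel_def)
    then show ?case using refl by (auto simp: touch_def)
  next
    case (step p z z')
    then obtain p' where p': "(x, p') \<in> reach c" "(p', z) \<in> touch c" by auto
    show ?case
    proof (cases "z' \<in> coloured c")
      case True then show ?thesis using p' touch_step step.hyps(2) by blast
    next
      case False
      then obtain x' where x': "x' \<in> ?S" "(x', z') \<in> reach c"
        using new_point_reach step.hyps(3) by blast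
      have "(p', z') \<in> reach c" using p'(2) step.hyps(2) by (auto simp: reach_def)
      then have "(x, x') \<in> conflict c" using p'(1) x'(2) unfolding conflict_def by blast
      then have "x' = x" using site_unique x'(1) step.prems(1) by blast
      moreover have "(z', z') \<in> touch c" using GX step.hyps(2) by (auto simp: touch_def)
      ultimately show ?thesis using x' by blast
    qed
  qed
  show "finite (conn ?D `` {z})"
  proof (cases "\<exists>p. (z, p) \<in> conn ?D \<and> p \<notin> coloured c")
    case True
    then obtain p where p: "(z, p) \<in> conn ?D" "p \<notin> coloured c" by auto
    then obtain x where x: "x \<in> ?S" "(x, p) \<in> reach c" using new_point_reach conn_in by blast
    have "conn ?D `` {z} \<subseteq> touch c `` (reach c `` {x})"
    proof
      fix y assume "y \<in> conn ?D `` {z}"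
      then have "(p, y) \<in> conn ?D" using p conn_sym conn_trans by blast
      then show "y \<in> touch c `` (reach c `` {x})" using near[OF x] by blast
    qed
    then show ?thesis
      by (rule finite_subset) (intro local_rel_finite_Image local_rels c finite.intros)
  next
    case False
    have "(z, y) \<in> conn (coloured c)" if "(z, y) \<in> conn ?D" for y
      using that False
    proof (induction rule: conn.induct)
      case (refl z) then show ?case by (auto intro: conn.intros)
    next
      case (step z y y')
      then have "(z, y') \<in> conn ?D" by (auto intro: conn.step)
      then show ?case using step by (blast intro: conn.step)
    qed
    then have "conn ?D `` {z} \<subseteq> conn (coloured c) `` {z}" by auto
    then show ?thesis using c finite_subset unfolding partial_colouring_def finite_comps_def by blast
  qed
qed

lemma partial_colouring_seal:
  assumes "partial_colouring c" shows "partial_colouring (seal c k)"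
proof -
  obtain n j where k: "k = (n, j)" by (cases k)
  have "G `` (touch c `` sites c n j) \<in> sets \<A>"
    by (intro local_rel_Image local_G local_rels assms sites_\<A>)
  then have "seal c k i \<in> sets \<A>" for i
    using assms sites_\<A>[OF assms, of n j] coloured_\<A>[OF assms]
    unfolding k seal_def partial_colouring_def by (auto simp: Let_def)
  moreover have "seal c k False \<inter> seal c k True = {}"
    using assms unfolding k seal_def partial_colouring_def
    by (cases j) (auto simp: Let_def coloured_def sites_def)
  ultimately show ?thesis
    using finite_comps_seal[OF assms] unfolding k partial_colouring_def by blast
qed

text \<open>The monochromatic component of \<open>x\<close> has only coloured neighbours, so it is the same in every larger colouring.\<close>

definition sealed :: "(bool \<Rightarrow> 'a set) \<Rightarrow> 'a set" where
  "sealed c = {x. \<exists>j. x \<in> c j \<and> G `` (conn (c j) `` {x}) \<subseteq> coloured c}"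

lemma sealed_\<A>:
  assumes "partial_colouring c" shows "sealed c \<in> sets \<A>"
proof -
  have cj: "c j \<in> sets \<A>" for j using assms by (simp add: partial_colouring_def)
  have GX: "G \<subseteq> space X \<times> space X" using local_G by (simp add: local_rel_def)
  have "sealed c = (\<Union>j. c j - conn (c j) `` (G `` (space X - coloured c)))"
  proof (intro equalityI subsetI)
    fix x assume "x \<in> sealed c"
    then obtain j where j: "x \<in> c j" "G `` (conn (c j) `` {x}) \<subseteq> coloured c" by (auto simp: sealed_def)
    have "x \<notin> conn (c j) `` (G `` (space X - coloured c))"
    proof
      assume "x \<in> conn (c j) `` (G `` (space X - coloured c))"
      then obtain y z where "y \<notin> coloured c" "(y, z) \<in> G" "(z, x) \<in> conn (c j)" by auto
      then show False using j conn_sym sym_G by (blast dest: symD)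
    qed
    then show "x \<in> (\<Union>j. c j - conn (c j) `` (G `` (space X - coloured c)))" using j by blast
  next
    fix x assume "x \<in> (\<Union>j. c j - conn (c j) `` (G `` (space X - coloured c)))"
    then obtain j where j: "x \<in> c j" "x \<notin> conn (c j) `` (G `` (space X - coloured c))" by auto
    have "y \<in> coloured c" if "(x, z) \<in> conn (c j)" "(z, y) \<in> G" for y z
    proof (rule ccontr)
      assume "y \<notin> coloured c"
      moreover have "(y, z) \<in> G" "y \<in> space X" using that(2) sym_G GX by (auto dest: symD)
      ultimately show False using j(2) conn_sym[OF that(1)] by blast
    qed
    then show "x \<in> sealed c" using j unfolding sealed_def by blast
  qed
  also have "\<dots> \<in> sets \<A>"
  proof (intro sets.countable_UN' image_subsetI)
    fix j
    have "space X - coloured c \<in> sets \<A>"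
      using coloured_\<A>[OF assms] sets.compl_sets[of "coloured c" \<A>] by simp
    then show "c j - conn (c j) `` (G `` (space X - coloured c)) \<in> sets \<A>"
      by (rule sets.Diff[OF cj conn_\<A>[OF cj local_rel_Image[OF local_G]]])
  qed auto
  finally show ?thesis .
qed

text \<open>Starting at a site \<open>x\<close> of colour \<open>j\<close>, a path of colour \<open>j\<close> stays in the region \<open>touch c `` {x}\<close>,
because a new point of colour \<open>j\<close> next to it would be a site in conflict with \<open>x\<close>.\<close>

lemma sites_sealed:
  assumes c: "partial_colouring c" and x: "x \<in> sites c n j" shows "x \<in> sealed (seal c (n, j))"
proof -
  let ?c = "seal c (n, j)" and ?S = "sites c n j"
  have GX: "G \<subseteq> space X \<times> space X" using local_G by (simp add: local_rel_def)
  have cj: "?c j = c j \<union> (?S - coloured c)" by (simp add: seal_def)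
  have xX: "x \<in> space X" using x sites_subset by auto
  have "x \<in> ?c j" using x unfolding cj by (cases j) (auto simp: sites_def coloured_def)
  have *: "(x, z) \<in> touch c" if "(x', z) \<in> conn (?c j)" "x' = x" for x' z
    using that
  proof (induction rule: conn.induct)
    case (refl x') then show ?case using xX by (auto simp: touch_def)
  next
    case (step x' z z')
    then have t: "(x, z) \<in> touch c" by simp
    show ?case
    proof (cases "z' \<in> coloured c")
      case True then show ?thesis using touch_step t step.hyps(2) by blast
    next
      case False
      then have "z' \<in> ?S" using step.hyps(3) unfolding cj by (auto dest: in_coloured)
      moreover have "(x, z') \<in> reach c" using t step.hyps(2) unfolding reach_def by blast
      moreover have "(z', z') \<in> reach c" using GX step.hyps(2) by (auto simp: reach_def)
      ultimately have "z' = x" using site_unique[OF x] unfolding conflict_def by blast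
      then show ?thesis using xX by (auto simp: touch_def)
    qed
  qed
  then have "G `` (conn (?c j) `` {x}) \<subseteq> coloured ?c" using x unfolding coloured_seal by blast
  then show ?thesis using \<open>x \<in> ?c j\<close> unfolding sealed_def by blast
qed

lemma conn_sealed:
  assumes ext: "\<And>i. c i \<subseteq> c' i" and disj: "c' False \<inter> c' True = {}"
    and x: "x \<in> c j" "G `` (conn (c j) `` {x}) \<subseteq> coloured c"
  shows "conn (c' j) `` {x} \<subseteq> conn (c j) `` {x}"
proof -
  have "(x, z) \<in> conn (c j)" if "(x', z) \<in> conn (c' j)" "x' = x" for x' z
    using that
  proof (induction rule: conn.induct)
    case (refl x') then show ?case using x by (auto intro: conn.refl)
  next
    case (step x' z z')
    then have "z' \<in> coloured c" using x(2) by auto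
    moreover have "z' \<notin> c (\<not> j)" using ext[of "\<not> j"] disj step.hyps(3) by (cases j) auto
    ultimately have "z' \<in> c j" by (cases j) (auto simp: coloured_def)
    then show ?case using step by (auto intro: conn.step)
  qed
  then show ?thesis by auto
qed

lemma sealed_mono:
  assumes "\<And>i. c i \<subseteq> c' i" "c' False \<inter> c' True = {}"
  shows "sealed c \<subseteq> sealed c'"
proof
  fix x assume "x \<in> sealed c"
  then obtain j where j: "x \<in> c j" "G `` (conn (c j) `` {x}) \<subseteq> coloured c" by (auto simp: sealed_def)
  have "coloured c \<subseteq> coloured c'" using assms(1) unfolding coloured_def by blast
  then have "G `` (conn (c' j) `` {x}) \<subseteq> coloured c'" using conn_sealed[OF assms j] j(2) by blast
  then show "x \<in> sealed c'" using j(1) assms(1) unfolding sealed_def by blast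
qed

definition seals :: "(bool \<Rightarrow> 'a set) \<Rightarrow> (nat \<times> bool) list \<Rightarrow> bool \<Rightarrow> 'a set" where
  "seals = foldl seal"

lemma partial_colouring_seals: "partial_colouring c \<Longrightarrow> partial_colouring (seals c ks)"
  by (induction ks arbitrary: c) (auto simp: seals_def partial_colouring_seal)

lemma seals_extends: "c i \<subseteq> seals c ks i"
proof (induction ks arbitrary: c)
  case (Cons k ks)
  have "seals c (k # ks) = seals (seal c k) ks" by (simp add: seals_def)
  then show ?case using Cons[of "seal c k"] seal_extends[of c i k] by auto
qed (simp add: seals_def)

lemma ex_seals:
  assumes "finite F" "F \<subseteq> space X" "partial_colouring c"
  shows "\<exists>ks. F \<subseteq> sealed (seals c ks)"
  using assms(1,2)
proof (induction F rule: finite_induct)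
  case (insert x F)
  then obtain ks where ks: "F \<subseteq> sealed (seals c ks)" by auto
  have c': "partial_colouring (seals c ks)" by (intro partial_colouring_seals assms)
  obtain n j where nj: "x \<in> sites (seals c ks) n j" using ex_site[OF c', of x] insert by auto
  have eq: "seals c (ks @ [(n, j)]) = seal (seals c ks) (n, j)" by (simp add: seals_def)
  have "sealed (seals c ks) \<subseteq> sealed (seal (seals c ks) (n, j))"
    using partial_colouring_seal[OF c', of "(n, j)"]
    by (intro sealed_mono seal_extends) (simp add: partial_colouring_def)
  then have "insert x F \<subseteq> sealed (seals c (ks @ [(n, j)]))"
    unfolding eq using ks sites_sealed[OF c' nj] by auto
  then show ?case by blast
qed auto

fun balls :: "nat \<Rightarrow> ('a \<times> 'a) set" where
  "balls 0 = Id_on (space X)"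
| "balls (Suc r) = (Id_on (space X) \<union> G) O balls r"

lemma local_rel_balls: "local_rel (balls r)"
  by (induction r) (auto intro!: local_rel_comp local_rel_Un local_rel_Id local_G)

text \<open>Sealing off whole balls, and not just their centres, makes the exceptional set invariant: the
component of a generic point may contain points of a meager set.\<close>

definition ball_sealed :: "nat \<Rightarrow> (bool \<Rightarrow> 'a set) \<Rightarrow> 'a set" where
  "ball_sealed r c = {x \<in> space X. balls r `` {x} \<subseteq> sealed c}"

lemma ball_sealed_\<A>:
  assumes "partial_colouring c" shows "ball_sealed r c \<in> sets \<A>"
proof -
  have sub: "balls r \<subseteq> space X \<times> space X" using local_rel_balls by (simp add: local_rel_def)
  have "ball_sealed r c = space \<A> - (balls r)\<inverse> `` (space \<A> - sealed c)"
    unfolding ball_sealed_def using sub by auto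
  also have "\<dots> \<in> sets \<A>"
    by (intro sets.compl_sets local_rel_pre local_rel_balls sealed_\<A> assms)
  finally show ?thesis .
qed

text \<open>Every point of \<open>basic n\<close> has its ball sealed off by one of countably many lists of steps, and
\<open>basic n\<close> is not meager.\<close>

lemma ex_nonmeager_seals:
  assumes c: "partial_colouring c" and ne: "basic n \<noteq> {}"
  shows "\<exists>ks. \<not> meager_in \<tau> (ball_sealed r (seals c ks) \<inter> basic n)"
proof (rule ccontr)
  assume "\<not> ?thesis"
  then have "meager_in \<tau> (\<Union>ks\<in>UNIV. ball_sealed r (seals c ks) \<inter> basic n)"
    by (intro meager_in_UN_countable) auto
  moreover have "basic n \<subseteq> (\<Union>ks\<in>UNIV. ball_sealed r (seals c ks) \<inter> basic n)"
  proof
    fix x assume x: "x \<in> basic n"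
    have sub: "balls r \<subseteq> space X \<times> space X" using local_rel_balls by (simp add: local_rel_def)
    have "finite (balls r `` {x})" by (intro local_rel_finite_Image local_rel_balls) auto
    moreover have "balls r `` {x} \<subseteq> space X" using sub by auto
    ultimately obtain ks where "balls r `` {x} \<subseteq> sealed (seals c ks)" using ex_seals[OF _ _ c] by blast
    then show "x \<in> (\<Union>ks\<in>UNIV. ball_sealed r (seals c ks) \<inter> basic n)"
      using x basic_subset[of n] unfolding ball_sealed_def by blast
  qed
  ultimately have "meager_in \<tau> (basic n)" by (rule meager_in_subset)
  then show False using not_meager_open[OF openin_basic ne] by simp
qed

text \<open>Step \<open>m\<close> of the construction treats the pair \<open>(n, r)\<close> coded by \<open>m\<close>: it seals off the \<open>r\<close>-balls of a nonmeager
set of points in \<open>basic n\<close>. The points whose \<open>r\<close>-ball is never sealed off form a set with the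
Baire property. If it were not meager, it would be comeager in some \<open>basic n\<close>, contrary to the step for \<open>(n, r)\<close>.\<close>

theorem ex_generic_colouring:
  "\<exists>C U. U \<in> sets \<A> \<and> C \<subseteq> space X \<and> meager_in \<tau> (space X - C) \<and> G `` C \<subseteq> C \<and>
     (\<forall>x\<in>C. finite (conn U `` {x}) \<and> finite (conn (space X - U) `` {x}))"
proof -
  \<comment> \<open>The hypothesis \<open>basic n \<noteq> {}\<close> is there because a base may contain the empty set.\<close>
  define pick where "pick c m = (SOME ks. basic (fst (prod_decode m)) \<noteq> {} \<longrightarrow>
      \<not> meager_in \<tau> (ball_sealed (snd (prod_decode m)) (seals c ks) \<inter> basic (fst (prod_decode m))))"
    for c m
  have pick: "\<not> meager_in \<tau> (ball_sealed r (seals c (pick c (prod_encode (n, r)))) \<inter> basic n)"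
    if "partial_colouring c" "basic n \<noteq> {}" for c n r
  proof -
    have "\<exists>ks. basic (fst (prod_decode (prod_encode (n, r)))) \<noteq> {} \<longrightarrow> \<not> meager_in \<tau>
      (ball_sealed (snd (prod_decode (prod_encode (n, r)))) (seals c ks) \<inter> basic (fst (prod_decode (prod_encode (n, r)))))"
      using ex_nonmeager_seals[OF that, of r] by simp
    from someI_ex[OF this] show ?thesis using that unfolding pick_def by simp
  qed
  define c where "c = rec_nat (\<lambda>_. {}) (\<lambda>m c. seals c (pick c m))"
  have c_Suc: "c (Suc m) = seals (c m) (pick (c m) m)" for m by (simp add: c_def)
  have pc: "partial_colouring (c m)" for m
  proof (induction m)
    case 0
    have "conn {} = {}" using conn_in[of _ _ "{}"] by auto
    then show ?case by (simp add: c_def partial_colouring_def coloured_def finite_comps_def)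
  next
    case (Suc m) then show ?case unfolding c_Suc by (rule partial_colouring_seals)
  qed
  have mono: "c m i \<subseteq> c m' i" if "m \<le> m'" for m m' i
    using that
  proof (induction rule: dec_induct)
    case (step k)
    then show ?case using seals_extends[of "c k" i "pick (c k) k"] unfolding c_Suc by blast
  qed simp
  define U where "U i = (\<Union>m. c m i)" for i
  have disj: "U False \<inter> U True = {}"
  proof -
    have "x \<notin> c m' True" if "x \<in> c m False" for x m m'
      using that mono[of m "max m m'" False] mono[of m' "max m m'" True] pc[of "max m m'"]
      by (auto simp: partial_colouring_def)
    then show ?thesis by (auto simp: U_def)
  qed
  define C where "C = {x \<in> space X. \<forall>r. \<exists>m. x \<in> ball_sealed r (c m)}"
  have finU: "finite (conn (U i) `` {x})" if x: "x \<in> sealed (c m)" for x m i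
  proof (cases "x \<in> U i")
    case True
    obtain j where j: "x \<in> c m j" "G `` (conn (c m j) `` {x}) \<subseteq> coloured (c m)"
      using x unfolding sealed_def by blast
    then have "x \<in> U j" by (auto simp: U_def)
    then have "i = j" using True disj by (cases i; cases j) auto
    have "conn (U j) `` {x} \<subseteq> conn (c m j) `` {x}"
      by (rule conn_sealed[OF _ disj j]) (auto simp: U_def)
    also have "\<dots> \<subseteq> conn (coloured (c m)) `` {x}"
      using conn_mono in_coloured by blast
    finally show ?thesis using pc[of m] finite_subset \<open>i = j\<close>
      unfolding partial_colouring_def finite_comps_def by blast
  next
    case False
    then have "conn (U i) `` {x} = {}" using conn_in by blast
    then show ?thesis by simp
  qed
  have Csealed: "\<exists>m. x \<in> sealed (c m)" if x: "x \<in> C" for x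
  proof -
    obtain m where "x \<in> ball_sealed 0 (c m)" "x \<in> space X" using x by (auto simp: C_def)
    then have "x \<in> sealed (c m)" by (auto simp: ball_sealed_def)
    then show ?thesis by blast
  qed
  have GX: "G \<subseteq> space X \<times> space X" using local_G by (simp add: local_rel_def)
  have inv: "y \<in> C" if "x \<in> C" "(x, y) \<in> G" for x y
  proof -
    have "\<exists>m. y \<in> ball_sealed r (c m)" for r
    proof -
      obtain m where "x \<in> ball_sealed (Suc r) (c m)" using \<open>x \<in> C\<close> by (auto simp: C_def)
      then have "y \<in> ball_sealed r (c m)" using that(2) GX unfolding ball_sealed_def by auto
      then show ?thesis by blast
    qed
    then show ?thesis using that(2) GX unfolding C_def by auto
  qed
  have CU: "C \<subseteq> U False \<union> U True"
  proof
    fix x assume "x \<in> C"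
    then obtain m where "x \<in> sealed (c m)" using Csealed by blast
    then obtain j where "x \<in> c m j" unfolding sealed_def by auto
    then show "x \<in> U False \<union> U True" by (cases j) (auto simp: U_def)
  qed
  have "meager_in \<tau> (space X - (\<Union>m. ball_sealed r (c m)))" for r
  proof -
    let ?M = "space X - (\<Union>m. ball_sealed r (c m))"
    have "space \<A> - (\<Union>m. ball_sealed r (c m)) \<in> sets \<A>"
      by (intro sets.compl_sets sets.countable_UN') (auto intro: ball_sealed_\<A> pc)
    then have "baire_property \<tau> ?M" using baire_property_\<A> by simp
    then obtain V where V: "openin \<tau> V" "meager_in \<tau> ((?M - V) \<union> (V - ?M))"
      unfolding baire_property_def by blast
    have "V = {}"
    proof (rule ccontr)
      assume "V \<noteq> {}"
      then obtain n where n: "basic n \<noteq> {}" "basic n \<subseteq> V" using ex_basic[OF V(1)] by blast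
      have "ball_sealed r (c (Suc (prod_encode (n, r)))) \<inter> basic n \<subseteq> (?M - V) \<union> (V - ?M)"
        using n by auto
      then have "meager_in \<tau> (ball_sealed r (c (Suc (prod_encode (n, r)))) \<inter> basic n)"
        using V(2) meager_in_subset by blast
      then show False using pick[OF pc n(1)] unfolding c_Suc by blast
    qed
    then show ?thesis using V(2) by simp
  qed
  then have "meager_in \<tau> (\<Union>r. space X - (\<Union>m. ball_sealed r (c m)))" by (rule meager_in_UN)
  then have "meager_in \<tau> (space X - C)" by (rule meager_in_subset) (auto simp: C_def)
  moreover have "U False \<in> sets \<A>"
    unfolding U_def using pc by (intro sets.countable_UN') (auto simp: partial_colouring_def)
  moreover have "finite (conn (U False) `` {x})" if "x \<in> C" for x
    using Csealed[OF that] finU by blast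
  moreover have "finite (conn (space X - U False) `` {x})" if x: "x \<in> C" for x
  proof -
    have "(x', y) \<in> conn (U True) \<and> y \<in> C" if "(x', y) \<in> conn (space X - U False)" "x' = x" for x' y
      using that
    proof (induction rule: conn.induct)
      case (refl x') then show ?case using x CU by (auto intro: conn.refl)
    next
      case (step x' y z)
      then have "z \<in> C" using inv by blast
      then have "z \<in> U True" using CU step.hyps(3) by blast
      then show ?case using step \<open>z \<in> C\<close> by (auto intro: conn.step)
    qed
    then have "conn (space X - U False) `` {x} \<subseteq> conn (U True) `` {x}" by auto
    then show ?thesis using Csealed[OF x] finU finite_subset by blast
  qed
  moreover have "C \<subseteq> space X" by (auto simp: C_def)
  moreover have "G `` C \<subseteq> C" using inv by auto
  ultimately show ?thesis by blast
qed

end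

section \<open>The Lovasz Local Lemma\<close>

lemma card_PiE_split:
  fixes Y :: "'c set"
  assumes "D \<subseteq> V"
    and P: "\<And>f g. (\<And>x. x \<in> D \<Longrightarrow> f x = g x) \<Longrightarrow> P f \<longleftrightarrow> P g"
    and Q: "\<And>f g. (\<And>x. x \<in> V - D \<Longrightarrow> f x = g x) \<Longrightarrow> Q f \<longleftrightarrow> Q g"
  shows "card {f \<in> V \<rightarrow>\<^sub>E Y. P f \<and> Q f} =
    card {g \<in> D \<rightarrow>\<^sub>E Y. P g} * card {h \<in> (V - D) \<rightarrow>\<^sub>E Y. Q h}"
proof -
  have P': "P (restrict f D) \<longleftrightarrow> P f" for f by (rule P) simp
  have Q': "Q (restrict f (V - D)) \<longleftrightarrow> Q f" for f by (rule Q) simp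
  let ?glue = "\<lambda>(g, h) x. if x \<in> D then g x else h x"
  have Pg: "P (?glue (g, h)) \<longleftrightarrow> P g" for g h by (rule P) simp
  have Qh: "Q (?glue (g, h)) \<longleftrightarrow> Q h" for g h by (rule Q) simp
  have "bij_betw (\<lambda>f. (restrict f D, restrict f (V - D))) {f \<in> V \<rightarrow>\<^sub>E Y. P f \<and> Q f}
    ({g \<in> D \<rightarrow>\<^sub>E Y. P g} \<times> {h \<in> (V - D) \<rightarrow>\<^sub>E Y. Q h})"
  proof (rule bij_betw_byWitness[where f' = ?glue])
    show "\<forall>f\<in>{f \<in> V \<rightarrow>\<^sub>E Y. P f \<and> Q f}. ?glue (restrict f D, restrict f (V - D)) = f"
      using assms(1) by (auto simp: fun_eq_iff PiE_def extensional_def)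
    show "\<forall>gh\<in>{g \<in> D \<rightarrow>\<^sub>E Y. P g} \<times> {h \<in> (V - D) \<rightarrow>\<^sub>E Y. Q h}.
        (restrict (?glue gh) D, restrict (?glue gh) (V - D)) = gh"
      by (auto simp: fun_eq_iff PiE_def extensional_def)
    show "(\<lambda>f. (restrict f D, restrict f (V - D))) ` {f \<in> V \<rightarrow>\<^sub>E Y. P f \<and> Q f}
        \<subseteq> {g \<in> D \<rightarrow>\<^sub>E Y. P g} \<times> {h \<in> (V - D) \<rightarrow>\<^sub>E Y. Q h}"
      using assms(1) by (auto simp: P' Q' PiE_iff)
    show "?glue ` ({g \<in> D \<rightarrow>\<^sub>E Y. P g} \<times> {h \<in> (V - D) \<rightarrow>\<^sub>E Y. Q h}) \<subseteq> {f \<in> V \<rightarrow>\<^sub>E Y. P f \<and> Q f}"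
    proof
      fix f assume "f \<in> ?glue ` ({g \<in> D \<rightarrow>\<^sub>E Y. P g} \<times> {h \<in> (V - D) \<rightarrow>\<^sub>E Y. Q h})"
      then obtain g h where gh: "f = ?glue (g, h)" "g \<in> D \<rightarrow>\<^sub>E Y" "P g" "h \<in> (V - D) \<rightarrow>\<^sub>E Y" "Q h" by auto
      have "f \<in> V \<rightarrow>\<^sub>E Y" using gh(2,4) assms(1) unfolding gh(1)
        by (auto simp: PiE_iff extensional_def)
      then show "f \<in> {f \<in> V \<rightarrow>\<^sub>E Y. P f \<and> Q f}" using gh(3,5) unfolding gh(1) by (simp only: mem_Collect_eq Pg Qh)
    qed
  qed
  from bij_betw_same_card[OF this] show ?thesis by (simp add: card_cartesian_product)
qed

text \<open>Events that depend on disjoint sets of variables are independent.\<close>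

lemma card_PiE_indep:
  fixes Y :: "'c set"
  assumes "D \<subseteq> V"
    and P: "\<And>f g. (\<And>x. x \<in> D \<Longrightarrow> f x = g x) \<Longrightarrow> P f \<longleftrightarrow> P g"
    and Q: "\<And>f g. (\<And>x. x \<in> V - D \<Longrightarrow> f x = g x) \<Longrightarrow> Q f \<longleftrightarrow> Q g"
  shows "card {f \<in> V \<rightarrow>\<^sub>E Y. P f \<and> Q f} * card (D \<rightarrow>\<^sub>E Y) =
    card {g \<in> D \<rightarrow>\<^sub>E Y. P g} * card {f \<in> V \<rightarrow>\<^sub>E Y. Q f}"
proof -
  have "card {f \<in> V \<rightarrow>\<^sub>E Y. P f \<and> Q f} = card {g \<in> D \<rightarrow>\<^sub>E Y. P g} * card {h \<in> (V - D) \<rightarrow>\<^sub>E Y. Q h}"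
    by (intro card_PiE_split assms(1) P Q)
  moreover have "card {f \<in> V \<rightarrow>\<^sub>E Y. True \<and> Q f} = card {g \<in> D \<rightarrow>\<^sub>E Y. True} * card {h \<in> (V - D) \<rightarrow>\<^sub>E Y. Q h}"
    by (intro card_PiE_split assms(1) Q refl)
  ultimately show ?thesis by simp
qed

text \<open>The choice \<open>x = 1 / (d + 1)\<close> works because \<open>(1 + 1 / d) ^ d \<le> e\<close>. It is not less than \<open>1\<close> for
  \<open>d = 0\<close>, where \<open>x = 1 / e\<close> is taken instead.\<close>

lemma lll_threshold:
  fixes d :: nat
  shows "\<exists>x. 0 \<le> x \<and> x < 1 \<and> 1 / (exp 1 * (real d + 1)) \<le> x * (1 - x) ^ d"
proof (cases "d = 0")
  case True
  have "1 / exp 1 < (1::real)" by simp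
  then show ?thesis using True by (intro exI[of _ "1 / exp 1"]) auto
next
  case False
  define x where "x = 1 / (real d + 1)"
  have x: "0 < x" "x < 1" using False by (auto simp: x_def)
  have "(1 + 1 / real d) ^ d \<le> exp (1 / real d) ^ d"
    by (intro power_mono exp_ge_add_one_self) auto
  also have "\<dots> = exp 1" using False by (simp add: exp_of_nat_mult[symmetric])
  finally have e: "(1 + 1 / real d) ^ d \<le> exp 1" .
  have "1 - x = real d / (real d + 1)" by (simp add: x_def field_simps)
  moreover have "1 + 1 / real d = (real d + 1) / real d" using False by (simp add: field_simps)
  moreover have "real d \<noteq> 0" "real d + 1 \<noteq> 0" using False by linarith+
  ultimately have "(1 - x) * (1 + 1 / real d) = 1" by simp
  then have "(1 - x) ^ d * (1 + 1 / real d) ^ d = 1" by (simp add: power_mult_distrib[symmetric])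
  moreover have "(1 - x) ^ d * (1 + 1 / real d) ^ d \<le> (1 - x) ^ d * exp 1"
    using e x by (intro mult_left_mono) auto
  ultimately have "1 / exp 1 \<le> (1 - x) ^ d" by (simp add: field_simps)
  then have "x * (1 / exp 1) \<le> x * (1 - x) ^ d" using x by (intro mult_left_mono) auto
  then show ?thesis using x by (intro exI[of _ x]) (simp add: x_def field_simps)
qed

text \<open>Probabilities are those of a uniformly random \<open>f \<in> V \<rightarrow>\<^sub>E {..<q}\<close>, and \<open>bad B\<close> is an event that
depends only on the variables in \<open>dm B\<close>.\<close>

locale finite_lovasz_local_lemma =
  fixes V :: "'a set" and I :: "'b set" and dm :: "'b \<Rightarrow> 'a set" and bad :: "'b \<Rightarrow> ('a \<Rightarrow> nat) \<Rightarrow> bool"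
    and q d :: nat
  assumes fin: "finite V" "finite I"
    and q: "q > 0"
    and dm: "\<And>B. B \<in> I \<Longrightarrow> dm B \<subseteq> V"
    and dep: "\<And>B f g. B \<in> I \<Longrightarrow> (\<And>x. x \<in> dm B \<Longrightarrow> f x = g x) \<Longrightarrow> bad B f \<longleftrightarrow> bad B g"
    and deg: "\<And>B. B \<in> I \<Longrightarrow> card {B' \<in> I. B' \<noteq> B \<and> dm B' \<inter> dm B \<noteq> {}} \<le> d"
    and prob: "\<And>B. B \<in> I \<Longrightarrow>
      real (card {g \<in> dm B \<rightarrow>\<^sub>E {..<q}. bad B g}) \<le> 1 / (exp 1 * (real d + 1)) * real q ^ card (dm B)"
begin

abbreviation \<Omega> :: "('a \<Rightarrow> nat) set" where "\<Omega> \<equiv> V \<rightarrow>\<^sub>E {..<q}"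

definition good :: "'b set \<Rightarrow> ('a \<Rightarrow> nat) set" where
  "good S = {f \<in> \<Omega>. \<forall>B\<in>S. \<not> bad B f}"

lemma finite_\<Omega>: "finite \<Omega>"
  using fin by (intro finite_PiE) auto

lemma finite_good: "finite (good S)"
  by (rule finite_subset[OF _ finite_\<Omega>]) (auto simp: good_def)

lemma good_insert: "card (good (insert B S)) = card (good S) - card {f \<in> good S. bad B f}"
proof -
  have "good (insert B S) = good S - {f \<in> good S. bad B f}" by (auto simp: good_def)
  then show ?thesis using finite_good by (simp add: card_Diff_subset)
qed

text \<open>Adding the events of \<open>F\<close> one at a time costs a factor \<open>1 - x\<close> each.\<close>

lemma good_chain:
  assumes "finite F" "x \<ge> 0" "x < 1"
    and step: "\<And>T B. S \<subseteq> T \<Longrightarrow> T \<subset> S \<union> F \<Longrightarrow> B \<in> F - T \<Longrightarrow> real (card {f \<in> good T. bad B f}) \<le> x * real (card (good T))"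
    and disj: "S \<inter> F = {}"
  shows "(1 - x) ^ card F * real (card (good S)) \<le> real (card (good (S \<union> F)))"
  using assms(1,4,5)
proof (induction F rule: finite_induct)
  case (insert B F)
  have IH: "(1 - x) ^ card F * real (card (good S)) \<le> real (card (good (S \<union> F)))"
    by (rule insert.IH) (use insert.prems insert.hyps in auto)
  have B: "real (card {f \<in> good (S \<union> F). bad B f}) \<le> x * real (card (good (S \<union> F)))"
    using insert.hyps insert.prems by (intro insert.prems(1)) auto
  have le: "card {f \<in> good (S \<union> F). bad B f} \<le> card (good (S \<union> F))"
    by (rule card_mono[OF finite_good]) auto
  have "S \<union> insert B F = insert B (S \<union> F)" by auto
  then have "real (card (good (S \<union> insert B F))) = real (card (good (S \<union> F))) - real (card {f \<in> good (S \<union> F). bad B f})"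
    using good_insert[of B "S \<union> F"] le by simp
  also have "\<dots> \<ge> (1 - x) * real (card (good (S \<union> F)))" using B by (simp add: algebra_simps)
  finally have "(1 - x) * real (card (good (S \<union> F))) \<le> real (card (good (S \<union> insert B F)))" .
  moreover have "(1 - x) * ((1 - x) ^ card F * real (card (good S))) \<le> (1 - x) * real (card (good (S \<union> F)))"
    using IH assms(3) by (intro mult_left_mono) auto
  ultimately show ?case using insert.hyps by (simp add: mult.assoc)
qed simp

text \<open>Given that no event in \<open>S\<close> happens, \<open>B\<close> has conditional probability at most \<open>x\<close>. Let \<open>S1\<close> be the
part of \<open>S\<close> that shares variables with \<open>B\<close>, which has at most \<open>d\<close> members, and \<open>S2\<close> the rest,
which is independent of \<open>B\<close>. Dropping \<open>S1\<close> from the condition changes the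
numerator to \<open>P(B) P(good S2)\<close>, and by induction shrinks the denominator by no more than \<open>(1 - x) ^ d\<close>.\<close>

lemma bad_given_good:
  assumes x: "0 \<le> x" "x < 1" "1 / (exp 1 * (real d + 1)) \<le> x * (1 - x) ^ d"
  shows "S \<subseteq> I \<Longrightarrow> B \<in> I - S \<Longrightarrow> real (card {f \<in> good S. bad B f}) \<le> x * real (card (good S))"
proof (induction "card S" arbitrary: S B rule: less_induct)
  case less
  have finS: "finite S" using less.prems fin finite_subset by auto
  define S1 where "S1 = {B' \<in> S. dm B' \<inter> dm B \<noteq> {}}"
  define S2 where "S2 = S - S1"
  let ?p = "1 / (exp 1 * (real d + 1))"
  have BI: "B \<in> I" using less.prems by auto
  have "real (card {f \<in> \<Omega>. bad B f \<and> (\<forall>B'\<in>S2. \<not> bad B' f)}) * real q ^ card (dm B) =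
      real (card {g \<in> dm B \<rightarrow>\<^sub>E {..<q}. bad B g}) * real (card (good S2))"
  proof -
    have "card {f \<in> \<Omega>. bad B f \<and> (\<forall>B'\<in>S2. \<not> bad B' f)} * card (dm B \<rightarrow>\<^sub>E {..<q}) =
      card {g \<in> dm B \<rightarrow>\<^sub>E {..<q}. bad B g} * card {f \<in> \<Omega>. \<forall>B'\<in>S2. \<not> bad B' f}"
    proof (rule card_PiE_indep[OF dm[OF BI]])
      show "bad B f \<longleftrightarrow> bad B g" if "\<And>x. x \<in> dm B \<Longrightarrow> f x = g x" for f g
        using dep[OF BI that] .
      fix f g :: "'a \<Rightarrow> nat" assume fg: "\<And>x. x \<in> V - dm B \<Longrightarrow> f x = g x"
      have "bad B' f \<longleftrightarrow> bad B' g" if B': "B' \<in> S2" for B'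
      proof (rule dep)
        show "B' \<in> I" using B' less.prems by (auto simp: S2_def)
        fix x assume "x \<in> dm B'"
        then show "f x = g x" using B' dm[OF \<open>B' \<in> I\<close>] by (intro fg) (auto simp: S1_def S2_def)
      qed
      then show "(\<forall>B'\<in>S2. \<not> bad B' f) \<longleftrightarrow> (\<forall>B'\<in>S2. \<not> bad B' g)" by auto
    qed
    moreover have "card (dm B \<rightarrow>\<^sub>E {..<q}) = q ^ card (dm B)"
      using fin dm[OF BI] finite_subset by (subst card_PiE) auto
    ultimately show ?thesis unfolding good_def
      by (simp only: of_nat_mult[symmetric] of_nat_power[symmetric])
  qed
  also have "\<dots> \<le> (?p * real q ^ card (dm B)) * real (card (good S2))"
    using prob[OF BI] by (intro mult_right_mono) auto
  finally have "real (card {f \<in> \<Omega>. bad B f \<and> (\<forall>B'\<in>S2. \<not> bad B' f)}) * real q ^ card (dm B) \<le>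
      (?p * real (card (good S2))) * real q ^ card (dm B)" by (simp add: mult_ac)
  then have 1: "real (card {f \<in> \<Omega>. bad B f \<and> (\<forall>B'\<in>S2. \<not> bad B' f)}) \<le> ?p * real (card (good S2))"
    by (rule mult_right_le_imp_le) (use q in simp)
  have "card {f \<in> good S. bad B f} \<le> card {f \<in> \<Omega>. bad B f \<and> (\<forall>B'\<in>S2. \<not> bad B' f)}"
    by (intro card_mono finite_subset[OF _ finite_\<Omega>]) (auto simp: good_def S2_def)
  then have "real (card {f \<in> good S. bad B f}) \<le> ?p * real (card (good S2))" using 1 by linarith
  also have "\<dots> \<le> (x * (1 - x) ^ d) * real (card (good S2))"
    using x by (intro mult_right_mono) auto
  also have "\<dots> \<le> (x * (1 - x) ^ card S1) * real (card (good S2))"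
  proof -
    have "S1 \<subseteq> {B' \<in> I. B' \<noteq> B \<and> dm B' \<inter> dm B \<noteq> {}}"
      using less.prems by (auto simp: S1_def)
    then have "card S1 \<le> card {B' \<in> I. B' \<noteq> B \<and> dm B' \<inter> dm B \<noteq> {}}"
      using fin(2) by (intro card_mono) auto
    then have "card S1 \<le> d" using deg[OF BI] by linarith
    then have "(1 - x) ^ d \<le> (1 - x) ^ card S1" using x by (intro power_decreasing) auto
    then show ?thesis using x by (intro mult_right_mono mult_left_mono) auto
  qed
  also have "\<dots> = x * ((1 - x) ^ card S1 * real (card (good S2)))" by simp
  also have "\<dots> \<le> x * real (card (good (S2 \<union> S1)))"
  proof (rule mult_left_mono[OF good_chain])
    show "finite S1" using finS by (simp add: S1_def)
    fix T B' assume T: "S2 \<subseteq> T" "T \<subset> S2 \<union> S1" "B' \<in> S1 - T"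
    have "S2 \<union> S1 = S" by (auto simp: S1_def S2_def)
    then have "card T < card S" using T finS by (intro psubset_card_mono) auto
    then show "real (card {f \<in> good T. bad B' f}) \<le> x * real (card (good T))"
      using T less.prems by (intro less.hyps) (auto simp: S1_def S2_def)
  qed (use x in \<open>auto simp: S2_def\<close>)
  also have "S2 \<union> S1 = S" by (auto simp: S1_def S2_def)
  finally show ?case .
qed

theorem ex_good: "\<exists>f \<in> \<Omega>. \<forall>B\<in>I. \<not> bad B f"
proof -
  obtain x where x: "0 \<le> x" "x < 1" "1 / (exp 1 * (real d + 1)) \<le> x * (1 - x) ^ d"
    using lll_threshold by blast
  have "(1 - x) ^ card I * real (card (good {})) \<le> real (card (good ({} \<union> I)))"
    by (rule good_chain) (use fin x bad_given_good[OF x] in auto)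
  moreover have "card (good {}) > 0"
    using q fin by (auto simp: good_def card_PiE)
  ultimately have "card (good I) > 0"
    using x by (smt (verit) mult_pos_pos of_nat_0_less_iff sup_bot_left zero_less_power)
  then have "good I \<noteq> {}" by auto
  then show ?thesis by (auto simp: good_def)
qed

end

text \<open>The functions that avoid one event form a clopen subset of the compact product space of all
  functions into \<open>{..<q}\<close>, so the finite version and compactness give the infinite one.\<close>

theorem infinite_lovasz_local_lemma:
  fixes I :: "'b set" and dm :: "'b \<Rightarrow> 'a set" and bad :: "'b \<Rightarrow> ('a \<Rightarrow> nat) \<Rightarrow> bool" and q d :: nat
  assumes q: "q > 0"
    and fin: "\<And>B. B \<in> I \<Longrightarrow> finite (dm B)"
    and dep: "\<And>B f g. B \<in> I \<Longrightarrow> (\<And>x. x \<in> dm B \<Longrightarrow> f x = g x) \<Longrightarrow> bad B f \<longleftrightarrow> bad B g"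
    and deg: "\<And>B. B \<in> I \<Longrightarrow> finite {B' \<in> I. B' \<noteq> B \<and> dm B' \<inter> dm B \<noteq> {}} \<and>
      card {B' \<in> I. B' \<noteq> B \<and> dm B' \<inter> dm B \<noteq> {}} \<le> d"
    and prob: "\<And>B. B \<in> I \<Longrightarrow>
      real (card {g \<in> dm B \<rightarrow>\<^sub>E {..<q}. bad B g}) \<le> 1 / (exp 1 * (real d + 1)) * real q ^ card (dm B)"
  shows "\<exists>f. (\<forall>x. f x < q) \<and> (\<forall>B\<in>I. \<not> bad B f)"
proof -
  define T where "T = product_topology (\<lambda>_. discrete_topology {..<q}) (UNIV :: 'a set)"
  have top: "topspace T = {f. \<forall>x. f x < q}" by (auto simp: T_def)
  have comp: "compact_space T"
    unfolding T_def by (simp add: compact_space_product_topology compact_space_discrete_topology)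
  define Cl where "Cl B = {f \<in> topspace T. \<not> bad B f}" for B
  have cl: "closedin T (Cl B)" if B: "B \<in> I" for B
    unfolding closedin_def
  proof
    show "Cl B \<subseteq> topspace T" by (auto simp: Cl_def)
    show "openin T (topspace T - Cl B)"
    proof (subst openin_subopen, intro ballI)
      fix f assume f: "f \<in> topspace T - Cl B"
      define N where "N = topspace T \<inter> (\<Inter>x\<in>dm B. {g \<in> topspace T. g x \<in> {f x}})"
      have "openin T {g \<in> topspace T. g x \<in> {f x}}" for x
      proof (rule openin_continuous_map_preimage)
        show "continuous_map T (discrete_topology {..<q}) (\<lambda>g. g x)"
          unfolding T_def by (rule continuous_map_product_projection) simp
        show "openin (discrete_topology {..<q}) {f x}" using f top by auto
      qed
      then have "openin T N" unfolding N_def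
        using fin[OF B] by (cases "dm B = {}") (auto intro!: openin_Int openin_INT)
      moreover have "f \<in> N" using f by (auto simp: N_def)
      moreover have "N \<subseteq> topspace T - Cl B"
      proof
        fix g assume g: "g \<in> N"
        then have "bad B g \<longleftrightarrow> bad B f" by (intro dep[OF B]) (auto simp: N_def)
        then show "g \<in> topspace T - Cl B" using f g by (auto simp: Cl_def N_def)
      qed
      ultimately show "\<exists>N. openin T N \<and> f \<in> N \<and> N \<subseteq> topspace T - Cl B" by blast
    qed
  qed
  have fip: "topspace T \<inter> (\<Inter>B\<in>F. Cl B) \<noteq> {}" if F: "finite F" "F \<subseteq> I" for F
  proof -
    interpret finite_lovasz_local_lemma "\<Union>B\<in>F. dm B" F dm bad q d
    proof
      fix B assume B: "B \<in> F"
      then have BI: "B \<in> I" using F by auto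
      have "card {B' \<in> F. B' \<noteq> B \<and> dm B' \<inter> dm B \<noteq> {}} \<le> card {B' \<in> I. B' \<noteq> B \<and> dm B' \<inter> dm B \<noteq> {}}"
        using deg[OF BI] F by (intro card_mono) auto
      then show "card {B' \<in> F. B' \<noteq> B \<and> dm B' \<inter> dm B \<noteq> {}} \<le> d" using deg[OF BI] by linarith
      show "real (card {g \<in> dm B \<rightarrow>\<^sub>E {..<q}. bad B g}) \<le> 1 / (exp 1 * (real d + 1)) * real q ^ card (dm B)"
        by (rule prob[OF BI])
      show "bad B f \<longleftrightarrow> bad B g" if "\<And>x. x \<in> dm B \<Longrightarrow> f x = g x" for f g by (rule dep[OF BI that])
    qed (use F fin q in auto)
    obtain f where f: "f \<in> (\<Union>B\<in>F. dm B) \<rightarrow>\<^sub>E {..<q}" "\<forall>B\<in>F. \<not> bad B f" using ex_good by blast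
    define f' where "f' x = (if x \<in> (\<Union>B\<in>F. dm B) then f x else 0)" for x
    have f'q: "f' x < q" for x using f(1) q unfolding f'_def by (auto simp: PiE_iff)
    have "\<not> bad B f'" if B: "B \<in> F" for B
    proof -
      have "bad B f' \<longleftrightarrow> bad B f" by (rule dep) (use B F in \<open>auto simp: f'_def\<close>)
      then show ?thesis using f(2) B by simp
    qed
    then have "f' \<in> topspace T \<inter> (\<Inter>B\<in>F. Cl B)" using f'q top by (auto simp: Cl_def)
    then show ?thesis by blast
  qed
  have "\<Inter>(insert (topspace T) (Cl ` I)) \<noteq> {}"
  proof -
    have "\<Inter>\<F> \<noteq> {}" if \<F>: "finite \<F>" "\<F> \<subseteq> insert (topspace T) (Cl ` I)" for \<F>
    proof -
      have "finite (\<F> - {topspace T})" "\<F> - {topspace T} \<subseteq> Cl ` I" using \<F> by auto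
      then obtain F where F: "F \<subseteq> I" "finite F" "\<F> - {topspace T} = Cl ` F"
        using finite_subset_image by metis
      have "topspace T \<inter> (\<Inter>B\<in>F. Cl B) \<subseteq> \<Inter>\<F>" using F(3) by blast
      then show ?thesis using fip[OF F(2,1)] by blast
    qed
    then have "(\<forall>C\<in>insert (topspace T) (Cl ` I). closedin T C) \<and>
        (\<forall>\<F>. finite \<F> \<and> \<F> \<subseteq> insert (topspace T) (Cl ` I) \<longrightarrow> \<Inter>\<F> \<noteq> {})"
      using cl by auto
    from mp[OF spec[OF comp[unfolded compact_space_fip]] this] show ?thesis .
  qed
  then obtain f where "f \<in> \<Inter>(insert (topspace T) (Cl ` I))" by blast
  then show ?thesis using top by (intro exI[of _ f]) (auto simp: Cl_def)
qed

section \<open>Borel families of constraints\<close>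

text \<open>The Borel structure on finite sets is the quotient of that on tuples of distinct points, so a set-valued map
is Borel as soon as it lists its values injectively in a Borel way.\<close>

lemma measurable_fin_subsets_image:
  fixes k :: nat
  assumes "\<And>i. i < k \<Longrightarrow> \<phi> i \<in> measurable M Y"
    and inj: "\<And>w. w \<in> space M \<Longrightarrow> inj_on (\<lambda>i. \<phi> i w) {..<k}"
  shows "(\<lambda>w. (\<lambda>i. \<phi> i w) ` {..<k}) \<in> measurable M (fin_subsets Y)"
proof (rule measurableI)
  define \<Phi> where "\<Phi> w = restrict (\<lambda>i. \<phi> i w) {..<k}" for w
  have sp: "\<phi> i w \<in> space Y" if "i < k" "w \<in> space M" for i w
    using measurable_space[OF assms(1)] that by blast
  show "(\<lambda>i. \<phi> i w) ` {..<k} \<in> space (fin_subsets Y)" if "w \<in> space M" for w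
    using that sp by (auto simp: space_fin_subsets Fpow_def)
  have \<Phi>: "\<Phi> \<in> measurable M (distinct_tuples k Y)"
    unfolding distinct_tuples_def
  proof (rule measurable_restrict_space2)
    show "\<Phi> \<in> space M \<rightarrow> {x. inj_on x {..<k}}"
      using inj by (auto simp: \<Phi>_def inj_on_restrict_eq)
    show "\<Phi> \<in> measurable M (Pi\<^sub>M {..<k} (\<lambda>_. Y))"
      unfolding \<Phi>_def by (rule measurable_restrict) (use assms(1) in auto)
  qed
  fix A assume "A \<in> sets (fin_subsets Y)"
  then have "(\<lambda>x. x ` {..<k}) -` A \<inter> space (distinct_tuples k Y) \<in> sets (distinct_tuples k Y)"
    unfolding sets_fin_subsets by blast
  from measurable_sets[OF \<Phi> this]
  have "\<Phi> -` ((\<lambda>x. x ` {..<k}) -` A \<inter> space (distinct_tuples k Y)) \<inter> space M \<in> sets M" .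
  moreover have "\<Phi> -` ((\<lambda>x. x ` {..<k}) -` A \<inter> space (distinct_tuples k Y)) \<inter> space M =
      (\<lambda>w. (\<lambda>i. \<phi> i w) ` {..<k}) -` A \<inter> space M"
    using measurable_space[OF \<Phi>] by (auto simp: \<Phi>_def)
  ultimately show "(\<lambda>w. (\<lambda>i. \<phi> i w) ` {..<k}) -` A \<inter> space M \<in> sets M" by simp
qed

text \<open>A nonempty constraint is described by an enumeration \<open>w 0, \<dots>, w (k - 1)\<close> of its domain together with
a finite set \<open>b\<close> of patterns \<open>{..<k} \<rightarrow> {..<q}\<close>. For fixed \<open>k\<close> and \<open>b\<close>, of which there are countably
many, this turns a set of constraints into a set of tuples.\<close>

definition tuple_graph :: "nat \<Rightarrow> (nat \<Rightarrow> 'a) \<Rightarrow> (nat \<Rightarrow> nat) \<Rightarrow> ('a \<times> nat) set" where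
  "tuple_graph k w g = (\<lambda>i. (w i, g i)) ` {..<k}"

definition inst :: "nat \<Rightarrow> (nat \<Rightarrow> 'a) \<Rightarrow> (nat \<Rightarrow> nat) set \<Rightarrow> ('a \<times> nat) set set" where
  "inst k w b = tuple_graph k w ` b"

abbreviation patterns :: "nat \<Rightarrow> nat \<Rightarrow> (nat \<Rightarrow> nat) set" where
  "patterns q k \<equiv> {..<k} \<rightarrow>\<^sub>E {..<q}"

lemma tuple_graph_mem:
  assumes "inj_on w {..<k}" "i < k" shows "(w i, v) \<in> tuple_graph k w g \<longleftrightarrow> v = g i"
  using assms unfolding tuple_graph_def by (auto dest: inj_onD)

lemma Domain_tuple_graph: "Domain (tuple_graph k w g) = w ` {..<k}"
  unfolding tuple_graph_def by auto

lemma tuple_graph_in_graph_funs: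
  assumes "inj_on w {..<k}" "g \<in> patterns q k"
  shows "tuple_graph k w g \<in> graph_funs (w ` {..<k}) q"
proof -
  have "single_valued (tuple_graph k w g)"
    using assms(1) unfolding tuple_graph_def single_valued_def by (auto dest: inj_onD)
  moreover have "tuple_graph k w g \<subseteq> w ` {..<k} \<times> {..<q}"
    using assms(2) by (auto simp: tuple_graph_def)
  ultimately show ?thesis by (simp add: graph_funs_def Domain_tuple_graph)
qed

lemma inj_on_tuple_graph:
  assumes "inj_on w {..<k}" shows "inj_on (tuple_graph k w) (patterns q k)"
proof (rule inj_onI)
  fix g h assume gh: "g \<in> patterns q k" "h \<in> patterns q k" "tuple_graph k w g = tuple_graph k w h"
  show "g = h"
  proof
    fix i show "g i = h i"
    proof (cases "i < k")
      case True
      have "(w i, g i) \<in> tuple_graph k w h"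
        unfolding gh(3)[symmetric] tuple_graph_mem[OF assms True] ..
      then show ?thesis unfolding tuple_graph_mem[OF assms True] .
    next
      case False
      then show ?thesis using PiE_arb[OF gh(1)] PiE_arb[OF gh(2)] by simp
    qed
  qed
qed

lemma inst_subset:
  assumes "inj_on w {..<k}" "b \<subseteq> patterns q k"
  shows "inst k w b \<subseteq> graph_funs (w ` {..<k}) q"
  using assms tuple_graph_in_graph_funs unfolding inst_def by blast

lemma cdom_inst: "b \<noteq> {} \<Longrightarrow> cdom (inst k w b) = w ` {..<k}"
  unfolding cdom_def inst_def by (simp add: Domain_tuple_graph)

text \<open>Any point of the domain can be made the first entry. The entries from \<open>k\<close> on are filled
with \<open>w 0\<close>, so that a constraint has only finitely many descriptions as a sequence.\<close>

lemma ex_inst: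
  assumes B: "B \<in> Const S q" and y: "y \<in> cdom B"
  shows "\<exists>k>0. \<exists>w b. b \<noteq> {} \<and> b \<subseteq> patterns q k \<and> inj_on w {..<k} \<and> (\<forall>i. w i \<in> S) \<and>
    (\<forall>i\<ge>k. w i = w 0) \<and> w 0 = y \<and> inst k w b = B"
proof -
  obtain D where D: "finite D" "D \<subseteq> S" "B \<subseteq> graph_funs D q" using B by (auto simp: Const_def Fpow_def)
  have ne: "B \<noteq> {}" using y by (auto simp: cdom_def)
  then have yD: "y \<in> D" using cdom_eq[OF D(3)] y by simp
  define k where "k = card D"
  have k: "k > 0" using D yD by (auto simp: k_def card_gt_0_iff)
  obtain h where h: "bij_betw h {..<k - 1} (D - {y})"
    using ex_bij_betw_nat_finite[of "D - {y}"] D yD by (auto simp: atLeast0LessThan k_def)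
  define w where "w i = (if i = 0 \<or> i \<ge> k then y else h (i - 1))" for i
  have hD: "h j \<in> D - {y}" if "j < k - 1" for j using h that by (auto simp: bij_betw_def)
  have inj: "inj_on w {..<k}"
  proof (rule inj_onI)
    fix i j assume ij: "i \<in> {..<k}" "j \<in> {..<k}" "w i = w j"
    show "i = j"
    proof (cases "i = 0 \<or> j = 0")
      case True
      have "m = 0" if "m < k" "w m = y" for m
      proof (rule ccontr)
        assume "m \<noteq> 0"
        then have "m - 1 < k - 1" using that by linarith
        from hD[OF this] show False using that \<open>m \<noteq> 0\<close> by (auto simp: w_def)
      qed
      then show ?thesis using True ij by (metis lessThan_iff w_def)
    next
      case False
      then have "h (i - 1) = h (j - 1)" using ij by (simp add: w_def)
      then have "i - 1 = j - 1"
        using h ij False by (intro inj_onD[of h "{..<k - 1}"]) (auto simp: bij_betw_def)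
      then show ?thesis using False by linarith
    qed
  qed
  have wD: "w i \<in> D" for i using hD[of "i - 1"] yD k by (auto simp: w_def)
  then have im: "w ` {..<k} = D"
    using D inj by (intro card_subset_eq) (auto simp: card_image k_def)
  define b where "b = {g \<in> patterns q k. tuple_graph k w g \<in> B}"
  have "inst k w b = B"
  proof (intro equalityI subsetI)
    fix u assume u: "u \<in> B"
    then have u': "u \<subseteq> D \<times> {..<q}" "single_valued u" "Domain u = D" using D by (auto simp: graph_funs_def)
    have "\<forall>i\<in>{..<k}. \<exists>v. (w i, v) \<in> u" using wD u'(3) by blast
    from bchoice[OF this] obtain g where g: "\<And>i. i < k \<Longrightarrow> (w i, g i) \<in> u" by auto
    define g' where "g' = restrict g {..<k}"
    have "g' \<in> patterns q k" using g u'(1) by (auto simp: g'_def)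
    moreover have "tuple_graph k w g' = u"
    proof (intro equalityI subsetI)
      fix z assume z: "z \<in> u"
      then obtain x v where xv: "z = (x, v)" "x \<in> D" using u'(1) by auto
      then obtain i where i: "i < k" "x = w i" using im by auto
      then have "v = g i" using g[OF i(1)] u'(2) z xv unfolding single_valued_def by blast
      then show "z \<in> tuple_graph k w g'" using i xv by (simp add: tuple_graph_mem[OF inj] g'_def)
    qed (auto simp: tuple_graph_def g'_def g)
    ultimately show "u \<in> inst k w b" using u by (auto simp: inst_def b_def)
  qed (auto simp: inst_def b_def)
  moreover then have "b \<noteq> {}" using ne by (auto simp: inst_def)
  moreover have "b \<subseteq> patterns q k" by (auto simp: b_def)
  moreover have "\<forall>i\<ge>k. w i = w 0" "w 0 = y" by (auto simp: w_def)
  moreover have "\<forall>i. w i \<in> S" using wD D(2) by auto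
  ultimately show ?thesis using k inj by (intro exI[of _ k] exI[of _ w] exI[of _ b] conjI) simp_all
qed

locale locally_finite_borel_csp = polish +
  fixes q :: nat and \<B> :: "('a \<times> nat) set set set"
  assumes borel: "borel_csp X q \<B>"
    and locally_finite: "\<And>y. finite {B \<in> \<B>. y \<in> cdom B}"
begin

lemma \<B>_Const: "\<B> \<subseteq> Const (space X) q"
  using borel by (simp add: borel_csp_def is_csp_def)

lemma finite_cdom: "B \<in> \<B> \<Longrightarrow> finite (cdom B)"
  and cdom_subset: "B \<in> \<B> \<Longrightarrow> cdom B \<subseteq> space X"
proof -
  assume "B \<in> \<B>"
  then obtain D where D: "finite D" "D \<subseteq> space X" "B \<subseteq> graph_funs D q"
    using \<B>_Const by (auto simp: Const_def Fpow_def)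
  then have "cdom B \<subseteq> D" by (auto simp: cdom_def graph_funs_def)
  then show "finite (cdom B)" "cdom B \<subseteq> space X" using D finite_subset by auto
qed

definition injective_seqs :: "nat \<Rightarrow> (nat \<Rightarrow> 'a) set" where
  "injective_seqs k = {w \<in> space W. inj_on w {..<k}}"

lemma injective_seqs_W: "injective_seqs k \<in> sets W"
proof -
  have "injective_seqs k = space W \<inter> (\<Inter>i\<in>{..<k}. \<Inter>j\<in>{..<k}. if i = j then space W else space W - {w \<in> space W. w i = w j})"
    unfolding injective_seqs_def inj_on_def by (auto split: if_splits)
  also have "\<dots> \<in> sets W"
  proof (cases "k = 0")
    case False
    then show ?thesis
      by (intro sets.Int sets.top sets.finite_INT) (auto simp: diagonal_in_W intro!: sets.Diff)
  qed simp
  finally show ?thesis .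
qed

lemma measurable_tuple_graph:
  assumes "g \<in> patterns q k"
  shows "(\<lambda>w. tuple_graph k w g) \<in> measurable (restrict_space W (injective_seqs k)) (pfun_space X q)"
  unfolding pfun_space_def
proof (rule measurable_restrict_space2)
  have sp: "space (restrict_space W (injective_seqs k)) = injective_seqs k"
    by (auto simp: space_restrict_space injective_seqs_def)
  show "(\<lambda>w. tuple_graph k w g) \<in> space (restrict_space W (injective_seqs k)) \<rightarrow> fin_pfuns (space X) q"
    unfolding sp
  proof
    fix w assume "w \<in> injective_seqs k"
    then have "w ` {..<k} \<in> Fpow (space X)" "inj_on w {..<k}"
      by (auto simp: injective_seqs_def Fpow_def space_W)
    then show "tuple_graph k w g \<in> fin_pfuns (space X) q"
      using tuple_graph_in_graph_funs[OF _ assms] unfolding fin_pfuns_def by blast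
  qed
  show "(\<lambda>w. tuple_graph k w g) \<in>
      measurable (restrict_space W (injective_seqs k)) (fin_subsets (X \<Otimes>\<^sub>M count_space {..<q}))"
    unfolding tuple_graph_def
  proof (rule measurable_fin_subsets_image)
    fix i assume "i < k"
    then have "g i \<in> {..<q}" using assms by auto
    then show "(\<lambda>w. (w i, g i)) \<in> measurable (restrict_space W (injective_seqs k)) (X \<Otimes>\<^sub>M count_space {..<q})"
      by (intro measurable_restrict_space1 measurable_Pair measurable_coord measurable_const) auto
  next
    fix w assume "w \<in> space (restrict_space W (injective_seqs k))"
    then have "inj_on w {..<k}" unfolding sp by (simp add: injective_seqs_def)
    then show "inj_on (\<lambda>i. (w i, g i)) {..<k}" by (auto simp: inj_on_def)
  qed
qed

lemma borel_instances:
  assumes b: "b \<subseteq> patterns q k"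
  shows "{w \<in> injective_seqs k. inst k w b \<in> \<B>} \<in> sets W"
proof -
  let ?M = "restrict_space W (injective_seqs k)"
  have sp: "space ?M = injective_seqs k"
    by (auto simp: space_restrict_space injective_seqs_def)
  have "finite b" using b by (rule finite_subset) (simp add: finite_PiE)
  then obtain g where g: "bij_betw g {..<card b} b"
    using ex_bij_betw_nat_finite by (metis atLeast0LessThan)
  have im: "g ` {..<card b} = b" using g by (auto simp: bij_betw_def)
  have inst: "inst k w b = (\<lambda>j. tuple_graph k w (g j)) ` {..<card b}" for w :: "nat \<Rightarrow> 'a"
  proof -
    have "inst k w b = tuple_graph k w ` (g ` {..<card b})" by (simp only: im inst_def)
    then show ?thesis by (simp only: image_image)
  qed
  have "(\<lambda>w. inst k w b) \<in> measurable ?M (const_space X q)"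
    unfolding const_space_def
  proof (rule measurable_restrict_space2)
    show "(\<lambda>w. inst k w b) \<in> space ?M \<rightarrow> Const (space X) q"
    proof
      fix w assume "w \<in> space ?M"
      then have w: "w \<in> injective_seqs k" by (simp only: sp)
      have "inst k w b \<subseteq> graph_funs (w ` {..<k}) q"
        by (rule inst_subset) (use w b in \<open>auto simp: injective_seqs_def\<close>)
      moreover have "w ` {..<k} \<in> Fpow (space X)"
        using w by (auto simp: Fpow_def injective_seqs_def space_W)
      ultimately show "inst k w b \<in> Const (space X) q" unfolding Const_def by blast
    qed
    show "(\<lambda>w. inst k w b) \<in> measurable ?M (fin_subsets (pfun_space X q))"
      unfolding inst
    proof (rule measurable_fin_subsets_image)
      fix j assume "j < card b"
      then show "(\<lambda>w. tuple_graph k w (g j)) \<in> measurable ?M (pfun_space X q)"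
        using b im by (intro measurable_tuple_graph) auto
    next
      fix w assume "w \<in> space ?M"
      then have w: "inj_on w {..<k}" unfolding sp by (simp add: injective_seqs_def)
      have "inj_on (tuple_graph k w \<circ> g) {..<card b}"
        using g b inj_on_subset[OF inj_on_tuple_graph[OF w]] by (intro comp_inj_on) (auto simp: bij_betw_def)
      then show "inj_on (\<lambda>j. tuple_graph k w (g j)) {..<card b}" by (simp add: comp_def)
    qed
  qed
  moreover have "\<B> \<in> sets (const_space X q)" using borel by (simp add: borel_csp_def)
  ultimately have "(\<lambda>w. inst k w b) -` \<B> \<inter> space ?M \<in> sets ?M" by (rule measurable_sets)
  moreover have "(\<lambda>w. inst k w b) -` \<B> \<inter> space ?M = {w \<in> injective_seqs k. inst k w b \<in> \<B>}"
    unfolding sp by auto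
  ultimately have "{w \<in> injective_seqs k. inst k w b \<in> \<B>} \<in> sets ?M" by simp
  then show ?thesis
    using injective_seqs_W sets_restrict_space_iff[of "injective_seqs k" W]
    by (simp add: Int_absorb2 sets.sets_into_space)
qed

definition tuples :: "nat \<Rightarrow> (nat \<Rightarrow> nat) set \<Rightarrow> (nat \<Rightarrow> 'a) set" where
  "tuples k b = {w \<in> injective_seqs k. inst k w b \<in> \<B>} \<inter> {w \<in> space W. \<forall>i\<ge>k. w i = w 0}"

lemma tuples_W:
  assumes "b \<subseteq> patterns q k" shows "tuples k b \<in> sets W"
proof -
  have "{w \<in> space W. \<forall>i\<ge>k. w i = w 0} = (\<Inter>n. {w \<in> space W. w (k + n) = w 0})"
  proof (intro equalityI subsetI)
    fix w assume w: "w \<in> (\<Inter>n. {w \<in> space W. w (k + n) = w 0})"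
    have "w i = w 0" if i: "i \<ge> k" for i
    proof -
      obtain n where "i = k + n" using le_Suc_ex[OF i] by blast
      then show ?thesis using w by simp
    qed
    then show "w \<in> {w \<in> space W. \<forall>i\<ge>k. w i = w 0}" using w by simp
  qed simp
  also have "\<dots> \<in> sets W" by (intro sets.countable_INT image_subsetI diagonal_in_W) simp
  finally show ?thesis unfolding tuples_def by (rule sets.Int[OF borel_instances[OF assms]])
qed

lemma finite_tuples:
  assumes "b \<noteq> {}" "k > 0" shows "finite {w \<in> tuples k b. w 0 = y}"
proof -
  define F where "F = (\<Union>B\<in>{B \<in> \<B>. y \<in> cdom B}. cdom B)"
  have F: "finite F" unfolding F_def using locally_finite finite_cdom by blast
  have "inj_on (\<lambda>w. restrict w {..<k}) {w \<in> tuples k b. w 0 = y}"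
  proof (rule inj_onI)
    fix w v assume wv: "w \<in> {w \<in> tuples k b. w 0 = y}" "v \<in> {w \<in> tuples k b. w 0 = y}"
      "restrict w {..<k} = restrict v {..<k}"
    show "w = v"
    proof
      fix i show "w i = v i"
      proof (cases "i < k")
        case True then show ?thesis using wv(3) by (metis lessThan_iff restrict_apply')
      next
        case False then show ?thesis using wv(1,2) by (auto simp: tuples_def)
      qed
    qed
  qed
  moreover have "(\<lambda>w. restrict w {..<k}) ` {w \<in> tuples k b. w 0 = y} \<subseteq> {..<k} \<rightarrow>\<^sub>E F"
  proof
    fix u assume "u \<in> (\<lambda>w. restrict w {..<k}) ` {w \<in> tuples k b. w 0 = y}"
    then obtain w where w: "w \<in> tuples k b" "w 0 = y" "u = restrict w {..<k}" by auto
    then have "inst k w b \<in> \<B>" by (simp add: tuples_def)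
    moreover have c: "cdom (inst k w b) = w ` {..<k}" using assms by (simp add: cdom_inst)
    ultimately have "w ` {..<k} \<subseteq> F" using w(2) assms(2) unfolding F_def by force
    then show "u \<in> {..<k} \<rightarrow>\<^sub>E F" using w(3) by auto
  qed
  then have "finite ((\<lambda>w. restrict w {..<k}) ` {w \<in> tuples k b. w 0 = y})"
    by (rule finite_subset) (simp add: F finite_PiE)
  ultimately show ?thesis by (simp add: finite_image_iff)
qed

text \<open>Such a property of a constraint only concerns the pattern that the constraint forms with a labelling of its domain. With
the countably many patterns and label sequences fixed, the set in question is a
projection, with finite fibres by local finiteness.\<close>

lemma constraint_property_\<A>:
  fixes f :: "'a \<Rightarrow> nat"
  assumes f: "f \<in> measurable \<A> (count_space UNIV)"
    and R: "\<And>k w b. k > 0 \<Longrightarrow> b \<noteq> {} \<Longrightarrow> b \<subseteq> patterns q k \<Longrightarrow> inj_on w {..<k} \<Longrightarrow>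
      inst k w b \<in> \<B> \<Longrightarrow> R (inst k w b) \<longleftrightarrow> Q k b (restrict (f \<circ> w) {..<k})"
  shows "{y. \<exists>B\<in>\<B>. y \<in> cdom B \<and> R B} \<in> sets \<A>"
proof -
  define Z where "Z k a = space W \<inter> (\<Inter>i\<in>{..<k}. {w \<in> space W. w i \<in> {y \<in> space \<A>. f y = a i}})" for k :: nat and a :: "nat \<Rightarrow> nat"
  have Z: "Z k a \<in> sets \<A>s" if "k > 0" for k a
  proof -
    have "{y \<in> space \<A>. f y = m} \<in> sets \<A>" for m using f by measurable
    then show ?thesis unfolding Z_def using that
      by (intro sets.Int sets.finite_INT \<A>s_coord) (auto simp: sets_W_\<A>s)
  qed
  define I where "I = (SIGMA k:{0<..}. SIGMA b:{b. b \<noteq> {} \<and> b \<subseteq> patterns q k}. {a \<in> {..<k} \<rightarrow>\<^sub>E (UNIV::nat set). Q k b a})"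
  have cI: "countable I" unfolding I_def
  proof (intro countable_SIGMA)
    fix k :: nat and b assume "k \<in> {0<..}"
    show "countable {b. b \<noteq> {} \<and> b \<subseteq> patterns q k}"
      by (rule countable_subset[of _ "Pow (patterns q k)"]) (auto intro!: countable_finite finite_PiE)
    show "countable {a \<in> {..<k} \<rightarrow>\<^sub>E (UNIV::nat set). Q k b a}"
      by (rule countable_subset[of _ "{..<k} \<rightarrow>\<^sub>E (UNIV::nat set)"]) (auto intro!: countable_PiE)
  qed auto
  have "(\<Union>(k, b, a)\<in>I. (\<lambda>w. w 0) ` (tuples k b \<inter> Z k a)) \<in> sets \<A>"
  proof (intro sets.countable_UN'[OF cI] image_subsetI)
    fix i assume "i \<in> I"
    then obtain k b a where i: "i = (k, b, a)" "k > 0" "b \<noteq> {}" "b \<subseteq> patterns q k" by (auto simp: I_def)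
    have "(\<lambda>w. w 0) ` (tuples k b \<inter> Z k a) \<in> sets \<A>"
      by (rule finite_fibre_projection) (use i tuples_W finite_tuples Z in auto)
    then show "(case i of (k, b, a) \<Rightarrow> (\<lambda>w. w 0) ` (tuples k b \<inter> Z k a)) \<in> sets \<A>" using i by simp
  qed
  moreover have "(\<Union>(k, b, a)\<in>I. (\<lambda>w. w 0) ` (tuples k b \<inter> Z k a)) = {y. \<exists>B\<in>\<B>. y \<in> cdom B \<and> R B}"
  proof (intro equalityI subsetI)
    fix y assume "y \<in> (\<Union>(k, b, a)\<in>I. (\<lambda>w. w 0) ` (tuples k b \<inter> Z k a))"
    then obtain k b a where i: "(k, b, a) \<in> I" "y \<in> (\<lambda>w. w 0) ` (tuples k b \<inter> Z k a)" by fast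
    then obtain w where *: "w \<in> tuples k b" "w \<in> Z k a" "y = w 0" by blast
    have **: "k > 0" "b \<noteq> {}" "b \<subseteq> patterns q k" "a \<in> {..<k} \<rightarrow>\<^sub>E (UNIV::nat set)" "Q k b a"
      using i(1) by (simp_all add: I_def)
    have "restrict (f \<circ> w) {..<k} = a"
      by (rule PiE_ext[of _ "{..<k}" "\<lambda>_. UNIV"]) (use * ** in \<open>auto simp: Z_def\<close>)
    moreover have "inst k w b \<in> \<B>" "inj_on w {..<k}" using *(1) by (auto simp: tuples_def injective_seqs_def)
    ultimately have "R (inst k w b)" using R ** by blast
    moreover have "y \<in> cdom (inst k w b)" using * ** by (simp add: cdom_inst)
    ultimately show "y \<in> {y. \<exists>B\<in>\<B>. y \<in> cdom B \<and> R B}" using \<open>inst k w b \<in> \<B>\<close> by blast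
  next
    fix y assume "y \<in> {y. \<exists>B\<in>\<B>. y \<in> cdom B \<and> R B}"
    then obtain B where B: "B \<in> \<B>" "y \<in> cdom B" "R B" by auto
    then obtain k w b where *: "k > 0" "b \<noteq> {}" "b \<subseteq> patterns q k" "inj_on w {..<k}" "\<forall>i. w i \<in> space X"
      "\<forall>i\<ge>k. w i = w 0" "w 0 = y" "inst k w b = B"
      using ex_inst[of B "space X" q y] \<B>_Const by blast
    define a where "a = restrict (f \<circ> w) {..<k}"
    have "Q k b a" using R[of k b w] * B unfolding a_def by simp
    then have "(k, b, a) \<in> I" using * by (auto simp: I_def a_def)
    moreover have "w \<in> tuples k b \<inter> Z k a"
      using * B by (auto simp: tuples_def injective_seqs_def space_W Z_def a_def)
    ultimately show "y \<in> (\<Union>(k, b, a)\<in>I. (\<lambda>w. w 0) ` (tuples k b \<inter> Z k a))"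
      using *(7) by (intro UN_I[of "(k, b, a)"]) auto
  qed
  ultimately show ?thesis by simp
qed

section \<open>Solving on finite components\<close>

definition adj :: "('a \<times> 'a) set" where
  "adj = {(x, y). \<exists>B\<in>\<B>. x \<in> cdom B \<and> y \<in> cdom B}"

text \<open>Neighbourhoods are governed by the labelling with the indicator function of \<open>Y\<close>.\<close>

lemma local_adj: "local_rel adj"
proof -
  have conv: "adj\<inverse> = adj" by (auto simp: adj_def)
  have "adj `` {x} = (\<Union>B\<in>{B \<in> \<B>. x \<in> cdom B}. cdom B)" for x by (auto simp: adj_def)
  then have "finite (adj `` {x})" for x using locally_finite finite_cdom by auto
  moreover have "adj \<subseteq> space X \<times> space X" using cdom_subset by (auto simp: adj_def)
  moreover have "adj `` Y \<in> sets \<A>" if Y: "Y \<in> sets \<A>" for Y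
  proof -
    have "{y. \<exists>B\<in>\<B>. y \<in> cdom B \<and> cdom B \<inter> Y \<noteq> {}} \<in> sets \<A>"
    proof (rule constraint_property_\<A>)
      have "Y = {x \<in> space \<A>. x \<in> Y}" using sets.sets_into_space[OF Y] by auto
      then show "(\<lambda>x. if x \<in> Y then 1 else 0 :: nat) \<in> measurable \<A> (count_space UNIV)"
        using Y by (intro measurable_If) auto
      fix k :: nat and w :: "nat \<Rightarrow> 'a" and b :: "(nat \<Rightarrow> nat) set" assume "b \<noteq> {}"
      then show "cdom (inst k w b) \<inter> Y \<noteq> {} \<longleftrightarrow>
          (\<exists>i<k. restrict ((\<lambda>x. if x \<in> Y then 1 else 0 :: nat) \<circ> w) {..<k} i = 1)"
        by (auto simp: cdom_inst)
    qed
    moreover have "adj `` Y = {y. \<exists>B\<in>\<B>. y \<in> cdom B \<and> cdom B \<inter> Y \<noteq> {}}" by (auto simp: adj_def)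
    ultimately show ?thesis by simp
  qed
  ultimately show ?thesis unfolding local_rel_def conv by simp
qed

sublocale graph: locally_finite_graph X \<tau> adj
proof
  show "local_rel adj" by (rule local_adj)
  show "sym adj" by (auto simp: sym_def adj_def)
qed

fun step_fun :: "(nat \<times> nat) list \<Rightarrow> 'a \<Rightarrow> nat" where
  "step_fun [] x = 0"
| "step_fun ((n, v) # es) x = (if x \<in> basic n then v else step_fun es x)"

text \<open>A countable family of measurable functions in which every function \<open>K \<rightarrow> {..<q}\<close> with finite
\<open>K\<close> has an extension.\<close>

definition approx :: "nat \<Rightarrow> 'a \<Rightarrow> nat" where
  "approx e x = step_fun (from_nat e) x mod q"

lemma approx_measurable: "approx e \<in> measurable \<A> (count_space UNIV)"
proof -
  have "step_fun es \<in> measurable \<A> (count_space UNIV)" for es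
  proof (induction es)
    case (Cons e es)
    obtain n v where e: "e = (n, v)" by (cases e)
    have "basic n = {x \<in> space \<A>. x \<in> basic n}" using basic_subset by auto
    then have "{x \<in> space \<A>. x \<in> basic n} \<in> sets \<A>" using basic_\<A> by simp
    then show ?case unfolding e step_fun.simps using Cons by (intro measurable_If) auto
  qed simp
  then show ?thesis unfolding approx_def by measurable
qed

lemma ex_approx:
  assumes "finite K" "K \<subseteq> space X" "\<And>x. x \<in> K \<Longrightarrow> g x < q"
  shows "\<exists>e. \<forall>x\<in>K. approx e x = g x"
proof -
  have "\<exists>es. \<forall>x\<in>K. step_fun es x = g x" using assms(1,2)
  proof (induction K rule: finite_induct)
    case (insert x K)
    then obtain es where es: "\<forall>x\<in>K. step_fun es x = g x" by auto
    obtain n where n: "x \<in> basic n" "basic n \<inter> K = {}"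
      using ex_basic_isolating[of K x] insert by auto
    have "\<forall>y\<in>insert x K. step_fun ((n, g x) # es) y = g y" using n es by auto
    then show ?case by blast
  qed simp
  then obtain es where es: "\<forall>x\<in>K. step_fun es x = g x" by auto
  have "\<forall>x\<in>K. approx (to_nat es) x = g x" using es assms(3) by (simp add: approx_def)
  then show ?thesis by blast
qed

text \<open>The Local Lemma yields some \<open>g\<close>, not necessarily measurable. On a finite component, \<open>g\<close> agrees with
some \<open>approx e\<close>. Let each component use the least \<open>e\<close> for which \<open>approx e\<close> violates no
condition that meets the component. Since each condition concerns only one component of \<open>U\<close>, the resulting
function is as required, and it is measurable because the set of points whose component admits \<open>e\<close> is the
complement of the saturation of a set in \<open>\<A>\<close>.\<close>

theorem measurable_lovasz_local_lemma:
  fixes bad :: "('a \<times> nat) set set \<Rightarrow> ('a \<Rightarrow> nat) \<Rightarrow> bool" and d :: nat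
  assumes q: "q > 0"
    and deg: "\<And>B. B \<in> \<B> \<Longrightarrow> finite {B' \<in> \<B>. B' \<noteq> B \<and> cdom B' \<inter> cdom B \<noteq> {}} \<and>
      card {B' \<in> \<B>. B' \<noteq> B \<and> cdom B' \<inter> cdom B \<noteq> {}} \<le> d"
    and U: "U \<in> sets \<A>"
    and C: "adj `` C \<subseteq> C" "C \<subseteq> space X" "\<And>x. x \<in> C \<Longrightarrow> finite (graph.conn U `` {x})"
    and dep: "\<And>B f g. B \<in> \<B> \<Longrightarrow> (\<And>x. x \<in> cdom B \<inter> U \<Longrightarrow> f x = g x) \<Longrightarrow> bad B f \<longleftrightarrow> bad B g"
    and meas: "\<And>f. f \<in> measurable \<A> (count_space UNIV) \<Longrightarrow> {y. \<exists>B\<in>\<B>. y \<in> cdom B \<and> bad B f} \<in> sets \<A>"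
    and prob: "\<And>B. B \<in> \<B> \<Longrightarrow> real (card {g \<in> (cdom B \<inter> U) \<rightarrow>\<^sub>E {..<q}. bad B g}) \<le>
      1 / (exp 1 * (real d + 1)) * real q ^ card (cdom B \<inter> U)"
  shows "\<exists>f \<in> measurable \<A> (count_space UNIV). (\<forall>x. f x < q) \<and> (\<forall>B\<in>\<B>. cdom B \<inter> C \<noteq> {} \<longrightarrow> \<not> bad B f)"
proof -
  have "\<exists>g. (\<forall>x. g x < q) \<and> (\<forall>B\<in>\<B>. \<not> bad B g)"
  proof (rule infinite_lovasz_local_lemma[where dm = "\<lambda>B. cdom B \<inter> U" and d = d, OF q _ dep _ prob])
    fix B assume B: "B \<in> \<B>"
    show "finite (cdom B \<inter> U)" using finite_cdom[OF B] by simp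
    have sub: "{B' \<in> \<B>. B' \<noteq> B \<and> cdom B' \<inter> U \<inter> (cdom B \<inter> U) \<noteq> {}} \<subseteq>
        {B' \<in> \<B>. B' \<noteq> B \<and> cdom B' \<inter> cdom B \<noteq> {}}" by auto
    then show "finite {B' \<in> \<B>. B' \<noteq> B \<and> cdom B' \<inter> U \<inter> (cdom B \<inter> U) \<noteq> {}} \<and>
        card {B' \<in> \<B>. B' \<noteq> B \<and> cdom B' \<inter> U \<inter> (cdom B \<inter> U) \<noteq> {}} \<le> d"
      using deg[OF B] card_mono finite_subset le_trans by (metis (no_types, lifting))
  qed
  then obtain g where g: "\<And>x. g x < q" "\<And>B. B \<in> \<B> \<Longrightarrow> \<not> bad B g" by blast
  \<comment> \<open>Points with a failure of \<open>approx e\<close>, and points in a component without such a failure.\<close>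
  define bd where "bd e = U \<inter> {y. \<exists>B\<in>\<B>. y \<in> cdom B \<and> bad B (approx e)}" for e
  define ok where "ok e = U - graph.conn U `` bd e" for e
  have ok_\<A>: "ok e \<in> sets \<A>" for e
    unfolding ok_def bd_def
    by (intro sets.Diff U graph.conn_\<A> sets.Int meas approx_measurable)
  define rank where "rank y = (LEAST e. y \<in> ok e)" for y
  define f where "f y = (if y \<in> (\<Union>e. ok e) then approx (rank y) y else 0)" for y
  have rank: "y \<in> ok (rank y)" if "y \<in> ok e" for y e
    unfolding rank_def by (rule LeastI[of "\<lambda>e. y \<in> ok e" e]) (rule that)
  have "f -` {v} \<inter> space \<A> \<in> sets \<A>" for v
  proof -
    have app: "approx e -` {v} \<inter> space \<A> \<in> sets \<A>" for e
      by (rule measurable_sets[OF approx_measurable]) simp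
    \<comment> \<open>This accounts for the default value of \<open>f\<close> where no \<open>e\<close> is admitted.\<close>
    define Z where "Z = (if v = 0 then space \<A> - (\<Union>e. ok e) else {})"
    have "space \<A> - (\<Union>e. ok e) \<in> sets \<A>"
      by (intro sets.compl_sets sets.countable_UN' image_subsetI ok_\<A>) auto
    then have Z: "Z \<in> sets \<A>" by (cases "v = 0") (auto simp: Z_def simp del: space_\<A>)
    have first: "{y. y \<in> ok e \<and> rank y = e} = ok e - (\<Union>e'\<in>{..<e}. ok e')" for e
    proof (intro equalityI subsetI)
      fix y assume y: "y \<in> {y. y \<in> ok e \<and> rank y = e}"
      then have "y \<notin> ok e'" if "e' < e" for e'
        using not_less_Least[of e' "\<lambda>e. y \<in> ok e"] that by (auto simp: rank_def)
      then show "y \<in> ok e - (\<Union>e'\<in>{..<e}. ok e')" using y by auto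
    next
      fix y assume y: "y \<in> ok e - (\<Union>e'\<in>{..<e}. ok e')"
      then have "rank y = e" unfolding rank_def
        by (intro Least_equality) (auto simp: not_less[symmetric])
      then show "y \<in> {y. y \<in> ok e \<and> rank y = e}" using y by auto
    qed
    have ok_sub: "ok e \<subseteq> space \<A>" for e using sets.sets_into_space[OF ok_\<A>] .
    have "f -` {v} \<inter> space \<A> = (\<Union>e. {y. y \<in> ok e \<and> rank y = e} \<inter> (approx e -` {v} \<inter> space \<A>)) \<union> Z"
    proof (intro equalityI subsetI)
      fix y assume y: "y \<in> f -` {v} \<inter> space \<A>"
      show "y \<in> (\<Union>e. {y. y \<in> ok e \<and> rank y = e} \<inter> (approx e -` {v} \<inter> space \<A>)) \<union> Z"
      proof (cases "y \<in> (\<Union>e. ok e)")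
        case True
        then have "y \<in> ok (rank y)" using rank by blast
        then have "y \<in> {y'. y' \<in> ok (rank y) \<and> rank y' = rank y} \<inter> (approx (rank y) -` {v} \<inter> space \<A>)"
          using y True by (auto simp: f_def)
        then show ?thesis by blast
      next
        case False then show ?thesis using y by (auto simp: f_def Z_def)
      qed
    next
      fix y assume "y \<in> (\<Union>e. {y. y \<in> ok e \<and> rank y = e} \<inter> (approx e -` {v} \<inter> space \<A>)) \<union> Z"
      then show "y \<in> f -` {v} \<inter> space \<A>"
        using ok_sub by (auto simp: f_def Z_def split: if_splits)
    qed
    also have "\<dots> \<in> sets \<A>"
      unfolding first by (intro sets.Un Z sets.countable_UN' image_subsetI sets.Int sets.Diff ok_\<A> app) auto
    finally show ?thesis .
  qed
  then have f_meas: "f \<in> measurable \<A> (count_space UNIV)"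
    by (intro measurable_count_space_eq2_countable[THEN iffD2]) auto
  have fq: "f x < q" for x using q by (simp add: f_def approx_def)
  have ex_ok: "\<exists>e. y \<in> ok e" if y: "y \<in> C" "y \<in> U" for y
  proof -
    let ?K = "graph.conn U `` {y}"
    have "?K \<subseteq> space X" using graph.conn_in sets.sets_into_space[OF U] by auto
    then obtain e where e: "\<forall>x\<in>?K. approx e x = g x"
      using ex_approx[of ?K g] C(3)[OF y(1)] g(1) by blast
    have "z \<notin> bd e" if z: "(y, z) \<in> graph.conn U" for z
    proof
      assume "z \<in> bd e"
      then obtain B where B: "B \<in> \<B>" "z \<in> cdom B" "bad B (approx e)" by (auto simp: bd_def)
      have "bad B (approx e) \<longleftrightarrow> bad B g"
      proof (rule dep[OF B(1)])
        fix x assume "x \<in> cdom B \<inter> U"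
        then have "(z, x) \<in> adj" "x \<in> U" using B by (auto simp: adj_def)
        then have "x \<in> ?K" using z graph.conn.step by blast
        then show "approx e x = g x" using e by blast
      qed
      then show False using g(2) B by blast
    qed
    then have "y \<in> ok e" using y(2) graph.conn_sym unfolding ok_def by blast
    then show ?thesis by blast
  qed
  have "\<not> bad B f" if B: "B \<in> \<B>" "cdom B \<inter> C \<noteq> {}" for B
  proof (cases "cdom B \<inter> U = {}")
    case True
    then have "bad B f \<longleftrightarrow> bad B g" by (intro dep[OF B(1)]) auto
    then show ?thesis using g(2)[OF B(1)] by simp
  next
    case False
    then obtain y where y: "y \<in> cdom B" "y \<in> U" by auto
    have "y \<in> C" using B C(1) y(1) unfolding adj_def by blast
    then obtain e0 where e0: "y \<in> ok e0" using ex_ok y by blast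
    have same: "f x = approx (rank y) x" if x: "x \<in> cdom B \<inter> U" for x
    proof -
      have "(y, x) \<in> adj" using x y B by (auto simp: adj_def)
      then have yx: "(y, x) \<in> graph.conn U"
        using x y graph.conn.refl graph.conn.step by blast
      have "x \<in> ok e \<longleftrightarrow> y \<in> ok e" for e
        using yx graph.conn_sym graph.conn_trans x y unfolding ok_def by blast
      then have "rank x = rank y" "x \<in> ok e0" using e0 unfolding rank_def by auto
      then show ?thesis by (auto simp: f_def)
    qed
    show ?thesis
    proof
      assume "bad B f"
      then have "bad B (approx (rank y))" using dep[OF B(1), of f "approx (rank y)"] same by blast
      then have "y \<in> bd (rank y)" using y B by (auto simp: bd_def)
      then show False using rank[OF e0] y(2) graph.conn.refl unfolding ok_def by blast
    qed
  qed
  then show ?thesis using f_meas fq by blast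
qed

section \<open>Fixing the variables in two stages\<close>

text \<open>The members of \<open>B\<close> that extend \<open>f\<close> on \<open>U\<close>; their number divided by \<open>q ^ card (cdom B - U)\<close> is the
conditional probability of violating \<open>B\<close> given the values of \<open>f\<close> on \<open>U\<close>.\<close>

definition compat :: "'a set \<Rightarrow> ('a \<Rightarrow> nat) \<Rightarrow> ('a \<times> nat) set set \<Rightarrow> ('a \<times> nat) set set" where
  "compat U f B = {g \<in> B. \<forall>x \<in> cdom B \<inter> U. (x, f x) \<in> g}"

definition risky :: "real \<Rightarrow> 'a set \<Rightarrow> ('a \<times> nat) set set \<Rightarrow> ('a \<Rightarrow> nat) \<Rightarrow> bool" where
  "risky \<theta> U B f \<longleftrightarrow> \<theta> * real q ^ card (cdom B - U) \<le> real (card (compat U f B))"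

lemma \<B>_graph_funs:
  assumes "B \<in> \<B>" "g \<in> B" shows "g \<in> graph_funs (cdom B) q"
proof -
  obtain D where "B \<subseteq> graph_funs D q" using assms \<B>_Const by (auto simp: Const_def)
  moreover then have "cdom B = D" using cdom_eq assms(2) by blast
  ultimately show ?thesis using assms(2) by auto
qed

lemma finite_\<B>: "B \<in> \<B> \<Longrightarrow> finite B"
  using finite_subset[OF _ finite_graph_funs[OF finite_cdom]] \<B>_graph_funs by blast

lemma compat_cong:
  "(\<And>x. x \<in> cdom B \<inter> U \<Longrightarrow> f x = g x) \<Longrightarrow> compat U f B = compat U g B"
  unfolding compat_def by auto

lemma risky_cong:
  "(\<And>x. x \<in> cdom B \<inter> U \<Longrightarrow> f x = g x) \<Longrightarrow> risky \<theta> U B f \<longleftrightarrow> risky \<theta> U B g"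
  unfolding risky_def using compat_cong[of B U f g] by simp

lemma violates_cong:
  assumes "\<And>x. x \<in> cdom B \<Longrightarrow> f x = g x" shows "violates f B \<longleftrightarrow> violates g B"
proof -
  have "(\<lambda>x. (x, f x)) ` cdom B = (\<lambda>x. (x, g x)) ` cdom B" using assms by (intro image_cong) auto
  then show ?thesis by (simp add: violates_def)
qed

text \<open>This is Markov's inequality: each member of \<open>B\<close> extends only one colouring of \<open>cdom B \<inter> U\<close>, while a
risky colouring has at least \<open>\<theta> q ^ card (cdom B - U)\<close> extensions in \<open>B\<close>.\<close>

lemma card_risky:
  assumes B: "B \<in> \<B>" and q: "q > 0" and \<theta>: "\<theta> > 0"
    and p: "real (card B) \<le> \<theta>\<^sup>2 * real q ^ card (cdom B)"
  shows "real (card {f \<in> (cdom B \<inter> U) \<rightarrow>\<^sub>E {..<q}. risky \<theta> U B f}) \<le> \<theta> * real q ^ card (cdom B \<inter> U)"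
proof -
  let ?R = "{f \<in> (cdom B \<inter> U) \<rightarrow>\<^sub>E {..<q}. risky \<theta> U B f}"
  let ?t = "\<theta> * real q ^ card (cdom B - U)"
  have finR: "finite ?R"
    by (rule finite_subset[of _ "(cdom B \<inter> U) \<rightarrow>\<^sub>E {..<q}"])
      (use finite_cdom[OF B] in \<open>auto intro!: finite_PiE\<close>)
  have "(\<Sum>f\<in>?R. card (compat U f B)) = card (\<Union>f\<in>?R. compat U f B)"
  proof (rule card_UN_disjoint[symmetric, OF finR])
    show "\<forall>f\<in>?R. finite (compat U f B)" using finite_\<B>[OF B] by (auto simp: compat_def)
    show "\<forall>f\<in>?R. \<forall>g\<in>?R. f \<noteq> g \<longrightarrow> compat U f B \<inter> compat U g B = {}"
    proof (intro ballI impI)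
      fix f g assume fg: "f \<in> ?R" "g \<in> ?R" "f \<noteq> g"
      show "compat U f B \<inter> compat U g B = {}"
      proof (rule ccontr)
        assume "compat U f B \<inter> compat U g B \<noteq> {}"
        then obtain u where u: "u \<in> compat U f B" "u \<in> compat U g B" by auto
        then have "single_valued u" using \<B>_graph_funs[OF B] by (auto simp: compat_def graph_funs_def)
        then have "f x = g x" if "x \<in> cdom B \<inter> U" for x
          using u that unfolding compat_def single_valued_def by blast
        then have "f = g" using fg by (intro PiE_ext[of f "cdom B \<inter> U" "\<lambda>_. {..<q}" g]) auto
        then show False using fg by simp
      qed
    qed
  qed
  also have "\<dots> \<le> card B" using finite_\<B>[OF B] by (intro card_mono) (auto simp: compat_def)
  finally have "(\<Sum>f\<in>?R. real (card (compat U f B))) \<le> real (card B)"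
    by (simp only: of_nat_sum[symmetric] of_nat_le_iff)
  moreover have "(\<Sum>f\<in>?R. ?t) \<le> (\<Sum>f\<in>?R. real (card (compat U f B)))"
    by (intro sum_mono) (simp add: risky_def)
  ultimately have "real (card ?R) * ?t \<le> real (card B)" by simp
  also have "\<dots> \<le> \<theta>\<^sup>2 * real q ^ (card (cdom B \<inter> U) + card (cdom B - U))"
    using p card_Int_Diff[OF finite_cdom[OF B], of U] by simp
  also have "\<dots> = (\<theta> * real q ^ card (cdom B \<inter> U)) * ?t"
    by (simp add: power_add power2_eq_square)
  finally show ?thesis by (rule mult_right_le_imp_le) (use q \<theta> in simp)
qed

text \<open>The condition that \<open>f\<close> is not risky is made part of the event. The bound then holds for every \<open>B\<close>,
including those for which the first round has failed.\<close>

lemma card_violating: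
  assumes B: "B \<in> \<B>" and \<theta>: "\<theta> > 0"
  shows "real (card {h \<in> (cdom B - U) \<rightarrow>\<^sub>E {..<q}.
      \<not> risky \<theta> U B (\<lambda>x. if x \<in> U then f x else h x) \<and> violates (\<lambda>x. if x \<in> U then f x else h x) B})
    \<le> \<theta> * real q ^ card (cdom B - U)"
proof -
  let ?glue = "\<lambda>h x. if x \<in> U then f x else h x"
  let ?S = "{h \<in> (cdom B - U) \<rightarrow>\<^sub>E {..<q}. \<not> risky \<theta> U B (?glue h) \<and> violates (?glue h) B}"
  have r: "risky \<theta> U B (?glue h) \<longleftrightarrow> risky \<theta> U B f" for h by (rule risky_cong) auto
  show ?thesis
  proof (cases "risky \<theta> U B f")
    case True
    then show ?thesis using \<theta> by (simp add: r)
  next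
    case False
    let ?gr = "\<lambda>h. (\<lambda>x. (x, ?glue h x)) ` cdom B"
    have "inj_on ?gr ?S"
    proof (rule inj_onI)
      fix h k assume hk: "h \<in> ?S" "k \<in> ?S" "?gr h = ?gr k"
      have "h x = k x" if "x \<in> cdom B - U" for x
      proof -
        have "(x, ?glue h x) \<in> ?gr k" unfolding hk(3)[symmetric] using that by blast
        then show ?thesis using that by auto
      qed
      then show "h = k" using hk(1,2) by (intro PiE_ext[of h "cdom B - U" "\<lambda>_. {..<q}" k]) auto
    qed
    then have "card ?S = card (?gr ` ?S)" by (simp add: card_image)
    also have "\<dots> \<le> card (compat U f B)"
    proof (rule card_mono)
      show "finite (compat U f B)" using finite_\<B>[OF B] by (auto simp: compat_def)
      show "?gr ` ?S \<subseteq> compat U f B"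
      proof
        fix u assume "u \<in> ?gr ` ?S"
        then obtain h where "u = ?gr h" "violates (?glue h) B" by blast
        then show "u \<in> compat U f B" by (auto simp: compat_def violates_def)
      qed
    qed
    finally have "real (card ?S) \<le> real (card (compat U f B))" by simp
    then show ?thesis using False unfolding risky_def by linarith
  qed
qed

text \<open>One label records both the value of \<open>F\<close> and, as its parity, membership in \<open>U\<close>. The two
properties of a constraint that matter are expressed in terms of such labels.\<close>

context
  fixes F :: "'a \<Rightarrow> nat" and U :: "'a set" and k :: nat and w :: "nat \<Rightarrow> 'a" and b :: "(nat \<Rightarrow> nat) set" and a :: "nat \<Rightarrow> nat"
  assumes b: "b \<noteq> {}" "b \<subseteq> patterns q k" and w: "inj_on w {..<k}"
    and a: "\<And>i. i < k \<Longrightarrow> a i = 2 * F (w i) + (if w i \<in> U then 1 else 0)"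
begin

lemma label_decode: "i < k \<Longrightarrow> a i div 2 = F (w i)" "i < k \<Longrightarrow> odd (a i) \<longleftrightarrow> w i \<in> U"
  using a[of i] by auto

lemma risky_inst:
  "risky \<theta> U (inst k w b) F \<longleftrightarrow>
     \<theta> * real q ^ card {i. i < k \<and> even (a i)} \<le> real (card {g \<in> b. \<forall>i<k. odd (a i) \<longrightarrow> g i = a i div 2})"
proof -
  have "cdom (inst k w b) - U = w ` {i. i < k \<and> even (a i)}"
    using label_decode(2) by (auto simp: cdom_inst[OF b(1)])
  moreover have "card (w ` {i. i < k \<and> even (a i)}) = card {i. i < k \<and> even (a i)}"
    by (rule card_image) (rule inj_on_subset[OF w], auto)
  moreover have "compat U F (inst k w b) = tuple_graph k w ` {g \<in> b. \<forall>i<k. odd (a i) \<longrightarrow> g i = a i div 2}"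
  proof -
    have "(\<forall>x\<in>w ` {..<k} \<inter> U. (x, F x) \<in> tuple_graph k w g) \<longleftrightarrow> (\<forall>i<k. odd (a i) \<longrightarrow> g i = a i div 2)" for g
    proof -
      have "(\<forall>x\<in>w ` {..<k} \<inter> U. (x, F x) \<in> tuple_graph k w g) \<longleftrightarrow>
          (\<forall>i<k. w i \<in> U \<longrightarrow> (w i, F (w i)) \<in> tuple_graph k w g)" by auto
      also have "\<dots> \<longleftrightarrow> (\<forall>i<k. odd (a i) \<longrightarrow> g i = a i div 2)"
        using label_decode tuple_graph_mem[OF w] by metis
      finally show ?thesis .
    qed
    then show ?thesis unfolding compat_def cdom_inst[OF b(1)] by (auto simp: inst_def)
  qed
  moreover have "card (tuple_graph k w ` {g \<in> b. \<forall>i<k. odd (a i) \<longrightarrow> g i = a i div 2}) =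
      card {g \<in> b. \<forall>i<k. odd (a i) \<longrightarrow> g i = a i div 2}"
    by (rule card_image) (rule inj_on_subset[OF inj_on_tuple_graph[OF w, of q]], use b in auto)
  ultimately show ?thesis unfolding risky_def by simp
qed

lemma violates_inst:
  "violates F (inst k w b) \<longleftrightarrow> restrict (\<lambda>i. a i div 2) {..<k} \<in> b"
proof -
  let ?g = "restrict (\<lambda>i. a i div 2) {..<k}"
  have eq: "(\<lambda>x. (x, F x)) ` cdom (inst k w b) = tuple_graph k w ?g"
    unfolding cdom_inst[OF b(1)] tuple_graph_def image_image
    by (rule image_cong) (auto simp: label_decode)
  have unique: "g = ?g" if g: "g \<in> b" "tuple_graph k w ?g = tuple_graph k w g" for g
  proof
    fix i show "g i = ?g i"
    proof (cases "i < k")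
      case True
      have "(w i, ?g i) \<in> tuple_graph k w g"
        unfolding g(2)[symmetric] tuple_graph_mem[OF w True] ..
      then show ?thesis unfolding tuple_graph_mem[OF w True] by simp
    next
      case False
      then show ?thesis using PiE_arb[of g "{..<k}" "\<lambda>_. {..<q}" i] g(1) b(2) by auto
    qed
  qed
  show ?thesis unfolding violates_def eq unfolding inst_def
  proof
    assume "tuple_graph k w ?g \<in> tuple_graph k w ` b"
    then obtain g where "g \<in> b" "tuple_graph k w ?g = tuple_graph k w g" by auto
    then show "?g \<in> b" using unique[of g] by simp
  qed (rule imageI)
qed

end

lemma risky_\<A>:
  assumes F: "F \<in> measurable \<A> (count_space UNIV)" and U: "U \<in> sets \<A>"
  shows "{y. \<exists>B\<in>\<B>. y \<in> cdom B \<and> risky \<theta> U B F} \<in> sets \<A>"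
    "{y. \<exists>B\<in>\<B>. y \<in> cdom B \<and> (\<not> risky \<theta> U B F \<and> violates F B)} \<in> sets \<A>"
proof -
  let ?lab = "\<lambda>x. 2 * F x + (if x \<in> U then 1 else 0 :: nat)"
  have "U = {x \<in> space \<A>. x \<in> U}" using sets.sets_into_space[OF U] by auto
  then have ind: "(\<lambda>x. if x \<in> U then 1 else 0 :: nat) \<in> measurable \<A> (count_space UNIV)"
    using U by (intro measurable_If) auto
  have "(\<lambda>x. (F x, if x \<in> U then 1 else 0 :: nat)) \<in> measurable \<A> (count_space UNIV \<Otimes>\<^sub>M count_space UNIV)"
    using F ind by (rule measurable_Pair)
  then have pair: "(\<lambda>x. (F x, if x \<in> U then 1 else 0 :: nat)) \<in> measurable \<A> (count_space UNIV)"
    by (simp add: pair_measure_countable)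
  have lab: "?lab \<in> measurable \<A> (count_space UNIV)"
    using measurable_compose[OF pair, of "\<lambda>(m, n). 2 * m + n" "count_space UNIV"] by simp
  let ?Q = "\<lambda>k b a. \<theta> * real q ^ card {i. i < k \<and> even (a i)} \<le>
    real (card {g \<in> b. \<forall>i<k. odd (a i) \<longrightarrow> g i = a i div 2})"
  show "{y. \<exists>B\<in>\<B>. y \<in> cdom B \<and> risky \<theta> U B F} \<in> sets \<A>"
  proof (rule constraint_property_\<A>[OF lab, where Q = ?Q])
    fix k :: nat and w :: "nat \<Rightarrow> 'a" and b :: "(nat \<Rightarrow> nat) set"
    assume *: "b \<noteq> {}" "b \<subseteq> patterns q k" "inj_on w {..<k}"
    show "risky \<theta> U (inst k w b) F \<longleftrightarrow> ?Q k b (restrict (?lab \<circ> w) {..<k})"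
      by (rule risky_inst[OF *]) simp
  qed
  show "{y. \<exists>B\<in>\<B>. y \<in> cdom B \<and> (\<not> risky \<theta> U B F \<and> violates F B)} \<in> sets \<A>"
  proof (rule constraint_property_\<A>[OF lab, where Q = "\<lambda>k b a. \<not> ?Q k b a \<and> restrict (\<lambda>i. a i div 2) {..<k} \<in> b"])
    fix k :: nat and w :: "nat \<Rightarrow> 'a" and b :: "(nat \<Rightarrow> nat) set"
    assume *: "b \<noteq> {}" "b \<subseteq> patterns q k" "inj_on w {..<k}"
    show "\<not> risky \<theta> U (inst k w b) F \<and> violates F (inst k w b) \<longleftrightarrow>
      \<not> ?Q k b (restrict (?lab \<circ> w) {..<k}) \<and> restrict (\<lambda>i. restrict (?lab \<circ> w) {..<k} i div 2) {..<k} \<in> b"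
    proof (intro arg_cong2[where f = "(\<and>)"] arg_cong[where f = Not])
      show "risky \<theta> U (inst k w b) F \<longleftrightarrow> ?Q k b (restrict (?lab \<circ> w) {..<k})"
        by (rule risky_inst[OF *]) simp
      show "violates F (inst k w b) \<longleftrightarrow> restrict (\<lambda>i. restrict (?lab \<circ> w) {..<k} i div 2) {..<k} \<in> b"
        by (rule violates_inst[OF *, where U = U]) simp
    qed
  qed
qed

text \<open>Off the invariant set \<open>C\<close>, whose complement is meager, the solution \<open>g\<close> is chosen
without regard to measurability; no constraint has points of its domain both in \<open>C\<close> and outside.\<close>

theorem ex_baire_measurable_solution:
  fixes d :: nat
  assumes q: "q > 0"
    and deg: "\<And>B. B \<in> \<B> \<Longrightarrow> finite {B' \<in> \<B>. B' \<noteq> B \<and> cdom B' \<inter> cdom B \<noteq> {}} \<and>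
      card {B' \<in> \<B>. B' \<noteq> B \<and> cdom B' \<inter> cdom B \<noteq> {}} \<le> d"
    and prob: "\<And>B. B \<in> \<B> \<Longrightarrow> real (card B) \<le> (1 / (exp 1 * (real d + 1)))\<^sup>2 * real q ^ card (cdom B)"
  shows "\<exists>f. is_solution (space X) q \<B> f \<and> baire_measurable \<tau> q f"
proof -
  define \<theta> where "\<theta> = 1 / (exp 1 * (real d + 1))"
  have \<theta>: "\<theta> > 0" by (simp add: \<theta>_def add_pos_nonneg)
  have \<theta>1: "\<theta> < 1"
  proof -
    have "1 * 1 < exp 1 * (real d + 1)" by (intro mult_less_le_imp_less) auto
    then show ?thesis by (simp add: \<theta>_def divide_less_eq)
  qed
  obtain C U where U: "U \<in> sets \<A>" and C: "C \<subseteq> space X" "meager_in \<tau> (space X - C)" "adj `` C \<subseteq> C"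
    and comps: "\<And>x. x \<in> C \<Longrightarrow> finite (graph.conn U `` {x})"
      "\<And>x. x \<in> C \<Longrightarrow> finite (graph.conn (space X - U) `` {x})"
    using graph.ex_generic_colouring by blast
  have U': "space X - U \<in> sets \<A>" using sets.compl_sets[OF U] by simp
  have "\<exists>f \<in> measurable \<A> (count_space UNIV). (\<forall>x. f x < q) \<and> (\<forall>B\<in>\<B>. cdom B \<inter> C \<noteq> {} \<longrightarrow> \<not> risky \<theta> U B f)"
  proof (rule measurable_lovasz_local_lemma[OF q deg U C(3,1) comps(1)])
    show "risky \<theta> U B f \<longleftrightarrow> risky \<theta> U B g" if "\<And>x. x \<in> cdom B \<inter> U \<Longrightarrow> f x = g x" for B f g
      by (rule risky_cong) (rule that)
    show "{y. \<exists>B\<in>\<B>. y \<in> cdom B \<and> risky \<theta> U B f} \<in> sets \<A>" if "f \<in> measurable \<A> (count_space UNIV)" for f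
      by (rule risky_\<A>[OF that U])
    show "real (card {g \<in> (cdom B \<inter> U) \<rightarrow>\<^sub>E {..<q}. risky \<theta> U B g}) \<le>
        1 / (exp 1 * (real d + 1)) * real q ^ card (cdom B \<inter> U)" if "B \<in> \<B>" for B
      using card_risky[OF that q \<theta>] prob[OF that] unfolding \<theta>_def by blast
  qed
  then obtain f0 where f0: "f0 \<in> measurable \<A> (count_space UNIV)" "\<And>x. f0 x < q"
    "\<And>B. B \<in> \<B> \<Longrightarrow> cdom B \<inter> C \<noteq> {} \<Longrightarrow> \<not> risky \<theta> U B f0" by blast
  define glue where "glue f x = (if x \<in> U then f0 x else f x)" for f :: "'a \<Rightarrow> nat" and x
  have glue_meas: "glue f \<in> measurable \<A> (count_space UNIV)" if f: "f \<in> measurable \<A> (count_space UNIV)" for f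
  proof -
    have "U = {x \<in> space \<A>. x \<in> U}" using sets.sets_into_space[OF U] by auto
    then show ?thesis unfolding glue_def[abs_def] using U f f0(1) by (intro measurable_If) auto
  qed
  have "\<exists>f \<in> measurable \<A> (count_space UNIV). (\<forall>x. f x < q) \<and>
      (\<forall>B\<in>\<B>. cdom B \<inter> C \<noteq> {} \<longrightarrow> \<not> (\<not> risky \<theta> U B (glue f) \<and> violates (glue f) B))"
  proof (rule measurable_lovasz_local_lemma[OF q deg U' C(3,1) comps(2)])
    fix B and f g :: "'a \<Rightarrow> nat" assume B: "B \<in> \<B>" and fg: "\<And>x. x \<in> cdom B \<inter> (space X - U) \<Longrightarrow> f x = g x"
    have "glue f x = glue g x" if "x \<in> cdom B" for x
      using fg[of x] that cdom_subset[OF B] by (auto simp: glue_def)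
    then show "(\<not> risky \<theta> U B (glue f) \<and> violates (glue f) B) \<longleftrightarrow> (\<not> risky \<theta> U B (glue g) \<and> violates (glue g) B)"
      using risky_cong[of B U "glue f" "glue g"] violates_cong[of B "glue f" "glue g"] by auto
  next
    fix f :: "'a \<Rightarrow> nat" assume "f \<in> measurable \<A> (count_space UNIV)"
    then show "{y. \<exists>B\<in>\<B>. y \<in> cdom B \<and> \<not> risky \<theta> U B (glue f) \<and> violates (glue f) B} \<in> sets \<A>"
      by (rule risky_\<A>(2)[OF glue_meas U])
  next
    fix B assume B: "B \<in> \<B>"
    have "cdom B \<inter> (space X - U) = cdom B - U" using cdom_subset[OF B] by auto
    then show "real (card {g \<in> (cdom B \<inter> (space X - U)) \<rightarrow>\<^sub>E {..<q}. \<not> risky \<theta> U B (glue g) \<and> violates (glue g) B})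
        \<le> 1 / (exp 1 * (real d + 1)) * real q ^ card (cdom B \<inter> (space X - U))"
      using card_violating[OF B \<theta>, of U f0] unfolding glue_def[abs_def] \<theta>_def[symmetric] by simp
  qed
  then obtain f1 where f1: "f1 \<in> measurable \<A> (count_space UNIV)" "\<And>x. f1 x < q"
    "\<And>B. B \<in> \<B> \<Longrightarrow> cdom B \<inter> C \<noteq> {} \<Longrightarrow> \<not> risky \<theta> U B (glue f1) \<Longrightarrow> \<not> violates (glue f1) B" by blast
  have good: "\<not> violates (glue f1) B" if B: "B \<in> \<B>" "cdom B \<inter> C \<noteq> {}" for B
  proof (rule f1(3)[OF B])
    have "risky \<theta> U B (glue f1) \<longleftrightarrow> risky \<theta> U B f0" by (rule risky_cong) (simp add: glue_def)
    then show "\<not> risky \<theta> U B (glue f1)" using f0(3)[OF B] by simp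
  qed
  have "\<exists>g. (\<forall>x. g x < q) \<and> (\<forall>B\<in>\<B>. \<not> violates g B)"
  proof (rule infinite_lovasz_local_lemma[where dm = cdom and d = d, OF q])
    fix B assume B: "B \<in> \<B>"
    show "finite (cdom B)" by (rule finite_cdom[OF B])
    show "finite {B' \<in> \<B>. B' \<noteq> B \<and> cdom B' \<inter> cdom B \<noteq> {}} \<and>
      card {B' \<in> \<B>. B' \<noteq> B \<and> cdom B' \<inter> cdom B \<noteq> {}} \<le> d" by (rule deg[OF B])
    show "violates f B \<longleftrightarrow> violates g B" if "\<And>x. x \<in> cdom B \<Longrightarrow> f x = g x" for f g
      by (rule violates_cong) (rule that)
    have "compat {} f B = B" for f by (simp add: compat_def)
    moreover have "\<theta>\<^sup>2 * real q ^ card (cdom B) < \<theta> * real q ^ card (cdom B)"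
      using \<theta> \<theta>1 q by (simp add: power2_eq_square)
    ultimately have "\<not> risky \<theta> {} B f" for f
      using prob[OF B] unfolding risky_def \<theta>_def[symmetric] by simp
    then show "real (card {g \<in> cdom B \<rightarrow>\<^sub>E {..<q}. violates g B}) \<le>
        1 / (exp 1 * (real d + 1)) * real q ^ card (cdom B)"
      using card_violating[OF B \<theta>, of "{}"] unfolding \<theta>_def[symmetric] by simp
  qed
  then obtain g where g: "\<And>x. g x < q" "\<And>B. B \<in> \<B> \<Longrightarrow> \<not> violates g B" by blast
  define f where "f x = (if x \<in> C then glue f1 x else g x)" for x
  have "\<not> violates f B" if B: "B \<in> \<B>" for B
  proof (cases "cdom B \<inter> C = {}")
    case True
    then have "violates f B \<longleftrightarrow> violates g B" by (intro violates_cong) (auto simp: f_def)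
    then show ?thesis using g(2)[OF B] by simp
  next
    case False
    then have "cdom B \<subseteq> C" using C(3) B unfolding adj_def by blast
    then have "violates f B \<longleftrightarrow> violates (glue f1) B" by (intro violates_cong) (auto simp: f_def)
    then show ?thesis using good[OF B False] by simp
  qed
  moreover have "f x < q" for x using f0(2) f1(2) g(1) by (simp add: f_def glue_def)
  ultimately have "is_solution (space X) q \<B> f" by (auto simp: is_solution_def)
  moreover have "baire_property \<tau> (f -` {i} \<inter> topspace \<tau>)" for i
  proof (rule baire_property_cong)
    have "glue f1 -` {i} \<inter> space \<A> \<in> sets \<A>"
      by (rule measurable_sets[OF glue_meas[OF f1(1)]]) simp
    then show "baire_property \<tau> (glue f1 -` {i} \<inter> space X)"
      using baire_property_\<A> by simp
    show "meager_in \<tau> ((glue f1 -` {i} \<inter> space X - f -` {i} \<inter> topspace \<tau>) \<union>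
        (f -` {i} \<inter> topspace \<tau> - glue f1 -` {i} \<inter> space X))"
      by (rule meager_in_subset[OF C(2)]) (auto simp: f_def topspace_eq)
  qed
  ultimately show ?thesis unfolding baire_measurable_def by blast
qed

end

text \<open>The number \<open>d\<close> is the supremum of the neighbourhood sizes rounded down, which bounds these integers as well.\<close>

theorem corollary1p33:
  fixes X :: "'a measure" and q :: nat and \<B> :: "('a \<times> nat) set set set"
    and \<tau> :: "'a topology"
  assumes "q > 0"
    and "standard_borel X"
    and "borel_csp X q \<B>"
    and "csp_d \<B> < \<infinity>"
    and "csp_p q \<B> * (csp_d \<B> + 1)\<^sup>2 \<le> ennreal (exp (- 2))"
    and "compatible_polish X \<tau>"
  shows "\<exists>f. is_solution (space X) q \<B> f \<and> baire_measurable \<tau> q f"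
proof -
  define d where "d = nat \<lfloor>enn2real (csp_d \<B>)\<rfloor>"
  have D: "csp_d \<B> = ennreal (enn2real (csp_d \<B>))" using assms(4) by simp
  have "real d \<le> enn2real (csp_d \<B>)" by (simp add: d_def)
  then have d: "ennreal (real d) \<le> csp_d \<B>" by (subst D) (rule ennreal_leI)
  have deg: "finite {B' \<in> \<B>. B' \<noteq> B \<and> cdom B' \<inter> cdom B \<noteq> {}} \<and>
      card {B' \<in> \<B>. B' \<noteq> B \<and> cdom B' \<inter> cdom B \<noteq> {}} \<le> d" if B: "B \<in> \<B>" for B
  proof -
    let ?N = "{B' \<in> \<B>. B' \<noteq> B \<and> cdom B' \<inter> cdom B \<noteq> {}}"
    have le: "emeasure (count_space UNIV) ?N \<le> csp_d \<B>"
      unfolding csp_d_def by (rule SUP_upper[OF B])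
    have fin: "finite ?N"
    proof (rule ccontr)
      assume "infinite ?N"
      then show False using le assms(4) by (simp add: emeasure_count_space)
    qed
    then have "ennreal (real (card ?N)) \<le> csp_d \<B>"
      using le by (simp add: emeasure_count_space ennreal_of_nat_eq_real_of_nat)
    then have "real (card ?N) \<le> enn2real (csp_d \<B>)"
      using enn2real_mono[of "ennreal (real (card ?N))" "csp_d \<B>"] assms(4) by simp
    then have "card ?N \<le> d" unfolding d_def by (rule le_nat_floor)
    then show ?thesis using fin by simp
  qed
  have prob: "real (card B) \<le> (1 / (exp 1 * (real d + 1)))\<^sup>2 * real q ^ card (cdom B)" if B: "B \<in> \<B>" for B
  proof -
    have c0: "cprob q B \<ge> 0" by (simp add: cprob_def)
    have "ennreal (cprob q B) \<le> csp_p q \<B>" unfolding csp_p_def by (rule SUP_upper[OF B])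
    moreover have "(ennreal (real d) + 1)\<^sup>2 \<le> (csp_d \<B> + 1)\<^sup>2"
      by (intro power_mono add_right_mono d) simp
    ultimately have "ennreal (cprob q B) * (ennreal (real d) + 1)\<^sup>2 \<le> csp_p q \<B> * (csp_d \<B> + 1)\<^sup>2"
      by (rule mult_mono) auto
    also note assms(5)
    also have "ennreal (cprob q B) * (ennreal (real d) + 1)\<^sup>2 = ennreal (cprob q B * (real d + 1)\<^sup>2)"
      using c0 by (simp add: ennreal_mult ennreal_power[symmetric])
    finally have "cprob q B * (real d + 1)\<^sup>2 \<le> exp (- 2)" by simp
    then have "cprob q B \<le> exp (- 2) / (real d + 1)\<^sup>2"
      by (simp add: pos_le_divide_eq add_pos_nonneg)
    also have "exp (- 2) / (real d + 1)\<^sup>2 = (1 / (exp 1 * (real d + 1)))\<^sup>2"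
      using exp_double[of "1 :: real"]
      by (simp add: power_mult_distrib power_divide exp_minus inverse_eq_divide)
    finally show ?thesis using assms(1) by (simp add: cprob_def pos_divide_le_eq)
  qed
  have "finite {B \<in> \<B>. y \<in> cdom B}" for y
  proof (cases "\<exists>B\<in>\<B>. y \<in> cdom B")
    case True
    then obtain B where B: "B \<in> \<B>" "y \<in> cdom B" by auto
    have "{B \<in> \<B>. y \<in> cdom B} \<subseteq> insert B {B' \<in> \<B>. B' \<noteq> B \<and> cdom B' \<inter> cdom B \<noteq> {}}" using B by auto
    then show ?thesis using deg[OF B(1)] finite_subset by blast
  next
    case False
    then have "{B \<in> \<B>. y \<in> cdom B} = {}" by auto
    then show ?thesis by (simp only: finite.emptyI)
  qed
  then interpret locally_finite_borel_csp X \<tau> q \<B>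
    by unfold_locales (use assms in auto)
  show ?thesis by (rule ex_baire_measurable_solution[OF assms(1) deg prob])
qed

end
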